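(* Let $N\ge 1$ be an integer and let $m,\sigma,p$ be real numbers with $$m>1,\qquad -2<\sigma<0,\qquad 1\le p<p_c(\sigma):=1-\frac{\sigma(m-1)}{2},$$ and, if $N=1$, assume in addition that $\sigma>-1$. Let $$\alpha=-\frac{\sigma+2}{\sigma(m-1)+2(p-1)}>0,\qquad \beta=-\frac{m-p}{\sigma(m-1)+2(p-1)}>0 .$$ There exists a unique profile $f$, solution to $$(f^m)''(\xi)+\frac{N-1}{\xi}(f^m)'(\xi)-\alpha f(\xi)+\beta\xi f'(\xi)+\xi^{\sigma}f(\xi)^p=0,$$ with the following two properties: (i) (local behavior at the origin) for some constant $D(\sigma)>0$, $$f(\xi)\sim\left[D(\sigma)-\frac{m-p}{m(N+\sigma)(\sigma+2)}\,\xi^{\sigma+2}\right]^{1/(m-p)}\qquad\text{as }\xi\to0;$$ (ii) (interface) there is a finite point $\xi_0\in(0,\infty)$ such that $f(\xi)>0$ for $\xi\in(0,\xi_0)$, $f(\xi_0)=0$ and $(f^m)'(\xi_0)=0$. Moreover, this profile $f$ is decreasing on $(0,\xi_0)$.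
   Context: The equation is the ODE satisfied by profiles of self-similar solutions $u(x,t)=t^{\alpha}f(|x|t^{-\beta})$ to $u_t=\Delta u^m+|x|^{\sigma}u^p$ in $\mathbb{R}^N\times(0,\infty)$. The ODE is required to hold classically on $(0,\xi_0)$, where $f>0$; the values of $f$ and $(f^m)'$ at $\xi_0$ are understood as limits as $\xi\to\xi_0^-$. In the stated range $\sigma(m-1)+2(p-1)<0$, $p<m$, and $N+\sigma>0$. The local behavior at the origin is understood as a two-term expansion: $f(\xi)^{m-p}=D(\sigma)-\frac{m-p}{m(N+\sigma)(\sigma+2)}\xi^{\sigma+2}+o(\xi^{\sigma+2})$ as $\xi\to0^+$. The constant $D(\sigma)$ is not prescribed; uniqueness means that there is exactly one pair (profile $f$, interface point $\xi_0$) with properties (i) and (ii). *)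

theory Defs
  imports "HOL-Analysis.Analysis" "HOL-Library.Landau_Symbols"
begin

definition ss_alpha :: "real \<Rightarrow> real \<Rightarrow> real \<Rightarrow> real" where
  "ss_alpha m \<sigma> p = - (\<sigma> + 2) / (\<sigma> * (m - 1) + 2 * (p - 1))"

definition ss_beta :: "real \<Rightarrow> real \<Rightarrow> real \<Rightarrow> real" where
  "ss_beta m \<sigma> p = - (m - p) / (\<sigma> * (m - 1) + 2 * (p - 1))"

definition crit_exp :: "real \<Rightarrow> real \<Rightarrow> real" where
  "crit_exp m \<sigma> = 1 - \<sigma> * (m - 1) / 2"

lemma ss_denominator_neg:
  assumes "p < crit_exp m \<sigma>"
  shows "\<sigma> * (m - 1) + 2 * (p - 1) < 0"
  using assms by (simp add: crit_exp_def)

lemma ss_alpha_pos: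
  assumes "-2 < \<sigma>" "p < crit_exp m \<sigma>"
  shows "ss_alpha m \<sigma> p > 0"
  unfolding ss_alpha_def
  using assms ss_denominator_neg[of p m \<sigma>] by (intro divide_neg_neg) auto

lemma p_less_m:
  assumes "m > 1" "-2 < \<sigma>" "p < crit_exp m \<sigma>"
  shows "p < m"
proof -
  have "0 < (\<sigma> + 2) * (m - 1)"
    using assms by simp
  then show ?thesis
    using ss_denominator_neg[OF assms(3)] by (simp add: algebra_simps)
qed

lemma ss_beta_pos:
  assumes "m > 1" "-2 < \<sigma>" "p < crit_exp m \<sigma>"
  shows "ss_beta m \<sigma> p > 0"
  unfolding ss_beta_def
  using p_less_m[OF assms] ss_denominator_neg[OF assms(3)] by (intro divide_neg_neg) auto

text \<open>
  The equation is required in the classical sense on \<open>(0, \<xi>\<^sub>0)\<close>. It is only meant for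
  functions positive there, so that \<open>powr\<close> is the usual real power.
\<close>
definition solves_profile_ode ::
  "nat \<Rightarrow> real \<Rightarrow> real \<Rightarrow> real \<Rightarrow> (real \<Rightarrow> real) \<Rightarrow> real \<Rightarrow> bool" where
  "solves_profile_ode N m \<sigma> p f \<xi>\<^sub>0 \<longleftrightarrow>
     (let F = (\<lambda>\<xi>. f \<xi> powr m) in
      \<forall>\<xi>\<in>{0<..<\<xi>\<^sub>0}.
        f differentiable (at \<xi>) \<and> F differentiable (at \<xi>) \<and> deriv F differentiable (at \<xi>) \<and>
        deriv (deriv F) \<xi> + (real N - 1) / \<xi> * deriv F \<xi>
          - ss_alpha m \<sigma> p * f \<xi> + ss_beta m \<sigma> p * \<xi> * deriv f \<xi>
          + \<xi> powr \<sigma> * f \<xi> powr p = 0)"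

text \<open>
  The local behaviour at the origin is a two-term expansion of \<open>f\<^bsup>m-p\<^esup>\<close>. Its second term
  vanishes at the origin, so mere asymptotic equivalence would only say that \<open>f\<close> has a
  positive limit there.
\<close>
definition behaviour_at_origin ::
  "nat \<Rightarrow> real \<Rightarrow> real \<Rightarrow> real \<Rightarrow> (real \<Rightarrow> real) \<Rightarrow> bool" where
  "behaviour_at_origin N m \<sigma> p f \<longleftrightarrow>
     (\<exists>D>0. (\<lambda>\<xi>. f \<xi> powr (m - p)
               - (D - (m - p) / (m * (real N + \<sigma>) * (\<sigma> + 2)) * \<xi> powr (\<sigma> + 2)))
             \<in> o[at_right 0](\<lambda>\<xi>. \<xi> powr (\<sigma> + 2)))"

definition interface_at :: "real \<Rightarrow> (real \<Rightarrow> real) \<Rightarrow> real \<Rightarrow> bool" where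
  "interface_at m f \<xi>\<^sub>0 \<longleftrightarrow>
     0 < \<xi>\<^sub>0 \<and> (\<forall>\<xi>\<in>{0<..<\<xi>\<^sub>0}. f \<xi> > 0) \<and>
     (f \<longlongrightarrow> 0) (at_left \<xi>\<^sub>0) \<and>
     (deriv (\<lambda>\<xi>. f \<xi> powr m) \<longlongrightarrow> 0) (at_left \<xi>\<^sub>0)"

text \<open>
  Nothing here depends on the values of \<open>f\<close> outside \<open>(0, \<xi>\<^sub>0)\<close>; hence uniqueness of a profile
  is uniqueness of \<open>\<xi>\<^sub>0\<close> together with uniqueness of the restriction of \<open>f\<close> to \<open>(0, \<xi>\<^sub>0)\<close>.
\<close>
definition is_profile ::
  "nat \<Rightarrow> real \<Rightarrow> real \<Rightarrow> real \<Rightarrow> (real \<Rightarrow> real) \<Rightarrow> real \<Rightarrow> bool" where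
  "is_profile N m \<sigma> p f \<xi>\<^sub>0 \<longleftrightarrow>
     solves_profile_ode N m \<sigma> p f \<xi>\<^sub>0 \<and> behaviour_at_origin N m \<sigma> p f \<and> interface_at m f \<xi>\<^sub>0"

end

theory Submission
  imports Defs
begin

text \<open>
  Uniqueness rests on the rescalings \<open>f\<^sub>\<lambda>(x) = \<lambda>\<^bsup>-2/(m-1)\<^esup> f(\<lambda> x)\<close>: for \<open>\<lambda> < 1\<close> they solve the equation
  with a larger reaction coefficient, hence are strict supersolutions. For small \<open>\<lambda>\<close> they lie above any
  other profile \<open>g\<close>, and increasing \<open>\<lambda>\<close> no first contact can occur before \<open>\<lambda> = 1\<close>: at the origin the
  two-term expansion forbids it, inside the maximum principle, and at a common interface an integral
  comparison. So \<open>g \<le> f\<close>, and by symmetry \<open>g = f\<close>.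

  Existence is by shooting. By scaling one may fix \<open>f(0) = 1\<close> and replace \<open>(\<alpha>, \<beta>)\<close> by
  \<open>(e \<alpha>, e \<beta>)\<close>, with \<open>e \<ge> 0\<close> as the shooting parameter. The energy
  \<open>((f\<^sup>m)')\<^sup>2/2 - e \<alpha> m/(m+1) f\<^bsup>m+1\<^esup> + m/(m+p) x\<^sup>\<sigma> f\<^bsup>m+p\<^esup>\<close> decreases because \<open>\<sigma> < 0\<close>. It becomes
  negative for large \<open>e\<close> and never for \<open>e = 0\<close>. While it is positive, \<open>f\<close> decreases, and \<open>f\<close> vanishes at
  a finite point. Both negative energy and vanishing with a nonzero slope are open conditions on \<open>e\<close>, so at
  the infimum of the parameters with negative energy \<open>f\<close> vanishes with zero slope.
\<close>

section \<open>The profile equation and its energy\<close>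

text \<open>The equation is singular at both ends. At the origin \<open>x^\<sigma>\<close> and
  \<open>(N-1)/x\<close> blow up, and for \<open>\<sigma> < -1\<close> the derivative of
  \<open>f^m\<close> is unbounded there; so the initial value problem is posed as an integral
  equation for \<open>f^m\<close> by means of the flux \<open>x^(N-1) (f^m)' + b x^N f\<close>,
  whose derivative contains no derivative of \<open>f\<close>. At the interface
  \<open>f' = (f^m)' f^(1-m) / m\<close> degenerates, so neither continuous dependence nor the
  maximum principle reaches that point. The comparison uses instead the asymptotics
  \<open>f^(m-1) ~ (m-1)/m b R (R - x)\<close>, common to any two profiles with the same interface.
  The shooting uses dependence on \<open>e\<close> only up to a point where \<open>f\<close> is
  still positive, and the energy bridges the rest. The critical exponent enters uniqueness as the
  sign of \<open>\<sigma> (m-1) + 2 (p-1)\<close>, which makes the rescalings with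
  \<open>\<lambda> < 1\<close> supersolutions. The final rescaling requires \<open>e > 0\<close>, so
  it has to be excluded separately that the critical parameter is 0, where linear term and drift are
  absent.\<close>

locale profile_equation =
  fixes N :: nat and m \<sigma> p :: real
  assumes N_ge: "N \<ge> 1" and m_gt: "m > 1" and \<sigma>_gt: "-2 < \<sigma>" and \<sigma>_neg: "\<sigma> < 0"
    and p_ge: "1 \<le> p" and p_crit: "p < crit_exp m \<sigma>" and \<sigma>_dim1: "N = 1 \<Longrightarrow> \<sigma> > -1"
begin

abbreviation \<alpha> :: real where "\<alpha> \<equiv> ss_alpha m \<sigma> p"
abbreviation \<beta> :: real where "\<beta> \<equiv> ss_beta m \<sigma> p"

lemma \<alpha>_pos: "\<alpha> > 0" using ss_alpha_pos \<sigma>_gt p_crit by blast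
lemma \<beta>_pos: "\<beta> > 0" using ss_beta_pos m_gt \<sigma>_gt p_crit by blast
lemma p_lt_m: "p < m" using p_less_m m_gt \<sigma>_gt p_crit by blast

lemma N\<sigma>_pos: "real N + \<sigma> > 0"
proof (cases "N = 1")
  case True then show ?thesis using \<sigma>_dim1 by simp
next
  case False then have "real N \<ge> 2" using N_ge by simp
  then show ?thesis using \<sigma>_gt by linarith
qed

text \<open>
  Here \<open>g\<close> plays the role of \<open>(f\<^sup>m)'\<close>; the constants \<open>a\<close>, \<open>b\<close>, \<open>k\<close> are free because
  rescaling \<open>f\<close> changes them.
\<close>
definition sol :: "real \<Rightarrow> real \<Rightarrow> real \<Rightarrow> real \<Rightarrow> (real \<Rightarrow> real) \<Rightarrow> (real \<Rightarrow> real) \<Rightarrow> bool" where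
  "sol a b k R f g \<longleftrightarrow> (\<forall>x\<in>{0<..<R}. f x > 0 \<and>
     (f has_real_derivative g x * f x powr (1 - m) / m) (at x) \<and>
     (g has_real_derivative (- ((real N - 1) / x * g x) + a * f x
        - b * x * (g x * f x powr (1 - m) / m) - k * x powr \<sigma> * f x powr p)) (at x))"

text \<open>Multiplying the equation for \<open>g\<close> by \<open>g = (f^m)'\<close> makes the
  zeroth-order terms integrable: the potential terms are the primitives of \<open>a f\<close> and
  \<open>k f^p\<close> with respect to \<open>f^m\<close>.\<close>

definition en :: "real \<Rightarrow> real \<Rightarrow> (real \<Rightarrow> real) \<Rightarrow> (real \<Rightarrow> real) \<Rightarrow> real \<Rightarrow> real" where
  "en a k f g x = (g x)\<^sup>2 / 2 - a * m / (m + 1) * f x powr (m + 1)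
     + k * m / (m + p) * (x powr \<sigma> * f x powr (m + p))"

text \<open>The divergence form of the equation: diffusion plus drift, so that the derivative in
  \<open>flux_deriv\<close> has only zeroth-order terms in \<open>f\<close>.\<close>

definition flux :: "real \<Rightarrow> (real \<Rightarrow> real) \<Rightarrow> (real \<Rightarrow> real) \<Rightarrow> real \<Rightarrow> real" where
  "flux b f g x = x powr (real N - 1) * g x + b * x powr real N * f x"

lemma solD:
  assumes "sol a b k R f g" "0 < x" "x < R"
  shows "f x > 0"
    and "(f has_real_derivative g x * f x powr (1 - m) / m) (at x)"
    and "(g has_real_derivative (- ((real N - 1) / x * g x) + a * f x
        - b * x * (g x * f x powr (1 - m) / m) - k * x powr \<sigma> * f x powr p)) (at x)"
  using assms by (auto simp: sol_def)

lemma sol_subset: "sol a b k R f g \<Longrightarrow> R' \<le> R \<Longrightarrow> sol a b k R' f g"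
  by (auto simp: sol_def)

lemma sol_isCont:
  assumes "sol a b k R f g" "0 < x" "x < R"
  shows "isCont f x" "isCont g x"
  using solD[OF assms] DERIV_isCont by blast+

lemma sol_pow_deriv:
  assumes "sol a b k R f g" "0 < x" "x < R"
  shows "((\<lambda>x. f x powr q) has_real_derivative (q / m) * f x powr (q - m) * g x) (at x)"
proof -
  note S = solD[OF assms]
  have e: "f x powr (q - m) = f x powr (q - 1) * f x powr (1 - m)"
    by (simp flip: powr_add)
  show ?thesis
    by (rule derivative_eq_intros S refl)+ (use S(1) in \<open>simp_all add: e\<close>)
qed

lemma sol_w_deriv:
  assumes "sol a b k R f g" "0 < x" "x < R"
  shows "((\<lambda>x. f x powr m) has_real_derivative g x) (at x)"
  using sol_pow_deriv[OF assms, of m] solD(1)[OF assms] m_gt by simp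

lemma en_deriv:
  assumes "sol a b k R f g" "0 < x" "x < R"
  shows "(en a k f g has_real_derivative
     (- ((real N - 1) / x * (g x)\<^sup>2) - b * x * ((g x)\<^sup>2 * f x powr (1 - m) / m)
      + k * \<sigma> * m / (m + p) * (x powr (\<sigma> - 1) * f x powr (m + p)))) (at x)"
proof -
  note S = solD[OF assms]
  have mp: "m + p > 0" "m + 1 > 0" "m > 0" using m_gt p_ge by auto
  have e1: "f x powr (m + 1 - m) = f x" "f x powr (m + p - m) = f x powr p"
    using S(1) by auto
  have d1: "((\<lambda>x. f x powr (m+1)) has_real_derivative (m+1) / m * f x * g x) (at x)"
    using sol_pow_deriv[OF assms, of "m+1"] e1 by simp
  have d2: "((\<lambda>x. f x powr (m+p)) has_real_derivative (m+p) / m * f x powr p * g x) (at x)"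
    using sol_pow_deriv[OF assms, of "m+p"] e1 by simp
  have d3: "((\<lambda>x. x powr \<sigma>) has_real_derivative \<sigma> * x powr (\<sigma> - 1)) (at x)"
    using assms(2) by (auto intro!: derivative_eq_intros)
  have "((\<lambda>x. (g x)\<^sup>2 / 2 - a * m / (m + 1) * f x powr (m + 1)
     + k * m / (m + p) * (x powr \<sigma> * f x powr (m + p))) has_real_derivative
     (2 * g x * (- ((real N - 1) / x * g x) + a * f x
        - b * x * (g x * f x powr (1 - m) / m) - k * x powr \<sigma> * f x powr p) / 2
       - a * m / (m + 1) * ((m+1) / m * f x * g x)
       + k * m / (m + p) * (x powr \<sigma> * ((m+p) / m * f x powr p * g x)
            + (\<sigma> * x powr (\<sigma> - 1)) * f x powr (m + p)))) (at x)"
    by (intro DERIV_cong[OF DERIV_add[OF DERIV_diff[OF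
        DERIV_cdivide[OF DERIV_power[OF S(3), where n = 2]] DERIV_cmult[OF d1]] DERIV_cmult[OF DERIV_mult[OF d3 d2]]]])
      (simp add: algebra_simps)
  moreover have "a * m / (m + 1) * ((m+1) / m * f x * g x) = a * f x * g x"
    using mp(2,3)[THEN less_imp_neq] by (simp add: divide_simps)
  moreover have "k * m / (m + p) * (x powr \<sigma> * ((m+p) / m * f x powr p * g x)
            + (\<sigma> * x powr (\<sigma> - 1)) * f x powr (m + p))
     = k * x powr \<sigma> * f x powr p * g x
       + k * \<sigma> * m / (m + p) * (x powr (\<sigma> - 1) * f x powr (m + p))"
    using mp(1,3)[THEN less_imp_neq] by (simp add: divide_simps) (simp add: algebra_simps)
  moreover have "2 * g x * (- ((real N - 1) / x * g x) + a * f x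
        - b * x * (g x * f x powr (1 - m) / m) - k * x powr \<sigma> * f x powr p) / 2
     = - ((real N - 1) / x * (g x)\<^sup>2) - b * x * ((g x)\<^sup>2 * f x powr (1 - m) / m)
       + a * f x * g x - k * x powr \<sigma> * f x powr p * g x"
    by (simp add: algebra_simps power2_eq_square add_divide_distrib diff_divide_distrib)
  ultimately show ?thesis
    unfolding en_def [abs_def] by (elim DERIV_cong) linarith
qed

lemma en_strict_decreasing:
  assumes "sol a b k R f g" "0 \<le> b" "0 < k" "0 < x" "x < y" "y < R"
  shows "en a k f g y < en a k f g x"
proof (rule DERIV_neg_imp_decreasing[OF assms(5)])
  fix z assume z: "x \<le> z" "z \<le> y"
  then have z': "0 < z" "z < R" using assms by auto
  have "- ((real N - 1) / z * (g z)\<^sup>2) \<le> 0"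
    using N_ge z' by (auto intro!: divide_nonneg_pos mult_nonneg_nonneg)
  moreover have "b * z * ((g z)\<^sup>2 * f z powr (1 - m) / m) \<ge> 0"
    using assms(2) z' m_gt by (auto intro!: mult_nonneg_nonneg divide_nonneg_nonneg)
  moreover have "k * \<sigma> * m / (m + p) * (z powr (\<sigma> - 1) * f z powr (m + p)) < 0"
  proof -
    have "k * m / (m+p) * (z powr (\<sigma> - 1) * f z powr (m + p)) > 0"
      using assms(3) m_gt p_ge z' solD(1)[OF assms(1) z'] by auto
    then show ?thesis using \<sigma>_neg
      by (metis (no_types, opaque_lifting) mult.assoc mult.commute mult_pos_neg times_divide_eq_right times_divide_eq_left)
  qed
  ultimately have "- ((real N - 1) / z * (g z)\<^sup>2) - b * z * ((g z)\<^sup>2 * f z powr (1 - m) / m)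
      + k * \<sigma> * m / (m + p) * (z powr (\<sigma> - 1) * f z powr (m + p)) < 0" by linarith
  then show "\<exists>d. DERIV (en a k f g) z :> d \<and> d < 0"
    using en_deriv[OF assms(1) z'] by blast
qed

lemma flux_deriv:
  assumes "sol a b k R f g" "0 < x" "x < R"
  shows "(flux b f g has_real_derivative
     ((a + real N * b) * (x powr (real N - 1) * f x)
        - k * (x powr (real N - 1 + \<sigma>) * f x powr p))) (at x)"
proof -
  note S = solD[OF assms]
  have e: "x powr (real N - 1) = x * x powr (real N - 2)" "x powr real N = x * (x * x powr (real N - 2))"
    "x powr (real N - 1 + \<sigma>) = x * x powr (real N - 2) * x powr \<sigma>"
    using assms(2) by (simp_all add: powr_diff powr_add field_simps power2_eq_square)
  have "((\<lambda>x. x powr (real N - 1)) has_real_derivative (real N - 1) * x powr (real N - 2)) (at x)"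
    using assms(2) by (auto intro!: derivative_eq_intros)
  moreover have "((\<lambda>x. x powr real N) has_real_derivative real N * x powr (real N - 1)) (at x)"
    using assms(2) by (auto intro!: derivative_eq_intros)
  ultimately show ?thesis
    unfolding flux_def [abs_def]
    by (intro DERIV_cong[OF DERIV_add[OF DERIV_mult[OF _ S(3)] DERIV_mult[OF DERIV_cmult S(2)]]])
      (use assms(2) in \<open>simp_all only: e, simp add: field_simps\<close>)
qed

text \<open>At a critical point of \<open>f\<close> where \<open>f\<^sup>m\<close> is convex, \<open>a \<ge> k x\<^sup>\<sigma> f\<^bsup>p-1\<^esup>\<close> makes the energy
  nonpositive, because \<open>p \<ge> 1\<close>.\<close>
lemma energy_pos_imp_decreasing:
  assumes S: "sol a b k R f g" and a: "0 \<le> a" and k: "0 < k"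
    and x0: "0 < x0" "x0 < R" "g x0 < 0"
    and epos: "\<And>x. x0 < x \<Longrightarrow> x < R \<Longrightarrow> en a k f g x > 0"
    and x: "x0 \<le> x" "x < R"
  shows "g x < 0"
proof (rule ccontr)
  assume "\<not> g x < 0"
  then have gx: "g x \<ge> 0" by simp
  define Z where "Z = {z \<in> {x0..x}. g z = 0}"
  have cont: "continuous_on {x0..x} g"
    using sol_isCont(2)[OF S] x0 x by (auto intro!: continuous_at_imp_continuous_on)
  have "\<exists>z. x0 \<le> z \<and> z \<le> x \<and> g z = 0"
    by (rule IVT') (use x0 gx x cont in auto)
  then have Zne: "Z \<noteq> {}" by (auto simp: Z_def)
  have "closed Z" unfolding Z_def
    using continuous_closed_preimage_constant[OF cont] by auto
  moreover have "bdd_below Z" by (auto simp: Z_def bdd_below_def)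
  ultimately have cZ: "Inf Z \<in> Z" using Zne closed_contains_Inf by blast
  \<comment> \<open>The first zero of \<open>g\<close> after \<open>x0\<close>; as \<open>g\<close>
    is negative before it, \<open>g'(c)\<close> is nonnegative.\<close>
  define c where "c = Inf Z"
  have c: "x0 \<le> c" "c \<le> x" "g c = 0" using cZ by (auto simp: Z_def c_def)
  have c0: "x0 < c" using c x0 by (cases "x0 = c") auto
  have cR: "0 < c" "c < R" using c c0 x x0 by auto
  have neg: "g z < 0" if "x0 \<le> z" "z < c" for z
  proof (rule ccontr)
    assume "\<not> g z < 0"
    then have "\<exists>y. x0 \<le> y \<and> y \<le> z \<and> g y = 0"
      by (intro IVT') (use x0 that c cont in \<open>auto intro: continuous_on_subset\<close>)
    then obtain y where "x0 \<le> y" "y \<le> z" "g y = 0" by blast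
    then have "y \<in> Z" "y < c" using that c by (auto simp: Z_def)
    then show False using cInf_lower[OF _ \<open>bdd_below Z\<close>] by (force simp: c_def)
  qed
  define d where "d = a * f c - k * c powr \<sigma> * f c powr p"
  have D: "(g has_real_derivative d) (at c)"
    using solD(3)[OF S cR] c(3) by (simp add: d_def)
  have "d \<ge> 0"
  proof (rule ccontr)
    assume "\<not> d \<ge> 0"
    then have "d < 0" by simp
    from has_real_derivative_neg_dec_left[OF D this] obtain e where
      e: "e > 0" "\<And>h. h > 0 \<Longrightarrow> h < e \<Longrightarrow> g c < g (c - h)" by auto
    define h where "h = min (e/2) (c - x0)"
    have "h > 0" "h < e" "x0 \<le> c - h" "c - h < c" using e c0 by (auto simp: h_def)
    then show False using e(2)[of h] neg[of "c - h"] c(3) by auto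
  qed
  have fc: "f c > 0" using solD(1)[OF S cR] .
  have e1: "f c powr (m+1) = f c * f c powr m" "f c powr (m+p) = f c powr p * f c powr m"
    using fc by (auto simp: powr_add)
  have m1: "m + 1 > 0" "m + p > 0" "m + p \<ge> m + 1" using m_gt p_ge by auto
  have q: "k * c powr \<sigma> * f c powr p \<ge> 0" using k by simp
  have "k * m / (m + p) * (c powr \<sigma> * f c powr (m + p))
      = m * f c powr m * ((k * c powr \<sigma> * f c powr p) / (m + p))"
    using e1 by simp
  also have "\<dots> \<le> m * f c powr m * ((a * f c) / (m + 1))"
  proof (rule mult_left_mono)
    have "(k * c powr \<sigma> * f c powr p) / (m + p) \<le> (k * c powr \<sigma> * f c powr p) / (m + 1)"
      using q m1 by (intro divide_left_mono) auto
    also have "\<dots> \<le> (a * f c) / (m + 1)"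
      using \<open>d \<ge> 0\<close> m1 by (intro divide_right_mono) (auto simp: d_def)
    finally show "(k * c powr \<sigma> * f c powr p) / (m + p) \<le> (a * f c) / (m + 1)" .
  qed (use m_gt in auto)
  also have "\<dots> = a * m / (m + 1) * f c powr (m + 1)" using e1 by simp
  finally have "en a k f g c \<le> 0" using c(3) by (simp add: en_def)
  then show False using epos[OF c0 cR(2)] by simp
qed

text \<open>The two free factors serve two ends: uniqueness ties \<open>\<mu>\<close> to
  \<open>\<nu>\<close> so that \<open>a\<close> and \<open>b\<close> stay fixed while
  \<open>k\<close> changes; existence chooses both so as to turn
  \<open>(e \<alpha>, e \<beta>, 1)\<close> into \<open>(\<alpha>, \<beta>, 1)\<close>.\<close>

lemma sol_scale:
  assumes S: "sol a b k R f g" and pos: "0 < \<mu>" "0 < \<nu>"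
  shows "sol (\<mu> powr (m - 1) * \<nu>\<^sup>2 * a) (\<mu> powr (m - 1) * \<nu>\<^sup>2 * b)
      (\<mu> powr (m - p) * \<nu> powr (\<sigma> + 2) * k) (R / \<nu>)
      (\<lambda>x. \<mu> * f (\<nu> * x)) (\<lambda>x. \<mu> powr m * \<nu> * g (\<nu> * x))"
  unfolding sol_def
proof (intro ballI conjI)
  fix x assume x: "x \<in> {0<..<R / \<nu>}"
  then have x': "0 < \<nu> * x" "\<nu> * x < R" "0 < x" using pos by (auto simp: field_simps)
  note D = solD[OF S x'(1,2)]
  show "0 < \<mu> * f (\<nu> * x)" using D(1) pos by simp
  have lin: "((\<lambda>x. \<nu> * x) has_real_derivative \<nu>) (at x)"
    by (auto intro!: derivative_eq_intros)
  have c: "\<mu> powr (1 - m) * \<mu> powr m = \<mu>" "\<mu> * (\<mu> powr (1 - m) * \<mu> powr m) = \<mu> * \<mu>"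
    "\<mu> powr m * \<mu> powr (1 - m) = \<mu>"
    using pos by (simp_all flip: powr_add)
  have "((\<lambda>x. \<mu> * f (\<nu> * x)) has_real_derivative \<mu> * ((g (\<nu>*x) * f (\<nu>*x) powr (1 - m) / m) * \<nu>)) (at x)"
    by (intro DERIV_cmult DERIV_chain2[OF D(2) lin])
  also have "\<mu> * ((g (\<nu>*x) * f (\<nu>*x) powr (1 - m) / m) * \<nu>)
     = \<mu> powr m * \<nu> * g (\<nu> * x) * (\<mu> * f (\<nu> * x)) powr (1 - m) / m"
    using pos D(1) c by (simp add: powr_mult mult_ac)
  finally show "((\<lambda>x. \<mu> * f (\<nu> * x)) has_real_derivative
       \<mu> powr m * \<nu> * g (\<nu> * x) * (\<mu> * f (\<nu> * x)) powr (1 - m) / m) (at x)" .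
  have "((\<lambda>x. \<mu> powr m * \<nu> * g (\<nu> * x)) has_real_derivative \<mu> powr m * \<nu> *
     ((- ((real N - 1) / (\<nu>*x) * g (\<nu>*x)) + a * f (\<nu>*x)
        - b * (\<nu>*x) * (g (\<nu>*x) * f (\<nu>*x) powr (1 - m) / m) - k * (\<nu>*x) powr \<sigma> * f (\<nu>*x) powr p) * \<nu>)) (at x)"
    by (intro DERIV_cmult DERIV_chain2[OF D(3) lin])
  also have "\<mu> powr m * \<nu> *
     ((- ((real N - 1) / (\<nu>*x) * g (\<nu>*x)) + a * f (\<nu>*x)
        - b * (\<nu>*x) * (g (\<nu>*x) * f (\<nu>*x) powr (1 - m) / m) - k * (\<nu>*x) powr \<sigma> * f (\<nu>*x) powr p) * \<nu>)
    = - ((real N - 1) / x * (\<mu> powr m * \<nu> * g (\<nu> * x))) + \<mu> powr (m - 1) * \<nu>\<^sup>2 * a * (\<mu> * f (\<nu> * x))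
      - \<mu> powr (m - 1) * \<nu>\<^sup>2 * b * x * (\<mu> powr m * \<nu> * g (\<nu> * x) * (\<mu> * f (\<nu> * x)) powr (1 - m) / m)
      - \<mu> powr (m - p) * \<nu> powr (\<sigma> + 2) * k * x powr \<sigma> * (\<mu> * f (\<nu> * x)) powr p"
  proof -
    have "\<mu> powr m * \<nu> * ((real N - 1) / (\<nu>*x) * g (\<nu>*x)) * \<nu> = (real N - 1) / x * (\<mu> powr m * \<nu> * g (\<nu> * x))"
      using pos x' by (simp add: field_simps)
    moreover have "\<mu> powr m * \<nu> * (a * f (\<nu>*x)) * \<nu> = \<mu> powr (m - 1) * \<nu>\<^sup>2 * a * (\<mu> * f (\<nu> * x))"
      using pos by (simp add: powr_diff power2_eq_square)
    moreover have "\<mu> powr m * \<nu> * (b * (\<nu>*x) * (g (\<nu>*x) * f (\<nu>*x) powr (1 - m) / m)) * \<nu>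
      = \<mu> powr (m - 1) * \<nu>\<^sup>2 * b * x * (\<mu> powr m * \<nu> * g (\<nu> * x) * (\<mu> * f (\<nu> * x)) powr (1 - m) / m)"
    proof -
      have "\<mu> powr (m - 1) * \<mu> powr m * \<mu> powr (1 - m) = \<mu> powr m"
        using pos by (simp flip: powr_add)
      then have "\<mu> powr (m - 1) * \<nu>\<^sup>2 * b * x * (\<mu> powr m * \<nu> * g (\<nu> * x) * (\<mu> * f (\<nu> * x)) powr (1 - m) / m)
        = \<mu> powr m * (\<nu>\<^sup>2 * b * x * (\<nu> * g (\<nu> * x) * f (\<nu> * x) powr (1 - m) / m))"
        using pos D(1) by (simp add: powr_mult mult_ac)
      then show ?thesis by (auto simp: power2_eq_square mult_ac)
    qed
    moreover have "\<mu> powr m * \<nu> * (k * (\<nu>*x) powr \<sigma> * f (\<nu>*x) powr p) * \<nu>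
      = \<mu> powr (m - p) * \<nu> powr (\<sigma> + 2) * k * x powr \<sigma> * (\<mu> * f (\<nu> * x)) powr p"
      using pos D(1) x' by (simp add: powr_mult powr_diff powr_add power2_eq_square)
    moreover have "M*n*((-A+B-C-D)*n) = -(M*n*A*n) + M*n*B*n - M*n*C*n - M*n*D*n" for M n A B C D :: real
      by (simp add: algebra_simps)
    ultimately show ?thesis by (simp only:)
  qed
  finally show "((\<lambda>x. \<mu> powr m * \<nu> * g (\<nu> * x)) has_real_derivative
      - ((real N - 1) / x * (\<mu> powr m * \<nu> * g (\<nu> * x))) + \<mu> powr (m - 1) * \<nu>\<^sup>2 * a * (\<mu> * f (\<nu> * x))
      - \<mu> powr (m - 1) * \<nu>\<^sup>2 * b * x * (\<mu> powr m * \<nu> * g (\<nu> * x) * (\<mu> * f (\<nu> * x)) powr (1 - m) / m)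
      - \<mu> powr (m - p) * \<nu> powr (\<sigma> + 2) * k * x powr \<sigma> * (\<mu> * f (\<nu> * x)) powr p) (at x)" .
qed

lemma profile_imp_sol:
  assumes "solves_profile_ode N m \<sigma> p f R" "\<forall>x\<in>{0<..<R}. f x > 0"
  shows "sol \<alpha> \<beta> 1 R f (deriv (\<lambda>x. f x powr m))"
  unfolding sol_def
proof (intro ballI conjI)
  fix x assume x: "x \<in> {0<..<R}"
  let ?F = "\<lambda>x. f x powr m"
  have fx: "f x > 0" using assms(2) x by auto
  then show "0 < f x" .
  have A: "f differentiable (at x)" "deriv ?F differentiable (at x)"
    "deriv (deriv ?F) x + (real N - 1) / x * deriv ?F x - \<alpha> * f x + \<beta> * x * deriv f x
          + x powr \<sigma> * f x powr p = 0"
    using assms(1) x by (auto simp: solves_profile_ode_def Let_def)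
  have Df: "(f has_real_derivative deriv f x) (at x)"
    using A(1) by (simp add: DERIV_deriv_iff_real_differentiable)
  have "(?F has_real_derivative m * f x powr (m - 1) * deriv f x) (at x)"
    by (rule derivative_eq_intros Df refl)+ (use fx in \<open>auto simp: Df\<close>)
  then have dF: "deriv ?F x = m * f x powr (m - 1) * deriv f x" by (rule DERIV_imp_deriv)
  have "f x powr (m - 1) * f x powr (1 - m) = 1"
    using fx by (simp flip: powr_add)
  then have df: "deriv f x = deriv ?F x * f x powr (1 - m) / m"
    using dF m_gt by (simp add: mult_ac)
  show "(f has_real_derivative deriv ?F x * f x powr (1 - m) / m) (at x)"
    using Df df by simp
  have "(deriv ?F has_real_derivative deriv (deriv ?F) x) (at x)"
    using A(2) by (simp add: DERIV_deriv_iff_real_differentiable)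
  then show "(deriv ?F has_real_derivative - ((real N - 1) / x * deriv ?F x) + \<alpha> * f x
        - \<beta> * x * (deriv ?F x * f x powr (1 - m) / m) - 1 * x powr \<sigma> * f x powr p) (at x)"
    by (rule DERIV_cong) (use A(3) df in \<open>simp add: algebra_simps\<close>)
qed

lemma sol_imp_profile:
  assumes S: "sol \<alpha> \<beta> 1 R f g"
  shows "solves_profile_ode N m \<sigma> p f R" "\<And>x. 0 < x \<Longrightarrow> x < R \<Longrightarrow> deriv (\<lambda>x. f x powr m) x = g x"
proof -
  let ?F = "\<lambda>x. f x powr m"
  show dF: "deriv ?F x = g x" if "0 < x" "x < R" for x
    using sol_w_deriv[OF S that] by (rule DERIV_imp_deriv)
  show "solves_profile_ode N m \<sigma> p f R"
    unfolding solves_profile_ode_def Let_def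
  proof (intro ballI)
    fix x assume "x \<in> {0<..<R}"
    then have x: "0 < x" "x < R" by auto
    note D = solD[OF S x]
    have ev: "\<forall>\<^sub>F y in nhds x. g y = deriv ?F y"
      using eventually_nhds_in_open[of "{0<..<R}" x] x dF
      by (auto elim!: eventually_mono)
    have D2: "(deriv ?F has_real_derivative (- ((real N - 1) / x * g x) + \<alpha> * f x
        - \<beta> * x * (g x * f x powr (1 - m) / m) - 1 * x powr \<sigma> * f x powr p)) (at x)"
      using D(3) DERIV_cong_ev[OF refl ev refl] by blast
    show "f differentiable at x \<and> ?F differentiable at x \<and> deriv ?F differentiable at x \<and>
        deriv (deriv ?F) x + (real N - 1) / x * deriv ?F x
          - \<alpha> * f x + \<beta> * x * deriv f x + x powr \<sigma> * f x powr p = 0"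
      using D(2) sol_w_deriv[OF S x] D2 DERIV_imp_deriv[OF D2] DERIV_imp_deriv[OF D(2)] dF[OF x]
      by (auto simp: real_differentiable_def algebra_simps)
  qed
qed

end

section \<open>Behaviour at the interface\<close>

text \<open>A mean value inequality up to an end point where only the limit of \<open>u\<close> is
  known. Estimates near the interface come from integrating backwards from \<open>R\<close> in this
  way.\<close>

lemma upper_bound_from_left_limit:
  fixes u u' :: "real \<Rightarrow> real"
  assumes "x < R" and d: "\<And>y. x \<le> y \<Longrightarrow> y < R \<Longrightarrow> (u has_real_derivative u' y) (at y)"
    and b: "\<And>y. x \<le> y \<Longrightarrow> y < R \<Longrightarrow> - B \<le> u' y" and l: "(u \<longlongrightarrow> 0) (at_left R)"
  shows "u x \<le> B * (R - x)"
proof -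
  define v where "v y = u y + B * y" for y
  have "v x \<le> v y" if "x < y" "y < R" for y
  proof (rule DERIV_nonneg_imp_nondecreasing[of x y v])
    show "x \<le> y" using that by simp
    fix z assume z: "x \<le> z" "z \<le> y"
    then have "(v has_real_derivative u' z + B) (at z)"
      unfolding v_def using that by (auto intro!: derivative_eq_intros d)
    then show "\<exists>e. DERIV v z :> e \<and> 0 \<le> e" using b[of z] z that by force
  qed
  then have "\<forall>\<^sub>F y in at_left R. v x \<le> v y"
    using eventually_at_left_real[OF assms(1)] by (auto elim: eventually_mono)
  moreover have "(v \<longlongrightarrow> 0 + B * R) (at_left R)"
    unfolding v_def by (intro tendsto_intros l)
  ultimately have "v x \<le> 0 + B * R" by (intro tendsto_lowerbound) auto
  then show ?thesis by (simp add: v_def algebra_simps)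
qed

lemma abs_bound_from_left_limit:
  fixes u u' :: "real \<Rightarrow> real"
  assumes "x < R" and d: "\<And>y. x \<le> y \<Longrightarrow> y < R \<Longrightarrow> (u has_real_derivative u' y) (at y)"
    and b: "\<And>y. x \<le> y \<Longrightarrow> y < R \<Longrightarrow> \<bar>u' y\<bar> \<le> B" and l: "(u \<longlongrightarrow> 0) (at_left R)"
  shows "\<bar>u x\<bar> \<le> B * (R - x)"
proof -
  have "u x \<le> B * (R - x)"
    using b by (intro upper_bound_from_left_limit[OF assms(1) d _ l]) (auto simp: abs_le_iff, force)
  moreover have "- u x \<le> B * (R - x)"
  proof (rule upper_bound_from_left_limit[OF assms(1), of "\<lambda>x. - u x" "\<lambda>x. - u' x"])
    show "((\<lambda>x. - u x) \<longlongrightarrow> 0) (at_left R)" using tendsto_minus[OF l] by simp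
  qed (use b d in \<open>auto simp: abs_le_iff intro: DERIV_minus\<close>)
  ultimately show ?thesis by simp
qed

text \<open>The tangent lies below the convex power; this later converts control of
  \<open>f1^m - f2^m\<close> into control of \<open>f1 - f2\<close>.\<close>

lemma powr_convex_lower:
  fixes x y m :: real
  assumes "0 < y" "y \<le> x" "1 < m"
  shows "m * y powr (m - 1) * (x - y) \<le> x powr m - y powr m"
proof (cases "x = y")
  case False
  then have "y < x" using assms by simp
  have "\<exists>z>y. z < x \<and> x powr m - y powr m = (x - y) * (m * z powr (m - 1))"
    by (rule MVT2[OF \<open>y < x\<close>]) (use assms in \<open>auto intro!: has_real_derivative_powr\<close>)
  then obtain z where z: "y < z" "z < x" "x powr m - y powr m = (x - y) * (m * z powr (m - 1))"
    by blast
  have "y powr (m - 1) \<le> z powr (m - 1)"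
    using z assms by (intro powr_mono2) auto
  then show ?thesis using z assms \<open>y < x\<close> by (simp add: mult_ac mult_left_mono)
qed simp

context profile_equation
begin

definition vanishing :: "real \<Rightarrow> (real \<Rightarrow> real) \<Rightarrow> (real \<Rightarrow> real) \<Rightarrow> bool" where
  "vanishing R f g \<longleftrightarrow> 0 < R \<and> (f \<longlongrightarrow> 0) (at_left R) \<and> (g \<longlongrightarrow> 0) (at_left R)"

text \<open>All terms of the energy tend to 0 at the interface and the energy decreases, so it is
  nonnegative before; comparison with the later point \<open>z\<close> makes this strict.\<close>

lemma vanishing_energy_pos:
  assumes S: "sol a b k R f g" "0 \<le> b" "0 < k" and v: "vanishing R f g"
    and x: "0 < x" "x < R"
  shows "en a k f g x > 0"
proof -
  have R: "0 < R" "(f \<longlongrightarrow> 0) (at_left R)" "(g \<longlongrightarrow> 0) (at_left R)"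
    using v by (auto simp: vanishing_def)
  define z where "z = (x + R) / 2"
  have z: "x < z" "z < R" using x by (auto simp: z_def)
  have fp: "\<forall>\<^sub>F y in at_left R. f y \<ge> 0"
    using eventually_at_left_real[OF R(1)] by (rule eventually_mono) (use solD(1)[OF S(1)] in force)
  have pw: "((\<lambda>y. f y powr q) \<longlongrightarrow> 0) (at_left R)" if "q > 0" for q
    using tendsto_powr2[OF R(2) tendsto_const fp that] that by simp
  have Rs: "((\<lambda>y. y powr \<sigma>) \<longlongrightarrow> R powr \<sigma>) (at_left R)"
    using R(1) by (intro tendsto_intros) auto
  have "(en a k f g \<longlongrightarrow> 0\<^sup>2 / 2 - a * m / (m + 1) * 0 + k * m / (m + p) * (R powr \<sigma> * 0)) (at_left R)"
    unfolding en_def [abs_def] using m_gt p_ge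
    by (intro tendsto_intros R pw Rs) auto
  then have lim: "(en a k f g \<longlongrightarrow> 0) (at_left R)" by simp
  have "\<forall>\<^sub>F y in at_left R. en a k f g y \<le> en a k f g z"
    using eventually_at_left_real[OF z(2)]
  proof (rule eventually_mono)
    fix y assume "y \<in> {z<..<R}"
    then show "en a k f g y \<le> en a k f g z"
      using en_strict_decreasing[OF S, of z y] z x by force
  qed
  then have "0 \<le> en a k f g z" using lim by (intro tendsto_upperbound[OF lim]) auto
  then show ?thesis using en_strict_decreasing[OF S x(1) z] by linarith
qed

lemma sol_decreasing:
  assumes S: "sol a b k R f g" and neg: "\<And>z. 0 < z \<Longrightarrow> z < R \<Longrightarrow> g z < 0"
    and x: "0 < x" "x < y" "y < R"
  shows "f y < f x"
proof (rule DERIV_neg_imp_decreasing[OF x(2)])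
  fix z assume z: "x \<le> z" "z \<le> y"
  then have z': "0 < z" "z < R" using x by auto
  show "\<exists>d. DERIV f z :> d \<and> d < 0"
  proof (intro exI conjI)
    show "DERIV f z :> g z * f z powr (1 - m) / m" by (rule solD(2)[OF S z'])
    show "g z * f z powr (1 - m) / m < 0"
      using solD(1)[OF S z'] neg[OF z'] m_gt by (auto intro!: divide_neg_pos mult_neg_pos)
  qed
qed

text \<open>The flux tends to 0 at \<open>R\<close> and its derivative is at most
  \<open>C f\<close>. As \<open>f\<close> decreases, integration from \<open>x\<close> to
  \<open>R\<close> gives \<open>C f(x) (R - x)\<close>, so the flux is small even relative to
  \<open>f\<close>.\<close>

lemma interface_flux_bound:
  assumes S: "sol a b k R f g" and ab: "0 \<le> a" "0 \<le> b" "0 < k" and v: "vanishing R f g"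
    and neg: "\<And>z. 0 < z \<Longrightarrow> z < R \<Longrightarrow> g z < 0"
  obtains C where "0 \<le> C" "\<And>x. R / 2 \<le> x \<Longrightarrow> x < R \<Longrightarrow> \<bar>flux b f g x\<bar> \<le> C * f x * (R - x)"
proof -
  have R: "0 < R" "(f \<longlongrightarrow> 0) (at_left R)" "(g \<longlongrightarrow> 0) (at_left R)"
    using v by (auto simp: vanishing_def)
  define C where "C = (a + real N * b) * R powr (real N - 1)
    + k * (R powr (real N - 1) * (R/2) powr \<sigma> * f (R/2) powr (p - 1))"
  have C0: "0 \<le> C" using ab by (simp add: C_def)
  have lim: "(flux b f g \<longlongrightarrow> R powr (real N - 1) * 0 + b * R powr real N * 0) (at_left R)"
    unfolding flux_def [abs_def] using R(1) by (intro tendsto_intros R) auto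
  have bnd: "\<bar>(a + real N * b) * (c powr (real N - 1) * f c)
        - k * (c powr (real N - 1 + \<sigma>) * f c powr p)\<bar> \<le> C * f c" if c: "R/2 \<le> c" "c < R" for c
  proof -
    have c0: "0 < c" using c R by linarith
    note fc = solD(1)[OF S c0 c(2)]
    have f2: "f c \<le> f (R/2)"
      using sol_decreasing[OF S neg, of "R/2" c] R c by (cases "c = R/2") auto
    have i1: "c powr (real N - 1) \<le> R powr (real N - 1)"
      using c c0 N_ge by (intro powr_mono2) auto
    have i2: "c powr \<sigma> \<le> (R/2) powr \<sigma>"
      using c R \<sigma>_neg by (intro powr_mono2') auto
    have i3: "f c powr (p - 1) \<le> f (R/2) powr (p - 1)"
      using f2 fc p_ge by (intro powr_mono2) auto
    have "f c powr p = f c powr (p - 1) * f c" using fc by (simp add: powr_diff)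
    then have "k * (c powr (real N - 1 + \<sigma>) * f c powr p)
        = k * (c powr (real N - 1) * c powr \<sigma> * f c powr (p - 1)) * f c"
      by (simp add: powr_add mult_ac)
    also have "\<dots> \<le> k * (R powr (real N - 1) * (R/2) powr \<sigma> * f (R/2) powr (p - 1)) * f c"
      using ab fc i1 i2 i3 by (intro mult_right_mono mult_left_mono mult_mono) auto
    finally have B2: "k * (c powr (real N - 1 + \<sigma>) * f c powr p) \<le> \<dots>" .
    have "(a + real N * b) * (c powr (real N - 1) * f c) \<le> (a + real N * b) * (R powr (real N - 1) * f c)"
      using ab fc i1 by (intro mult_left_mono mult_right_mono) auto
    then have B1: "(a + real N * b) * (c powr (real N - 1) * f c) \<le> (a + real N * b) * R powr (real N - 1) * f c"
      by (simp add: mult_ac)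
    have "0 \<le> (a + real N * b) * (c powr (real N - 1) * f c)"
      "0 \<le> k * (c powr (real N - 1 + \<sigma>) * f c powr p)"
      using ab fc by auto
    then show ?thesis using B1 B2 unfolding C_def by (simp add: distrib_right abs_le_iff)
  qed
  show ?thesis
  proof (rule that[OF C0])
    fix x assume x: "R / 2 \<le> x" "x < R"
    have x0: "0 < x" using x R by linarith
    show "\<bar>flux b f g x\<bar> \<le> C * f x * (R - x)"
    proof (rule abs_bound_from_left_limit[OF x(2)])
      show "(flux b f g \<longlongrightarrow> 0) (at_left R)" using lim by simp
      fix y assume y: "x \<le> y" "y < R"
      show "(flux b f g has_real_derivative ((a + real N * b) * (y powr (real N - 1) * f y)
        - k * (y powr (real N - 1 + \<sigma>) * f y powr p))) (at y)"
        using flux_deriv[OF S] x0 y by auto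
      have "f y \<le> f x" using sol_decreasing[OF S neg, of x y] x0 y by (cases "x = y") auto
      then have "C * f y \<le> C * f x" using C0 by (rule mult_left_mono)
      then show "\<bar>(a + real N * b) * (y powr (real N - 1) * f y)
        - k * (y powr (real N - 1 + \<sigma>) * f y powr p)\<bar> \<le> C * f x"
        using bnd[of y] x y by linarith
    qed
  qed
qed

text \<open>Dividing the flux bound by \<open>f\<close> gives
  \<open>g / f = - b x + O(R - x)\<close>, and \<open>g / f\<close> is, up to the factor
  \<open>(m - 1) / m\<close>, the derivative of \<open>f^(m-1)\<close>; one integration yields the
  linear leading term.\<close>

lemma interface_asymptotics:
  assumes S: "sol a b k R f g" and ab: "0 \<le> a" "0 \<le> b" "0 < k" and v: "vanishing R f g"
    and neg: "\<And>z. 0 < z \<Longrightarrow> z < R \<Longrightarrow> g z < 0"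
  obtains C where "0 \<le> C" "\<And>x. R / 2 \<le> x \<Longrightarrow> x < R \<Longrightarrow>
     \<bar>f x powr (m - 1) - (m - 1) / m * b * R * (R - x)\<bar> \<le> C * (R - x)\<^sup>2"
proof -
  have R: "0 < R" "(f \<longlongrightarrow> 0) (at_left R)" "(g \<longlongrightarrow> 0) (at_left R)"
    using v by (auto simp: vanishing_def)
  from interface_flux_bound[OF S ab v neg] obtain C where
    C: "0 \<le> C" "\<And>x. R / 2 \<le> x \<Longrightarrow> x < R \<Longrightarrow> \<bar>flux b f g x\<bar> \<le> C * f x * (R - x)" by metis
  define B where "B = (m - 1) / m * ((R/2) powr (1 - real N) * C + b)"
  have B0: "0 \<le> B" using C ab m_gt by (simp add: B_def)
  define u where "u x = f x powr (m - 1) - (m - 1) / m * b * R * (R - x)" for x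
  define u' where "u' x = (m - 1) / m * (g x / f x) + (m - 1) / m * b * R" for x
  have du: "(u has_real_derivative u' x) (at x)" if "0 < x" "x < R" for x
  proof -
    have "f x powr (m - 1 - m) = 1 / f x" using solD(1)[OF S that] by (simp add: powr_minus_divide)
    then have d: "((\<lambda>x. f x powr (m - 1)) has_real_derivative (m - 1) / m * (g x / f x)) (at x)"
      using sol_pow_deriv[OF S that, of "m - 1"] by simp
    show ?thesis unfolding u_def u'_def
      by (rule DERIV_cong[OF DERIV_diff[OF d DERIV_cmult[OF DERIV_diff[OF DERIV_const DERIV_ident]]]]) simp
  qed
  have u'b: "\<bar>u' x\<bar> \<le> B * (R - x)" if x: "R/2 \<le> x" "x < R" for x
  proof -
    have x0: "0 < x" using x R by linarith
    note fx = solD(1)[OF S x0 x(2)]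
    have e: "x powr (1 - real N) * x powr (real N - 1) = 1" "x powr (1 - real N) * x powr real N = x"
      using x0 by (simp_all flip: powr_add)
    have "x powr (1 - real N) * flux b f g x = g x + b * x * f x"
    proof -
      have "x powr (1 - real N) * flux b f g x = (x powr (1 - real N) * x powr (real N - 1)) * g x
        + b * (x powr (1 - real N) * x powr real N) * f x" by (simp add: flux_def algebra_simps)
      then show ?thesis unfolding e by simp
    qed
    then have "g x = x powr (1 - real N) * flux b f g x - b * x * f x" by simp
    then have g: "g x / f x + b * x = x powr (1 - real N) * (flux b f g x / f x)"
      using fx by (simp add: field_simps)
    have "\<bar>g x / f x + b * x\<bar> = x powr (1 - real N) * (\<bar>flux b f g x\<bar> / f x)"
      unfolding g using fx by (simp add: abs_mult)
    also have "\<dots> \<le> (R/2) powr (1 - real N) * (C * f x * (R - x) / f x)"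
      using x x0 R N_ge fx C by (intro mult_mono divide_right_mono powr_mono2') auto
    finally have h: "\<bar>g x / f x + b * x\<bar> \<le> (R/2) powr (1 - real N) * C * (R - x)" using fx by simp
    have mm: "(m - 1) / m > 0" using m_gt by simp
    have "u' x = (m - 1) / m * ((g x / f x + b * x) + b * (R - x))"
      by (simp add: u'_def algebra_simps)
    then have "\<bar>u' x\<bar> = (m - 1) / m * \<bar>(g x / f x + b * x) + b * (R - x)\<bar>"
      using m_gt by (simp add: abs_mult)
    also have "\<dots> \<le> (m - 1) / m * ((R/2) powr (1 - real N) * C * (R - x) + b * (R - x))"
    proof (rule mult_left_mono)
      have "0 \<le> b * (R - x)" using ab x by simp
      then show "\<bar>(g x / f x + b * x) + b * (R - x)\<bar> \<le> (R/2) powr (1 - real N) * C * (R - x) + b * (R - x)"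
        using h by linarith
    qed (use mm in simp)
    also have "\<dots> = B * (R - x)" unfolding B_def distrib_right[symmetric] by (simp only: mult.assoc)
    finally show ?thesis .
  qed
  have fp: "\<forall>\<^sub>F y in at_left R. f y \<ge> 0"
    using eventually_at_left_real[OF R(1)] by (rule eventually_mono) (use solD(1)[OF S(1)] in force)
  have pw: "((\<lambda>y. f y powr (m - 1)) \<longlongrightarrow> 0) (at_left R)"
    using tendsto_powr2[OF R(2) tendsto_const fp] m_gt by simp
  have "(u \<longlongrightarrow> 0 - (m - 1) / m * b * R * (R - R)) (at_left R)"
    unfolding u_def [abs_def] by (intro tendsto_intros pw)
  then have lim: "(u \<longlongrightarrow> 0) (at_left R)" by simp
  show ?thesis
  proof (rule that[OF B0])
    fix x assume x: "R / 2 \<le> x" "x < R"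
    have x0: "0 < x" using x R by linarith
    have "\<bar>u x\<bar> \<le> (B * (R - x)) * (R - x)"
    proof (rule abs_bound_from_left_limit[OF x(2) _ _ lim])
      fix y assume y: "x \<le> y" "y < R"
      show "(u has_real_derivative u' y) (at y)" using du x0 y by simp
      have "B * (R - y) \<le> B * (R - x)" using B0 y by (intro mult_left_mono) auto
      then show "\<bar>u' y\<bar> \<le> B * (R - x)" using u'b[of y] x y by linarith
    qed
    then show "\<bar>f x powr (m - 1) - (m - 1) / m * b * R * (R - x)\<bar> \<le> B * (R - x)\<^sup>2"
      by (simp add: u_def power2_eq_square)
  qed
qed

text \<open>
  With \<open>h = f\<^sub>1 - f\<^sub>2 \<ge> 0\<close> and \<open>H(x) = \<integral>\<^sub>x\<^sup>R h\<close>, the flux identity and the interface asymptotics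
  give \<open>(R - x) h \<le> q H\<close> near \<open>R\<close> for any \<open>q > 1/(m-1)\<close>, so \<open>H (R - x)\<^bsup>-q\<^esup>\<close> is nondecreasing; but
  \<open>H = O((R - x)\<^bsup>1 + 1/(m-1)\<^esup>)\<close>, which forces \<open>H = 0\<close> once \<open>q < 1 + 1/(m-1)\<close>.
\<close>
lemma same_interface_eq:
  assumes S1: "sol a b k1 R f1 g1" and S2: "sol a b k2 R f2 g2"
    and ab: "0 \<le> a" "0 < b" "0 < k2" "k2 \<le> k1"
    and v1: "vanishing R f1 g1" and v2: "vanishing R f2 g2"
    and neg1: "\<And>z. 0 < z \<Longrightarrow> z < R \<Longrightarrow> g1 z < 0" and neg2: "\<And>z. 0 < z \<Longrightarrow> z < R \<Longrightarrow> g2 z < 0"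
    and le: "\<And>z. 0 < z \<Longrightarrow> z < R \<Longrightarrow> f2 z \<le> f1 z"
  obtains r where "0 < r" "r < R" "\<And>x. r < x \<Longrightarrow> x < R \<Longrightarrow> f1 x = f2 x"
proof -
  have R: "0 < R" "(f1 \<longlongrightarrow> 0) (at_left R)" "(g1 \<longlongrightarrow> 0) (at_left R)" "(f2 \<longlongrightarrow> 0) (at_left R)" "(g2 \<longlongrightarrow> 0) (at_left R)"
    using v1 v2 by (auto simp: vanishing_def)
  define c where "c = R / 2"
  have c: "0 < c" "c < R" using R by (auto simp: c_def)
  have k1: "0 < k1" using ab by simp
  \<comment> \<open>The value 0 at \<open>R\<close> makes \<open>h\<close> continuous on
    \<open>[c, R]\<close>, so that it has an antiderivative there.\<close>
  define h where "h x = (if x < R then f1 x - f2 x else 0)" for x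
  have h0: "0 \<le> h x" if "0 < x" "x \<le> R" for x using le that by (auto simp: h_def)
  have hcont: "continuous_on {c..R} h"
  proof (rule continuous_on_IccI)
    have e: "\<forall>\<^sub>F x in at_left R. f1 x - f2 x = h x"
      using eventually_at_left_real[OF R(1)] by (rule eventually_mono) (auto simp: h_def)
    have "((\<lambda>x. f1 x - f2 x) \<longlongrightarrow> 0 - 0) (at_left R)" by (intro tendsto_intros R)
    then show "(h \<longlongrightarrow> h R) (at_left R)"
      using Lim_transform_eventually[OF _ e, of 0] by (simp add: h_def[of R])
    have cont: "(h \<longlongrightarrow> h x) (at x)" if "0 < x" "x < R" for x
    proof -
      have e: "\<forall>\<^sub>F x in at x. f1 x - f2 x = h x"
        using eventually_at_in_open'[of "{0<..<R}" x] that
        by (auto elim!: eventually_mono simp: h_def)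
      have "((\<lambda>x. f1 x - f2 x) \<longlongrightarrow> f1 x - f2 x) (at x)"
        using sol_isCont(1)[OF S1 that] sol_isCont(1)[OF S2 that] by (auto intro!: tendsto_intros simp: isCont_def)
      from Lim_transform_eventually[OF this e] show ?thesis using that by (simp add: h_def[of x])
    qed
    show "(h \<longlongrightarrow> h x) (at x)" if "c < x" "x < R" for x using cont that c by simp
    show "(h \<longlongrightarrow> h c) (at_right c)"
      using cont[OF c] by (rule tendsto_within_subset) simp
  qed (use c in simp)
  from antiderivative_continuous[OF hcont] obtain P where
    P: "\<And>x. x \<in> {c..R} \<Longrightarrow> (P has_vector_derivative h x) (at x within {c..R})" by auto
  define H where "H x = P R - P x" for x
  have dH: "(H has_real_derivative - h x) (at x)" if "c < x" "x < R" for x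
  proof -
    have "(P has_vector_derivative h x) (at x within {c..R})" using P that by simp
    then have "(P has_real_derivative h x) (at x)"
      using that at_within_interior[of x "{c..R}"] by (simp add: has_real_derivative_iff_has_vector_derivative)
    then show ?thesis unfolding H_def by (auto intro!: derivative_eq_intros)
  qed
  have "(P \<longlongrightarrow> P R) (at R within {c..R})"
    using has_vector_derivative_continuous[OF P[of R]] c by (simp add: continuous_within)
  then have "(P \<longlongrightarrow> P R) (at_left R)"
    using at_within_Icc_at_left[OF c(2)] by simp
  then have "(H \<longlongrightarrow> P R - P R) (at_left R)" unfolding H_def [abs_def] by (intro tendsto_intros)
  then have Hl: "(H \<longlongrightarrow> 0) (at_left R)" by simp
  have H0: "0 \<le> H x" if "c < x" "x < R" for x
  proof -
    have "- H x \<le> 0 * (R - x)"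
    proof (rule upper_bound_from_left_limit[OF that(2)])
      fix y assume y: "x \<le> y" "y < R"
      show "((\<lambda>x. - H x) has_real_derivative h y) (at y)"
        using DERIV_minus[OF dH[of y]] y that by simp
      show "- 0 \<le> h y" using h0[of y] y that c by simp
    qed (use tendsto_minus[OF Hl] in simp)
    then show ?thesis by simp
  qed
  have Hanti: "H y \<le> H x" if "c < x" "x \<le> y" "y < R" for x y
    by (rule DERIV_nonpos_imp_nonincreasing[of x y H]) (use dH h0 that c in \<open>force+\<close>)
  have H_f1: "H x \<le> f1 x * (R - x)" if "c < x" "x < R" for x
  proof (rule upper_bound_from_left_limit[OF that(2) dH _ Hl])
    fix y assume y: "x \<le> y" "y < R"
    then have "f1 y \<le> f1 x" "0 < f2 y"
      using sol_decreasing[OF S1 neg1, of x y] solD(1)[OF S2, of y] that c by (cases "x = y"; force)+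
    then show "- f1 x \<le> - h y" using y by (simp add: h_def)
  qed (use that in auto)
  define C0 where "C0 = (a + real N * b) * R powr (real N - 1)"
  have C0: "0 \<le> C0" using ab by (simp add: C0_def)
  define Y where "Y x = flux b f1 g1 x - flux b f2 g2 x" for x
  have fluxl: "(flux b f g \<longlongrightarrow> 0) (at_left R)" if "(f \<longlongrightarrow> 0) (at_left R)" "(g \<longlongrightarrow> 0) (at_left R)" for f g
  proof -
    have "(flux b f g \<longlongrightarrow> R powr (real N - 1) * 0 + b * R powr real N * 0) (at_left R)"
      unfolding flux_def [abs_def] using R(1) by (intro tendsto_intros that) auto
    then show ?thesis by simp
  qed
  have Yl: "((\<lambda>x. - (Y x + C0 * H x)) \<longlongrightarrow> 0) (at_left R)"
    unfolding Y_def using fluxl R Hl by (auto intro!: tendsto_eq_intros)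
  \<comment> \<open>The reaction terms differ with the favourable sign because
    \<open>k2 <= k1\<close> and \<open>f2 <= f1\<close>, so the linear part of the source alone
    bounds \<open>Y'\<close> from above.\<close>
  have YH: "0 \<le> Y x + C0 * H x" if x: "c < x" "x < R" for x
  proof -
    define Y' where "Y' y = ((a + real N * b) * (y powr (real N - 1) * f1 y)
        - k1 * (y powr (real N - 1 + \<sigma>) * f1 y powr p))
       - ((a + real N * b) * (y powr (real N - 1) * f2 y)
        - k2 * (y powr (real N - 1 + \<sigma>) * f2 y powr p))" for y
    have "- (Y x + C0 * H x) \<le> 0 * (R - x)"
    proof (rule upper_bound_from_left_limit[OF x(2) _ _ Yl, of "\<lambda>y. - (Y' y - C0 * h y)"])
      fix y assume y: "x \<le> y" "y < R"
      then have y': "0 < y" "y < R" "c < y" using x c by auto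
      have "(Y has_real_derivative Y' y) (at y)"
        unfolding Y_def Y'_def by (intro DERIV_diff flux_deriv[OF S1] flux_deriv[OF S2] y')
      from DERIV_minus[OF DERIV_add[OF this DERIV_cmult[OF dH[OF y'(3,2)], of C0]]]
      show "((\<lambda>x. - (Y x + C0 * H x)) has_real_derivative - (Y' y - C0 * h y)) (at y)" by simp
      have f: "0 < f2 y" "f2 y \<le> f1 y" using solD(1)[OF S2 y'(1,2)] le[OF y'(1,2)] by auto
      have "k2 * (y powr (real N - 1 + \<sigma>) * f2 y powr p) \<le> k1 * (y powr (real N - 1 + \<sigma>) * f1 y powr p)"
        using f ab p_ge by (intro mult_mono mult_left_mono powr_mono2) auto
      then have "Y' y \<le> (a + real N * b) * y powr (real N - 1) * h y"
        using y' by (simp add: Y'_def h_def algebra_simps)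
      also have "\<dots> \<le> (a + real N * b) * R powr (real N - 1) * h y"
        using ab y' h0[of y] N_ge by (intro mult_left_mono mult_right_mono powr_mono2) auto
      finally show "- 0 \<le> - (Y' y - C0 * h y)" by (simp add: C0_def)
    qed
    then show ?thesis by simp
  qed
  define C' where "C' = c powr (1 - real N) * C0"
  have C': "0 \<le> C'" using C0 by (simp add: C'_def)
  define \<gamma> where "\<gamma> x = f1 x powr m - f2 x powr m" for x
  \<comment> \<open>\<open>\<gamma>' = y^(1-N) Y - b y h\<close> is integrated from \<open>x\<close>
    to \<open>R\<close>: the drift yields \<open>b R H\<close>, the flux difference only a
    correction with the additional factor \<open>R - x\<close>.\<close>
  have \<gamma>_upper: "\<gamma> x \<le> (b * R + C' * (R - x)) * H x" if x: "c < x" "x < R" for x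
  proof -
    have lim: "((\<lambda>x. \<gamma> x - b * R * H x) \<longlongrightarrow> 0) (at_left R)"
    proof -
      have "((\<lambda>y. f y powr m) \<longlongrightarrow> 0) (at_left R)" if "(f \<longlongrightarrow> 0) (at_left R)" "sol a b k R f g" for f g k
      proof -
        have "\<forall>\<^sub>F y in at_left R. f y \<ge> 0"
          using eventually_at_left_real[OF R(1)] by (rule eventually_mono) (use solD(1)[OF that(2)] in force)
        from tendsto_powr2[OF that(1) tendsto_const this, of m] show ?thesis using m_gt by simp
      qed
      from tendsto_diff[OF tendsto_diff[OF this[OF R(2) S1] this[OF R(4) S2]] tendsto_mult_left[OF Hl, of "b * R"]]
      show ?thesis unfolding \<gamma>_def by simp
    qed
    have "\<gamma> x - b * R * H x \<le> (C' * H x) * (R - x)"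
    proof (rule upper_bound_from_left_limit[OF x(2) _ _ lim])
      fix y assume y: "x \<le> y" "y < R"
      then have y': "0 < y" "y < R" "c < y" using x c by auto
      show "((\<lambda>x. \<gamma> x - b * R * H x) has_real_derivative (g1 y - g2 y + b * R * h y)) (at y)"
        unfolding \<gamma>_def
        using DERIV_diff[OF DERIV_diff[OF sol_w_deriv[OF S1 y'(1,2)] sol_w_deriv[OF S2 y'(1,2)]]
            DERIV_cmult[OF dH[OF y'(3,2)], of "b * R"]] by simp
      have "y powr (1 - real N) * Y y = (y powr (1 - real N) * y powr (real N - 1)) * (g1 y - g2 y)
          + b * (y powr (1 - real N) * y powr real N) * (f1 y - f2 y)"
        by (simp add: Y_def flux_def algebra_simps)
      moreover have "y powr (1 - real N) * y powr (real N - 1) = 1" "y powr (1 - real N) * y powr real N = y"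
        using y' by (simp_all flip: powr_add)
      ultimately have "g1 y - g2 y = y powr (1 - real N) * Y y - b * y * h y" using y' by (simp add: h_def)
      moreover have "- (C' * H x) \<le> y powr (1 - real N) * Y y"
      proof -
        have "y powr (1 - real N) * (C0 * H y) \<le> c powr (1 - real N) * (C0 * H x)"
          using y' c C0 H0[OF y'(3,2)] Hanti[OF x(1) y] N_ge
          by (intro mult_mono mult_left_mono powr_mono2') auto
        then have "y powr (1 - real N) * (C0 * H y) \<le> C' * H x" by (simp add: C'_def)
        moreover have "0 \<le> y powr (1 - real N) * (Y y + C0 * H y)" using YH[OF y'(3,2)] by simp
        ultimately show ?thesis by (simp add: distrib_left)
      qed
      moreover have "b * y * h y \<le> b * R * h y"
        using ab y' h0[of y] by (intro mult_right_mono mult_left_mono) auto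
      ultimately show "- (C' * H x) \<le> g1 y - g2 y + b * R * h y" by linarith
    qed
    then show ?thesis by (simp add: algebra_simps)
  qed
  from interface_asymptotics[OF S2 ab(1) less_imp_le[OF ab(2)] ab(3) v2 neg2] obtain C2 where
    C2: "0 \<le> C2" "\<And>x. R / 2 \<le> x \<Longrightarrow> x < R \<Longrightarrow>
     \<bar>f2 x powr (m - 1) - (m - 1) / m * b * R * (R - x)\<bar> \<le> C2 * (R - x)\<^sup>2" by metis
  from interface_asymptotics[OF S1 ab(1) less_imp_le[OF ab(2)] k1 v1 neg1] obtain C1 where
    C1: "0 \<le> C1" "\<And>x. R / 2 \<le> x \<Longrightarrow> x < R \<Longrightarrow>
     \<bar>f1 x powr (m - 1) - (m - 1) / m * b * R * (R - x)\<bar> \<le> C1 * (R - x)\<^sup>2" by metis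
  \<comment> \<open>The excess 1/2 over \<open>1 / (m - 1)\<close> leaves a surplus
    \<open>(m - 1) / 2 * b * R\<close>, which absorbs the corrections \<open>M * t\<close> once
    \<open>t < \<delta>\<close>; the distance 1/2 to \<open>1 + 1 / (m - 1)\<close> makes
    \<open>J\<close> vanish at \<open>R\<close>.\<close>
  define q where "q = 1 / (m - 1) + 1 / 2"
  have q: "0 < q" "q * (m - 1) = 1 + (m - 1) / 2" using m_gt by (auto simp: q_def field_simps add_pos_pos)
  define M where "M = C' + q * m * C2"
  have M: "0 \<le> M" using C' C2 q m_gt by (simp add: M_def)
  define \<delta> where "\<delta> = min c ((m - 1) / 2 * b * R / (M + 1))"
  have \<delta>: "0 < \<delta>" "\<delta> \<le> c" using c m_gt ab R M by (auto simp: \<delta>_def)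
  define r where "r = R - \<delta>"
  have r: "c \<le> r" "r < R" using \<delta> by (auto simp: r_def c_def)
  have key: "(R - x) * h x \<le> q * H x" if x: "r < x" "x < R" for x
  proof -
    define t where "t = R - x"
    have t: "0 < t" "t < \<delta>" using x by (auto simp: t_def r_def)
    have x': "0 < x" "c < x" using x r c by auto
    have "M * t \<le> (M + 1) * t" using t by simp
    also have "\<dots> \<le> (M + 1) * ((m - 1) / 2 * b * R / (M + 1))"
      using t M by (intro mult_left_mono) (auto simp: \<delta>_def)
    also have "\<dots> = (m - 1) / 2 * b * R"
    proof -
      have "M + 1 \<noteq> 0" using M by linarith
      then show ?thesis by (metis nonzero_mult_div_cancel_left times_divide_eq_right)
    qed
    finally have Mt: "M * t \<le> (m - 1) / 2 * b * R" .
    \<comment> \<open>By the interface asymptotics \<open>A * t\<close> is a lower bound for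
      \<open>m f2^(m-1)\<close>; \<open>qA\<close> compares it with the factor of \<open>H\<close>
      in the upper bound for \<open>\<gamma>\<close>.\<close>
    define A where "A = (m - 1) * b * R - m * C2 * t"
    have qA: "b * R + C' * t \<le> q * A"
    proof -
      have "q * A = (q * (m - 1)) * (b * R) - q * m * C2 * t" by (simp add: A_def algebra_simps)
      also have "\<dots> = b * R + (m - 1) / 2 * b * R - q * m * C2 * t" unfolding q(2) distrib_right by (simp add: mult.assoc)
      finally have "q * A = b * R + (m - 1) / 2 * b * R - q * m * C2 * t" .
      moreover have "M * t = C' * t + q * m * C2 * t" by (simp add: M_def distrib_right)
      ultimately show ?thesis using Mt by linarith
    qed
    have "0 < b * R + C' * t" using ab R C' t by (intro add_pos_nonneg) auto
    then have A: "0 < A" using qA q(1) by (metis le_less_trans less_le_trans not_le zero_less_mult_pos)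
    have f: "0 < f2 x" "f2 x \<le> f1 x" using solD(1)[OF S2 x'(1) x(2)] le[OF x'(1) x(2)] by auto
    have "(m - 1) / m * b * R * t - C2 * t\<^sup>2 \<le> f2 x powr (m - 1)"
      using C2(2)[of x] x' x by (auto simp: t_def c_def abs_le_iff)
    then have "m * ((m - 1) / m * b * R * t - C2 * t\<^sup>2) \<le> m * f2 x powr (m - 1)"
      using m_gt by (intro mult_left_mono) auto
    moreover have "m * ((m - 1) / m * b * R * t - C2 * t\<^sup>2) = A * t"
    proof -
      have "m * ((m - 1) / m) = m - 1" using m_gt by simp
      then have "m * ((m - 1) / m * b * R * t) = (m - 1) * b * R * t" by (metis mult.assoc)
      then show ?thesis by (simp add: A_def right_diff_distrib left_diff_distrib power2_eq_square)
    qed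
    ultimately have "A * t \<le> m * f2 x powr (m - 1)" by simp
    then have "A * t * h x \<le> m * f2 x powr (m - 1) * h x"
      using h0[of x] x x' by (intro mult_right_mono) auto
    also have "\<dots> = m * f2 x powr (m - 1) * (f1 x - f2 x)" using x by (simp add: h_def)
    also have "\<dots> \<le> \<gamma> x" unfolding \<gamma>_def by (rule powr_convex_lower) (use f m_gt in auto)
    also have "\<dots> \<le> (b * R + C' * t) * H x" using \<gamma>_upper[OF x'(2) x(2)] by (simp add: t_def)
    also have "\<dots> \<le> (q * A) * H x" using qA H0[OF x'(2) x(2)] by (rule mult_right_mono)
    finally have "A * (t * h x) \<le> A * (q * H x)" by (simp add: mult_ac)
    then show ?thesis using A by (simp add: t_def)
  qed
  define J where "J x = H x * (R - x) powr (- q)" for x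
  have dJ: "(J has_real_derivative (R - x) powr (- q - 1) * (q * H x - (R - x) * h x)) (at x)"
    if x: "r < x" "x < R" for x
  proof -
    have "((\<lambda>x. (R - x) powr (- q)) has_real_derivative q * (R - x) powr (- q - 1)) (at x)"
      using x by (auto intro!: derivative_eq_intros)
    from DERIV_mult[OF dH this] have "(J has_real_derivative (- h x) * (R - x) powr (- q) + (q * (R - x) powr (- q - 1)) * H x) (at x)"
      unfolding J_def using x r by auto
    moreover have "(R - x) powr (- q) = (R - x) powr (- q - 1) * (R - x)"
      using x by (simp add: powr_diff)
    ultimately show ?thesis by (simp add: algebra_simps)
  qed
  define E where "E = (m - 1) / m * b * R + C1 * R"
  have E: "0 \<le> E" using m_gt ab R C1 by (simp add: E_def)
  have J_upper: "J x \<le> E powr (1 / (m - 1)) * (R - x) powr (1/2)" if x: "r < x" "x < R" for x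
  proof -
    define t where "t = R - x"
    have x': "0 < x" "c < x" using x r c by auto
    have t: "0 < t" "t \<le> R" using x x' by (auto simp: t_def)
    have f: "0 < f1 x" using solD(1)[OF S1 x'(1) x(2)] .
    have "f1 x powr (m - 1) \<le> (m - 1) / m * b * R * t + C1 * t\<^sup>2"
      using C1(2)[of x] x' x by (auto simp: t_def c_def abs_le_iff)
    also have "\<dots> \<le> E * t"
    proof -
      have "C1 * t\<^sup>2 \<le> C1 * R * t" using C1(1) t by (simp add: power2_eq_square mult.assoc mult_left_mono mult_right_mono)
      then show ?thesis by (simp add: E_def algebra_simps)
    qed
    finally have "(f1 x powr (m - 1)) powr (1 / (m - 1)) \<le> (E * t) powr (1 / (m - 1))"
      using m_gt by (intro powr_mono2) auto
    then have fb: "f1 x \<le> E powr (1 / (m - 1)) * t powr (1 / (m - 1))"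
      using m_gt f E t by (simp add: powr_powr powr_mult)
    have "J x \<le> f1 x * t * t powr (- q)"
      unfolding J_def t_def using H_f1[OF x'(2) x(2)] by (intro mult_right_mono) auto
    also have "\<dots> \<le> E powr (1 / (m - 1)) * t powr (1 / (m - 1)) * t * t powr (- q)"
      using fb t by (intro mult_right_mono) auto
    also have "\<dots> = E powr (1 / (m - 1)) * (t powr (1 / (m - 1)) * t powr 1 * t powr (- q))"
      using t by simp
    \<comment> \<open>The exponents add up to \<open>1 / (m - 1) + 1 - q = 1/2 > 0\<close>.\<close>
    also have "t powr (1 / (m - 1)) * t powr 1 * t powr (- q) = t powr (1/2)"
      unfolding powr_add[symmetric] by (simp add: q_def)
    finally show ?thesis by (simp add: t_def)
  qed
  have "f1 x = f2 x" if x: "r < x" "x < R" for x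
  proof -
    have J0: "J y = 0" if y: "r < y" "y < R" for y
    proof -
      have "\<forall>\<^sub>F z in at_left R. J y \<le> E powr (1 / (m - 1)) * (R - z) powr (1/2)"
        using eventually_at_left_real[OF y(2)]
      proof (rule eventually_mono)
        fix z assume z: "z \<in> {y<..<R}"
        have "J y \<le> J z"
        proof (rule DERIV_nonneg_imp_nondecreasing[of y z J])
          fix w assume w: "y \<le> w" "w \<le> z"
          show "\<exists>d. DERIV J w :> d \<and> 0 \<le> d"
            using dJ[of w] key[of w] w y z by (intro exI conjI) (assumption | auto)+
        qed (use z in auto)
        then show "J y \<le> E powr (1 / (m - 1)) * (R - z) powr (1/2)" using J_upper[of z] z y by auto
      qed
      moreover have "((\<lambda>z. E powr (1 / (m - 1)) * (R - z) powr (1/2)) \<longlongrightarrow> E powr (1 / (m - 1)) * 0) (at_left R)"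
      proof (intro tendsto_intros)
        have "((\<lambda>z. R - z) \<longlongrightarrow> R - R) (at_left R)" by (intro tendsto_intros)
        then have "((\<lambda>z. R - z) \<longlongrightarrow> 0) (at_left R)" by simp
        moreover have "\<forall>\<^sub>F z in at_left R. 0 \<le> R - z"
          using eventually_at_left_real[OF R(1)] by (rule eventually_mono) auto
        ultimately show "((\<lambda>z. (R - z) powr (1/2)) \<longlongrightarrow> 0) (at_left R)"
          using tendsto_powr2[OF _ tendsto_const, of "\<lambda>z. R - z" 0 "at_left R" "1/2"] by simp
      qed
      ultimately have "J y \<le> 0" using tendsto_lowerbound by fastforce
      moreover have "0 \<le> J y" using H0[of y] y r by (simp add: J_def)
      ultimately show ?thesis by simp
    qed
    then have Hz: "H y = 0" if "r < y" "y < R" for y using that by (force simp: J_def)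
    have ev: "\<forall>\<^sub>F y in nhds x. H y = 0"
      using eventually_nhds_in_open[of "{r<..<R}" x] x Hz by (auto elim!: eventually_mono)
    have "((\<lambda>_. 0) has_real_derivative - h x) (at x)"
      using dH[of x] x r DERIV_cong_ev[OF refl ev refl] by auto
    then have "h x = 0" using DERIV_unique[OF DERIV_const] by force
    then show ?thesis using x by (simp add: h_def)
  qed
  then show ?thesis using that[of r] r c by auto
qed

section \<open>Profiles and their uniqueness\<close>

definition origin_coeff :: real where
  "origin_coeff = (m - p) / (m * (real N + \<sigma>) * (\<sigma> + 2))"

lemma origin_coeff_pos: "0 < origin_coeff"
  using p_lt_m m_gt N\<sigma>_pos \<sigma>_gt by (simp add: origin_coeff_def)

text \<open>The second coefficient is proportional to \<open>k\<close>, so profiles with equal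
  \<open>D\<close> and different \<open>k\<close> are ordered near the origin. Written as the limit
  of a quotient, the expansion passes easily through rescalings and inequalities.\<close>

definition prof :: "real \<Rightarrow> real \<Rightarrow> real \<Rightarrow> real \<Rightarrow> real \<Rightarrow> (real \<Rightarrow> real) \<Rightarrow> (real \<Rightarrow> real) \<Rightarrow> bool" where
  "prof a b k D R f g \<longleftrightarrow> sol a b k R f g \<and> vanishing R f g \<and> 0 < D \<and>
     ((\<lambda>x. (f x powr (m - p) - D) / x powr (\<sigma> + 2)) \<longlongrightarrow> - k * origin_coeff) (at_right 0)"

lemma origin_tendsto_iff:
  "(\<lambda>x. F x - (D - c * x powr s)) \<in> o[at_right 0](\<lambda>x. x powr s)
     \<longleftrightarrow> ((\<lambda>x. (F x - D) / x powr s) \<longlongrightarrow> - c) (at_right (0::real))" for F :: "real \<Rightarrow> real"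
proof -
  have ev: "\<forall>\<^sub>F x in at_right 0. x powr s \<noteq> (0::real)"
    using eventually_at_right_less by (rule eventually_mono) auto
  have "(\<lambda>x. F x - (D - c * x powr s)) \<in> o[at_right 0](\<lambda>x. x powr s)
     \<longleftrightarrow> ((\<lambda>x. (F x - (D - c * x powr s)) / x powr s) \<longlongrightarrow> 0) (at_right 0)"
    using smalloI_tendsto[OF _ ev] smalloD_tendsto by (intro iffI) auto
  also have "\<dots> \<longleftrightarrow> ((\<lambda>x. (F x - D) / x powr s - (- c)) \<longlongrightarrow> 0) (at_right 0)"
    using ev by (intro filterlim_cong refl) (auto elim!: eventually_mono simp: field_simps)
  also have "\<dots> \<longleftrightarrow> ((\<lambda>x. (F x - D) / x powr s) \<longlongrightarrow> - c) (at_right 0)"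
    by (rule Lim_null[symmetric])
  finally show ?thesis .
qed

lemma is_profile_imp_prof:
  assumes "is_profile N m \<sigma> p f R"
  obtains D where "prof \<alpha> \<beta> 1 D R f (deriv (\<lambda>x. f x powr m))"
proof -
  have A: "solves_profile_ode N m \<sigma> p f R" "behaviour_at_origin N m \<sigma> p f" "interface_at m f R"
    using assms by (auto simp: is_profile_def)
  from A(2) obtain D where D: "D > 0"
    "(\<lambda>x. f x powr (m - p) - (D - origin_coeff * x powr (\<sigma> + 2))) \<in> o[at_right 0](\<lambda>x. x powr (\<sigma> + 2))"
    unfolding behaviour_at_origin_def origin_coeff_def by blast
  show ?thesis
    using that[of D] A D profile_imp_sol[OF A(1)] unfolding prof_def vanishing_def interface_at_def
    by (auto simp: origin_tendsto_iff)
qed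

lemma prof_imp_is_profile:
  assumes "prof \<alpha> \<beta> 1 D R f g"
  shows "is_profile N m \<sigma> p f R"
proof -
  have A: "sol \<alpha> \<beta> 1 R f g" "vanishing R f g" "0 < D"
     "((\<lambda>x. (f x powr (m - p) - D) / x powr (\<sigma> + 2)) \<longlongrightarrow> - origin_coeff) (at_right 0)"
    using assms by (auto simp: prof_def)
  have R: "0 < R" "(f \<longlongrightarrow> 0) (at_left R)" "(g \<longlongrightarrow> 0) (at_left R)" using A(2) by (auto simp: vanishing_def)
  have "\<forall>\<^sub>F x in at_left R. g x = deriv (\<lambda>x. f x powr m) x"
    using eventually_at_left_real[OF R(1)]
    by (rule eventually_mono) (use sol_imp_profile(2)[OF A(1)] in auto)
  from Lim_transform_eventually[OF R(3) this] have "(deriv (\<lambda>x. f x powr m) \<longlongrightarrow> 0) (at_left R)" .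
  moreover have "behaviour_at_origin N m \<sigma> p f"
    unfolding behaviour_at_origin_def origin_coeff_def[symmetric] origin_tendsto_iff using A by blast
  ultimately show ?thesis
    using R sol_imp_profile(1)[OF A(1)] solD(1)[OF A(1)] by (auto simp: is_profile_def interface_at_def)
qed

lemma prof_scale:
  assumes P: "prof a b k D R f g" and pos: "0 < \<mu>" "0 < \<nu>"
  shows "prof (\<mu> powr (m - 1) * \<nu>\<^sup>2 * a) (\<mu> powr (m - 1) * \<nu>\<^sup>2 * b)
      (\<mu> powr (m - p) * \<nu> powr (\<sigma> + 2) * k) (\<mu> powr (m - p) * D) (R / \<nu>)
      (\<lambda>x. \<mu> * f (\<nu> * x)) (\<lambda>x. \<mu> powr m * \<nu> * g (\<nu> * x))"
proof -
  have A: "sol a b k R f g" "0 < R" "(f \<longlongrightarrow> 0) (at_left R)" "(g \<longlongrightarrow> 0) (at_left R)" "0 < D"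
     "((\<lambda>x. (f x powr (m - p) - D) / x powr (\<sigma> + 2)) \<longlongrightarrow> - k * origin_coeff) (at_right 0)"
    using P by (auto simp: prof_def vanishing_def)
  have lR: "filterlim (\<lambda>x. \<nu> * x) (at_left R) (at_left (R / \<nu>))"
    unfolding filterlim_at
  proof (intro conjI)
    have "((\<lambda>x. \<nu> * x) \<longlongrightarrow> \<nu> * (R / \<nu>)) (at_left (R / \<nu>))" by (intro tendsto_intros)
    then show "((\<lambda>x. \<nu> * x) \<longlongrightarrow> R) (at_left (R / \<nu>))" using pos by simp
    have "R / \<nu> - 1 < R / \<nu>" by simp
    from eventually_at_left_real[OF this]
    show "\<forall>\<^sub>F x in at_left (R / \<nu>). \<nu> * x \<in> {..<R} \<and> \<nu> * x \<noteq> R"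
      by (rule eventually_mono) (use pos in \<open>auto simp: field_simps\<close>)
  qed
  have l0: "filterlim (\<lambda>x. \<nu> * x) (at_right 0) (at_right 0)"
    by (rule filterlim_times_pos[OF filterlim_ident]) (use pos in auto)
  have "((\<lambda>x. \<mu> * f (\<nu> * x)) \<longlongrightarrow> \<mu> * 0) (at_left (R / \<nu>))"
    by (intro tendsto_intros filterlim_compose[OF A(3) lR])
  moreover have "((\<lambda>x. \<mu> powr m * \<nu> * g (\<nu> * x)) \<longlongrightarrow> \<mu> powr m * \<nu> * 0) (at_left (R / \<nu>))"
    by (intro tendsto_intros filterlim_compose[OF A(4) lR])
  moreover have "((\<lambda>x. ((\<mu> * f (\<nu> * x)) powr (m - p) - \<mu> powr (m - p) * D) / x powr (\<sigma> + 2))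
       \<longlongrightarrow> - (\<mu> powr (m - p) * \<nu> powr (\<sigma> + 2) * k) * origin_coeff) (at_right 0)"
  proof -
    have "((\<lambda>x. \<mu> powr (m - p) * \<nu> powr (\<sigma> + 2) * ((f (\<nu> * x) powr (m - p) - D) / (\<nu> * x) powr (\<sigma> + 2)))
       \<longlongrightarrow> \<mu> powr (m - p) * \<nu> powr (\<sigma> + 2) * (- k * origin_coeff)) (at_right 0)"
      by (intro tendsto_intros filterlim_compose[OF A(6) l0])
    moreover have "\<forall>\<^sub>F x in at_right 0.
      \<mu> powr (m - p) * \<nu> powr (\<sigma> + 2) * ((f (\<nu> * x) powr (m - p) - D) / (\<nu> * x) powr (\<sigma> + 2))
      = ((\<mu> * f (\<nu> * x)) powr (m - p) - \<mu> powr (m - p) * D) / x powr (\<sigma> + 2)"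
    proof -
      have "0 < R / \<nu>" using A pos by simp
      from eventually_at_right_real[OF this] show ?thesis
      proof (rule eventually_mono)
        fix x assume "x \<in> {0<..<R / \<nu>}"
        then have x: "0 < x" "0 < \<nu> * x" "\<nu> * x < R" using pos by (auto simp: field_simps)
        have "0 < f (\<nu> * x)" using solD(1)[OF A(1) x(2,3)] .
        then show "\<mu> powr (m - p) * \<nu> powr (\<sigma> + 2) * ((f (\<nu> * x) powr (m - p) - D) / (\<nu> * x) powr (\<sigma> + 2))
      = ((\<mu> * f (\<nu> * x)) powr (m - p) - \<mu> powr (m - p) * D) / x powr (\<sigma> + 2)"
          using pos x by (simp add: powr_mult field_simps)
      qed
    qed
    ultimately show ?thesis using Lim_transform_eventually by (simp add: mult_ac)
  qed
  ultimately show ?thesis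
    using sol_scale[OF A(1) pos] A pos by (simp add: prof_def vanishing_def)
qed

lemma prof_origin_limit:
  assumes P: "prof a b k D R f g"
  shows "((\<lambda>x. f x powr (m - p)) \<longlongrightarrow> D) (at_right 0)" "(f \<longlongrightarrow> D powr (1 / (m - p))) (at_right 0)"
proof -
  have A: "sol a b k R f g" "0 < R" "0 < D"
     "((\<lambda>x. (f x powr (m - p) - D) / x powr (\<sigma> + 2)) \<longlongrightarrow> - k * origin_coeff) (at_right 0)"
    using P by (auto simp: prof_def vanishing_def)
  have "((\<lambda>x::real. x powr (\<sigma> + 2)) \<longlongrightarrow> 0) (at_right 0)"
    using tendsto_powr2[OF tendsto_ident_at tendsto_const, of 0 "{0<..}" "\<sigma> + 2"] \<sigma>_gt
      eventually_at_right_less[of "0::real", THEN eventually_mono, of "\<lambda>x. 0 \<le> x"] by simp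
  from tendsto_add[OF tendsto_const[of D] tendsto_mult[OF A(4) this]]
  have "((\<lambda>x. D + (f x powr (m - p) - D) / x powr (\<sigma> + 2) * x powr (\<sigma> + 2)) \<longlongrightarrow> D) (at_right 0)" by simp
  moreover have "\<forall>\<^sub>F x in at_right 0. D + (f x powr (m - p) - D) / x powr (\<sigma> + 2) * x powr (\<sigma> + 2) = f x powr (m - p)"
    using eventually_at_right_less by (rule eventually_mono) auto
  ultimately show l: "((\<lambda>x. f x powr (m - p)) \<longlongrightarrow> D) (at_right 0)" by (rule Lim_transform_eventually)
  have "((\<lambda>x. (f x powr (m - p)) powr (1 / (m - p))) \<longlongrightarrow> D powr (1 / (m - p))) (at_right 0)"
    using A(3) by (intro tendsto_intros l) auto
  moreover have "\<forall>\<^sub>F x in at_right 0. (f x powr (m - p)) powr (1 / (m - p)) = f x"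
    using eventually_at_right_real[OF A(2)]
  proof (rule eventually_mono)
    fix x assume "x \<in> {0<..<R}"
    then show "(f x powr (m - p)) powr (1 / (m - p)) = f x"
      using solD(1)[OF A(1), of x] p_lt_m by (simp add: powr_powr)
  qed
  ultimately show "(f \<longlongrightarrow> D powr (1 / (m - p))) (at_right 0)" by (rule Lim_transform_eventually)
qed

text \<open>The negative second coefficient forces \<open>f^(m-p) < D\<close> near the origin. Then
  \<open>g < 0\<close> somewhere there, since otherwise \<open>f\<close> would be nondecreasing from
  its limit on; from that point positivity of the energy keeps \<open>g\<close> negative.\<close>

lemma prof_deriv_neg:
  assumes P: "prof a b k D R f g" and ab: "0 \<le> a" "0 \<le> b" "0 < k" and x: "0 < x" "x < R"
  shows "g x < 0"
proof -
  have A: "sol a b k R f g" "vanishing R f g" "0 < R" "0 < D"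
     "((\<lambda>x. (f x powr (m - p) - D) / x powr (\<sigma> + 2)) \<longlongrightarrow> - k * origin_coeff) (at_right 0)"
    using P by (auto simp: prof_def vanishing_def)
  have "- k * origin_coeff < 0" using ab origin_coeff_pos by simp
  from order_tendstoD(2)[OF A(5) this] eventually_at_right_real[OF x(1)]
  have "\<forall>\<^sub>F y in at_right 0. f y powr (m - p) < D \<and> y \<in> {0<..<x}"
  proof eventually_elim
    case (elim y)
    then show ?case using powr_ge_zero[of y "\<sigma> + 2"] by (auto simp: divide_less_0_iff)
  qed
  then obtain r where r: "0 < r" "\<And>y. 0 < y \<Longrightarrow> y < r \<Longrightarrow> f y powr (m - p) < D \<and> y < x"
    unfolding eventually_at_right_field by auto
  define y where "y = r / 2"
  have y: "0 < y" "y < r" "y < x" "f y powr (m - p) < D" using r(1) r(2)[of "r/2"] by (auto simp: y_def)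
  have "\<exists>x0. 0 < x0 \<and> x0 \<le> y \<and> g x0 < 0"
  proof (rule ccontr)
    assume "\<not> ?thesis"
    then have gn: "\<And>z. 0 < z \<Longrightarrow> z \<le> y \<Longrightarrow> 0 \<le> g z" by force
    have "\<forall>\<^sub>F z in at_right 0. f z powr (m - p) \<le> f y powr (m - p)"
      using eventually_at_right_real[OF y(1)]
    proof (rule eventually_mono)
      fix z assume z: "z \<in> {0<..<y}"
      have "f z \<le> f y"
      proof (rule DERIV_nonneg_imp_nondecreasing[of z y f])
        fix w assume "z \<le> w" "w \<le> y"
        then have w: "0 < w" "w < R" "w \<le> y" using z y x by auto
        have "0 \<le> g w * f w powr (1 - m) / m" using gn[OF w(1,3)] m_gt by simp
        then show "\<exists>d. DERIV f w :> d \<and> 0 \<le> d" using solD(2)[OF A(1) w(1,2)] by blast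
      qed (use z in auto)
      then show "f z powr (m - p) \<le> f y powr (m - p)"
        using z y x p_lt_m solD(1)[OF A(1), of z] by (intro powr_mono2) auto
    qed
    then have "D \<le> f y powr (m - p)"
      using prof_origin_limit(1)[OF P] by (intro tendsto_upperbound) auto
    then show False using y by simp
  qed
  then obtain x0 where x0: "0 < x0" "x0 \<le> y" "g x0 < 0" by blast
  show ?thesis
    by (rule energy_pos_imp_decreasing[OF A(1) ab(1,3) x0(1) _ x0(3)])
      (use x0 y x vanishing_energy_pos[OF A(1) ab(2,3) A(2)] in auto)
qed

text \<open>With the limit of \<open>f\<close> at 0 and the value 0 beyond \<open>R\<close> the
  extension is continuous on the line, so profiles with different interfaces can be compared on one
  compact interval, end points included.\<close>

definition extend :: "real \<Rightarrow> real \<Rightarrow> (real \<Rightarrow> real) \<Rightarrow> real \<Rightarrow> real" where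
  "extend D R f x = (if x \<le> 0 then D powr (1 / (m - p)) else if x < R then f x else 0)"

lemma extend_continuous:
  assumes P: "prof a b k D R f g"
  shows "continuous_on UNIV (extend D R f)"
proof -
  have A: "sol a b k R f g" "0 < R" "(f \<longlongrightarrow> 0) (at_left R)"
    using P by (auto simp: prof_def vanishing_def)
  let ?e = "extend D R f"
  have "isCont ?e x" for x
  proof -
    have tr: "(?e \<longlongrightarrow> l) F" if "(h \<longlongrightarrow> l) F" "\<forall>\<^sub>F y in F. h y = ?e y" for h l F
      using Lim_transform_eventually[OF that] .
    consider "x < 0" | "x = 0" | "0 < x" "x < R" | "x = R" | "R < x" by linarith
    then show ?thesis
    proof cases
      case 1
      have "\<forall>\<^sub>F y in at x. D powr (1 / (m - p)) = ?e y"
        using eventually_at_in_open'[of "{..<0}" x] 1 by (auto elim!: eventually_mono simp: extend_def)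
      from tr[OF tendsto_const this] show ?thesis using 1 by (simp add: isCont_def extend_def)
    next
      case 2
      have "\<forall>\<^sub>F y in at_left 0. D powr (1 / (m - p)) = ?e y"
        using eventually_at_left_real[of "-1" 0] by (auto elim!: eventually_mono simp: extend_def)
      note l = tr[OF tendsto_const this]
      have "\<forall>\<^sub>F y in at_right 0. f y = ?e y"
        using eventually_at_right_real[OF A(2)] by (auto elim!: eventually_mono simp: extend_def)
      note r = tr[OF prof_origin_limit(2)[OF P] this]
      show ?thesis using l r 2 by (simp add: isCont_def filterlim_at_split extend_def)
    next
      case 3
      have "\<forall>\<^sub>F y in at x. f y = ?e y"
        using eventually_at_in_open'[of "{0<..<R}" x] 3 by (auto elim!: eventually_mono simp: extend_def)
      from tr[OF _ this] sol_isCont(1)[OF A(1) 3] show ?thesis using 3 by (simp add: isCont_def extend_def)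
    next
      case 4
      have "\<forall>\<^sub>F y in at_left R. f y = ?e y"
        using eventually_at_left_real[OF A(2)] by (auto elim!: eventually_mono simp: extend_def)
      note l = tr[OF A(3) this]
      have "\<forall>\<^sub>F y in at_right R. 0 = ?e y"
        using eventually_at_right_less[of R] A by (auto elim!: eventually_mono simp: extend_def)
      note r = tr[OF tendsto_const this]
      show ?thesis using l r 4 A by (simp add: isCont_def filterlim_at_split extend_def)
    next
      case 5
      have "\<forall>\<^sub>F y in at x. 0 = ?e y"
        using eventually_at_in_open'[of "{R<..}" x] 5 A by (auto elim!: eventually_mono simp: extend_def)
      from tr[OF tendsto_const this] show ?thesis using 5 A by (simp add: isCont_def extend_def)
    qed
  qed
  then show ?thesis by (simp add: continuous_on_eq_continuous_at)
qed

section \<open>Comparison of profiles by rescaling\<close>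

lemma no_touching:
  assumes F: "prof a b K D1 R1 F F'" and g: "prof a b k D2 R2 g g'"
    and ab: "0 \<le> a" "0 < b" "0 < k" "k < K"
    and le: "\<And>x. 0 \<le> x \<Longrightarrow> x \<le> R2 \<Longrightarrow> extend D2 R2 g x \<le> extend D1 R1 F x"
    and x: "0 \<le> x" "x \<le> R2"
  shows "extend D2 R2 g x < extend D1 R1 F x"
proof (rule ccontr)
  assume "\<not> ?thesis"
  then have eq: "extend D2 R2 g x = extend D1 R1 F x" using le[OF x] by simp
  have K: "0 < K" "0 \<le> b" using ab by auto
  have A1: "sol a b K R1 F F'" "vanishing R1 F F'" "0 < R1" "0 < D1"
     "((\<lambda>x. (F x powr (m - p) - D1) / x powr (\<sigma> + 2)) \<longlongrightarrow> - K * origin_coeff) (at_right 0)"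
    using F by (auto simp: prof_def vanishing_def)
  have A2: "sol a b k R2 g g'" "vanishing R2 g g'" "0 < R2" "0 < D2"
     "((\<lambda>x. (g x powr (m - p) - D2) / x powr (\<sigma> + 2)) \<longlongrightarrow> - k * origin_coeff) (at_right 0)"
    using g by (auto simp: prof_def vanishing_def)
  \<comment> \<open>Otherwise the extended \<open>F\<close> is 0 at \<open>R1\<close> while
    \<open>g\<close> is still positive.\<close>
  have R12: "R2 \<le> R1"
  proof (rule ccontr)
    assume "\<not> ?thesis"
    then show False
      using le[of R1] solD(1)[OF A2(1), of R1] A1(3) by (auto simp: extend_def)
  qed
  have le': "g y \<le> F y" if "0 < y" "y < R2" for y
    using le[of y] that R12 by (simp add: extend_def)
  consider "x = 0" | "0 < x" "x < R2" | "x = R2" using x by linarith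
  then show False
  proof cases
    case 1
    then have "(D2 powr (1 / (m - p))) powr (m - p) = (D1 powr (1 / (m - p))) powr (m - p)"
      using eq by (simp add: extend_def)
    then have D: "D1 = D2" using A1 A2 p_lt_m by (simp add: powr_powr)
    have "\<forall>\<^sub>F y in at_right 0. (g y powr (m - p) - D2) / y powr (\<sigma> + 2) \<le> (F y powr (m - p) - D1) / y powr (\<sigma> + 2)"
      using eventually_at_right_real[OF A2(3)]
    proof (rule eventually_mono)
      fix y assume y: "y \<in> {0<..<R2}"
      then have "g y powr (m - p) \<le> F y powr (m - p)"
        using le'[of y] solD(1)[OF A2(1), of y] p_lt_m by (intro powr_mono2) auto
      then show "(g y powr (m - p) - D2) / y powr (\<sigma> + 2) \<le> (F y powr (m - p) - D1) / y powr (\<sigma> + 2)"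
        using D by (intro divide_right_mono) auto
    qed
    \<comment> \<open>The limits of the quotients inherit the order, but \<open>K > k\<close> gives
      \<open>F\<close> the smaller second coefficient.\<close>
    from tendsto_le[OF _ A1(5) A2(5) this] have "- k * origin_coeff \<le> - K * origin_coeff" by simp
    then show False using ab origin_coeff_pos by simp
  next
    case 2
    then have x1: "0 < x" "x < R1" using R12 by auto
    have e: "F x = g x" using eq 2 R12 by (simp add: extend_def)
    define u where "u y = F y powr m - g y powr m" for y
    define v where "v y = F' y - g' y" for y
    have du: "(u has_real_derivative v y) (at y)" if "0 < y" "y < R2" for y
      unfolding u_def v_def
      using that R12 by (intro DERIV_diff sol_w_deriv[OF A1(1)] sol_w_deriv[OF A2(1)]) auto
    have u0: "u x = 0" by (simp add: u_def e)
    have unn: "0 \<le> u y" if "0 < y" "y < R2" for y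
      using le'[OF that] solD(1)[OF A2(1) that] m_gt by (auto simp: u_def intro!: powr_mono2)
    have "v x = 0"
    proof (rule DERIV_local_min[OF du[OF 2]])
      show "0 < min x (R2 - x)" using 2 by simp
      show "\<forall>y. \<bar>x - y\<bar> < min x (R2 - x) \<longrightarrow> u x \<le> u y" using unn u0 by auto
    qed
    then have v0: "F' x = g' x" by (simp add: v_def)
    \<comment> \<open>At the contact point values and derivatives agree, so all terms of the two
      equations cancel except the reaction: \<open>u'' < 0\<close> at a minimum of
      \<open>u\<close>.\<close>
    have dv: "(v has_real_derivative (k - K) * (x powr \<sigma> * g x powr p)) (at x)"
      unfolding v_def
      by (rule DERIV_cong[OF DERIV_diff[OF solD(3)[OF A1(1) x1] solD(3)[OF A2(1) 2]]])
        (simp add: e v0 algebra_simps)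
    have "(k - K) * (x powr \<sigma> * g x powr p) < 0"
      using ab x1 solD(1)[OF A2(1) 2] by (intro mult_neg_pos) auto
    from has_real_derivative_neg_dec_right[OF dv this]
    obtain d where d: "d > 0" "\<And>h. h > 0 \<Longrightarrow> h < d \<Longrightarrow> v (x + h) < v x" by auto
    define y where "y = x + min (d/2) ((R2 - x)/2)"
    have y: "x < y" "y < R2" "y < x + d" using d 2 by (auto simp: y_def min_def field_simps)
    have "u y < u x"
    proof (rule DERIV_neg_imp_decreasing_open[OF y(1)])
      fix z assume z: "x < z" "z < y"
      have "v z < 0" using d(2)[of "z - x"] z y v0 by (simp add: v_def)
      then show "\<exists>d. DERIV u z :> d \<and> d < 0" using du[of z] z y 2 by force
    next
      show "continuous_on {x..y} u"
        using du y 2 by (intro continuous_at_imp_continuous_on ballI DERIV_isCont[OF du]) auto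
    qed
    then show False using u0 unn[of y] y 2 by simp
  next
    case 3
    have "R1 = R2"
    proof (rule ccontr)
      assume "R1 \<noteq> R2"
      then show False using eq 3 R12 solD(1)[OF A1(1), of R2] A2(3) by (auto simp: extend_def)
    qed
    then have A1': "sol a b K R2 F F'" "vanishing R2 F F'" using A1 by auto
    \<comment> \<open>The integral comparison makes the profiles coincide near the interface; there
      the two equations differ only in the reaction term, which is impossible for
      \<open>k < K\<close>.\<close>
    obtain r where r: "0 < r" "r < R2" "\<And>x. r < x \<Longrightarrow> x < R2 \<Longrightarrow> F x = g x"
      by (rule same_interface_eq[OF A1'(1) A2(1) ab(1,2,3) less_imp_le[OF ab(4)] A1'(2) A2(2)])
        (use prof_deriv_neg[OF F ab(1) K(2,1)] prof_deriv_neg[OF g ab(1) K(2) ab(3)] le' \<open>R1 = R2\<close> in auto)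
    define y where "y = (r + R2) / 2"
    have y: "r < y" "y < R2" "0 < y" using r by (auto simp: y_def)
    have fg: "F z = g z" if "r < z" "z < R2" for z using r(3) that by blast
    have evw: "\<forall>\<^sub>F z in nhds w. F z = g z" if "r < w" "w < R2" for w
      using eventually_nhds_in_open[of "{r<..<R2}" w] that fg by (auto elim!: eventually_mono)
    have g': "F' w = g' w" if w: "r < w" "w < R2" for w
    proof -
      have w0: "0 < w" using w r by simp
      have ev: "\<forall>\<^sub>F z in nhds w. F z powr m = g z powr m"
        using evw[OF w] by (auto elim!: eventually_mono)
      have "((\<lambda>z. g z powr m) has_real_derivative F' w) (at w)"
        using sol_w_deriv[OF A1'(1) w0 w(2)] DERIV_cong_ev[OF refl ev refl] by auto
      then show ?thesis using sol_w_deriv[OF A2(1) w0 w(2)] DERIV_unique by blast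
    qed
    have ev': "\<forall>\<^sub>F z in nhds y. F' z = g' z"
      using eventually_nhds_in_open[of "{r<..<R2}" y] y g' by (auto elim!: eventually_mono)
    from DERIV_cong_ev[OF refl ev' refl] solD(3)[OF A1'(1) y(3,2)]
    have "(g' has_real_derivative (- ((real N - 1) / y * F' y) + a * F y
        - b * y * (F' y * F y powr (1 - m) / m) - K * y powr \<sigma> * F y powr p)) (at y)" by blast
    from DERIV_unique[OF this solD(3)[OF A2(1) y(3,2)]]
    have "K * y powr \<sigma> * g y powr p = k * y powr \<sigma> * g y powr p"
      unfolding fg[OF y(1,2)] g'[OF y(1,2)] by linarith
    then show False using ab y solD(1)[OF A2(1) y(3,2)] by simp
  qed
qed

lemma prof_dominates:
  assumes f: "prof \<alpha> \<beta> 1 D1 R1 f f'" and g: "prof \<alpha> \<beta> 1 D2 R2 g g'" and x: "0 \<le> x" "x \<le> R2"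
  shows "extend D2 R2 g x \<le> extend D1 R1 f x"
proof -
  have A1: "sol \<alpha> \<beta> 1 R1 f f'" "0 < R1" "0 < D1" using f by (auto simp: prof_def vanishing_def)
  have A2: "sol \<alpha> \<beta> 1 R2 g g'" "0 < R2" "0 < D2" using g by (auto simp: prof_def vanishing_def)
  let ?f = "extend D1 R1 f" and ?g = "extend D2 R2 g"
  have cf: "continuous_on A ?f" and cg: "continuous_on A ?g" for A
    using extend_continuous[OF f] extend_continuous[OF g] continuous_on_subset by blast+
  \<comment> \<open>The exponent with \<open>(l^e)^(m-1) l^2 = 1\<close>, for which the rescaling
    preserves \<open>a\<close> and \<open>b\<close>.\<close>
  define e where "e = - 2 / (m - 1)"
  have e: "e < 0" using m_gt by (simp add: e_def divide_neg_pos)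
  have e2: "e * (m - 1) = - 2"
    using m_gt nonzero_eq_divide_eq[of "m - 1" e "- 2"] by (simp add: e_def)
  define \<Phi> where "\<Phi> l x = l powr e * ?f (l * x)" for l x
  have scaled: "prof \<alpha> \<beta> (l powr (e * (m - p) + (\<sigma> + 2))) (l powr (e * (m - p)) * D1) (R1 / l)
      (\<lambda>x. l powr e * f (l * x)) (\<lambda>x. (l powr e) powr m * l * f' (l * x))" if "0 < l" for l
  proof -
    have "(l powr e) powr (m - 1) * l\<^sup>2 = l powr (e * (m - 1)) * l powr 2"
      using that by (simp add: powr_powr powr_numeral)
    also have "\<dots> = l powr (e * (m - 1) + 2)" by (simp add: powr_add)
    also have "e * (m - 1) + 2 = 0" using e2 by simp
    finally have 1: "(l powr e) powr (m - 1) * l\<^sup>2 = 1" using that by simp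
    show ?thesis
      using prof_scale[OF f, of "l powr e" l] that 1 by (simp add: powr_powr powr_add)
  qed
  have \<Phi>_ext: "\<Phi> l x = extend (l powr (e * (m - p)) * D1) (R1 / l) (\<lambda>x. l powr e * f (l * x)) x"
    if "0 < l" for l x
  proof -
    have "(l powr (e * (m - p)) * D1) powr (1 / (m - p)) = l powr e * D1 powr (1 / (m - p))"
      using A1 p_lt_m by (simp add: powr_mult powr_powr)
    moreover have "l * x \<le> 0 \<longleftrightarrow> x \<le> 0" "l * x < R1 \<longleftrightarrow> x < R1 / l"
      using that by (auto simp: mult_le_0_iff field_simps)
    ultimately show ?thesis by (simp add: \<Phi>_def extend_def)
  qed
  \<comment> \<open>The start of the sliding: as \<open>e < 0\<close>, the factor \<open>l^e\<close>
    is large for small \<open>l\<close>, while \<open>f (l x)\<close> stays above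
    \<open>f(0) / 2\<close> on \<open>[0, R2]\<close>.\<close>
  define B where "B = Sup (?g ` {0..R2})"
  have bddg: "bdd_above (?g ` {0..R2})"
    by (intro bounded_imp_bdd_above compact_imp_bounded compact_continuous_image cg compact_Icc)
  have gB: "?g x \<le> B" if "0 \<le> x" "x \<le> R2" for x
    unfolding B_def using bddg that by (intro cSUP_upper) auto
  have f0: "0 < ?f 0" using A1 by (simp add: extend_def)
  have "isCont ?f 0" using cf[of UNIV] by (simp add: continuous_on_eq_continuous_at)
  then have "\<forall>\<^sub>F x in at 0. ?f 0 / 2 < ?f x"
    unfolding isCont_def using f0 by (intro order_tendstoD) auto
  then obtain d where d: "0 < d" "\<And>y. y \<noteq> 0 \<Longrightarrow> \<bar>y\<bar> < d \<Longrightarrow> ?f 0 / 2 < ?f y"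
    unfolding eventually_at by (auto simp: dist_real_def)
  have d': "?f 0 / 2 < ?f y" if "0 \<le> y" "y < d" for y
    using d(2)[of y] that f0 by (cases "y = 0") auto
  have "filterlim (\<lambda>l. - ln l) at_top (at_right (0::real))"
    using ln_at_0 by (simp add: filterlim_uminus_at_top)
  then have "filterlim (\<lambda>l. exp (- e * - ln l)) at_top (at_right 0)"
    using e by (intro filterlim_compose[OF exp_at_top filterlim_tendsto_pos_mult_at_top[OF tendsto_const]]) simp_all
  moreover have "\<forall>\<^sub>F l in at_right 0. exp (- e * - ln l) = l powr e"
    using eventually_at_right_less by (rule eventually_mono) (simp add: powr_def)
  ultimately have "filterlim (\<lambda>l::real. l powr e) at_top (at_right 0)"
    using filterlim_cong by fastforce
  then have "\<forall>\<^sub>F l in at_right 0. 2 * \<bar>B\<bar> / ?f 0 < l powr e"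
    by (auto simp: filterlim_at_top_dense)
  moreover have "\<forall>\<^sub>F l in at_right 0. l \<in> {0<..<d / (R2 + 1)}"
    using d A2 by (intro eventually_at_right_real) auto
  moreover have "\<forall>\<^sub>F l in at_right (0::real). l \<in> {0<..<1}" by (intro eventually_at_right_real) auto
  ultimately have "\<forall>\<^sub>F l in at_right 0. 0 < l \<and> l < 1 \<and> (\<forall>x\<in>{0..R2}. ?g x < \<Phi> l x)"
  proof eventually_elim
    case (elim l)
    have "?g x < \<Phi> l x" if x: "x \<in> {0..R2}" for x
    proof -
      have "l * x \<le> l * (R2 + 1)" using x elim by (intro mult_left_mono) auto
      also have "\<dots> < d" using elim A2 by (auto simp: field_simps)
      finally have lf: "?f 0 / 2 < ?f (l * x)" using d'[of "l * x"] x elim by auto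
      have "?g x \<le> \<bar>B\<bar>" using gB[of x] x by auto
      also have "\<bar>B\<bar> < l powr e * (?f 0 / 2)" using elim f0 by (simp add: field_simps)
      also have "\<dots> \<le> \<Phi> l x" unfolding \<Phi>_def using lf by (intro mult_left_mono) auto
      finally show ?thesis .
    qed
    then show ?case using elim by auto
  qed
  then obtain l1 where l1: "0 < l1" "\<And>l. 0 < l \<Longrightarrow> l < l1 \<Longrightarrow> l < 1 \<and> (\<forall>x\<in>{0..R2}. ?g x < \<Phi> l x)"
    unfolding eventually_at_right_field by auto
  define l0 where "l0 = l1 / 2"
  have l0: "0 < l0" "l0 < 1" "l0 < l1" using l1(1) l1(2)[of "l1/2"] by (auto simp: l0_def)
  \<comment> \<open>The pairs of parameter and point at which the strict order fails. The
    restriction to \<open>l >= l0 > 0\<close> makes this set compact, which provides a smallest bad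
    parameter; parameters below \<open>l0\<close> are good by the choice of
    \<open>l1\<close>.\<close>
  define T where "T = {z \<in> {l0..1} \<times> {0..R2}. \<Phi> (fst z) (snd z) \<le> ?g (snd z)}"
  have cont\<Phi>: "continuous_on ({l0..1} \<times> {0..R2}) (\<lambda>z. \<Phi> (fst z) (snd z))"
    unfolding \<Phi>_def using l0
    by (intro continuous_intros continuous_on_compose2[OF cf[of UNIV]]) auto
  have isCont\<Phi>: "isCont (\<lambda>l. \<Phi> l x) s" if "0 < s" for s x
  proof -
    have "isCont ?f (s * x)" using cf[of UNIV] by (simp add: continuous_on_eq_continuous_at)
    then have "isCont (\<lambda>l. ?f (l * x)) s"
      by (intro isCont_o2[where f = "\<lambda>l. l * x" and g = ?f]) (auto intro!: continuous_intros)
    moreover have "isCont (\<lambda>l. l powr e) s" using that by (intro continuous_intros) auto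
    ultimately show ?thesis unfolding \<Phi>_def by (intro continuous_mult)
  qed
  have contg: "continuous_on ({l0..1} \<times> {0..R2}) (\<lambda>z. ?g (snd z))"
    by (intro continuous_on_compose2[OF cg[of UNIV]] continuous_intros) auto
  have "closed T" unfolding T_def
    by (rule continuous_on_closed_Collect_le[OF cont\<Phi> contg]) (simp add: closed_Times)
  moreover have "bounded T"
    by (rule bounded_subset[of "{l0..1} \<times> {0..R2}"]) (auto simp: T_def bounded_Times)
  ultimately have cT: "compact T" by (simp add: compact_eq_bounded_closed)
  then have cfst: "compact (fst ` T)" by (intro compact_continuous_image continuous_intros)
  have above: "?g x < \<Phi> l x" if "0 < l" "l \<le> 1" "l \<notin> fst ` T" "0 \<le> x" "x \<le> R2" for l x
  proof (cases "l < l0")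
    case True
    then show ?thesis using l1(2)[of l] l0 that by auto
  next
    case False
    have "(l, x) \<notin> T" using that(3) by (metis fst_conv image_eqI)
    then show ?thesis using False that by (simp add: T_def not_le)
  qed
  have one: "fst ` T \<subseteq> {1}"
  proof (rule ccontr)
    assume n: "\<not> fst ` T \<subseteq> {1}"
    then have ne: "fst ` T \<noteq> {}" by auto
    define s where "s = Inf (fst ` T)"
    have bdd: "bdd_below (fst ` T)" by (intro bounded_imp_bdd_below compact_imp_bounded cfst)
    have sT: "s \<in> fst ` T" unfolding s_def
      using closed_contains_Inf[OF ne bdd] cfst compact_imp_closed by blast
    have s1: "s < 1"
    proof -
      obtain l where l: "l \<in> fst ` T" "l \<noteq> 1" using n by auto
      then have "l < 1" by (auto simp: T_def)
      then show ?thesis using cInf_lower[OF l(1) bdd] by (simp add: s_def)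
    qed
    have s0: "l0 \<le> s" "0 < s" using sT l0 by (auto simp: T_def)
    \<comment> \<open>The weak order at the smallest bad parameter \<open>s\<close> is the limit of
      the order at smaller ones; it is what excludes contact at \<open>s\<close>.\<close>
    have le: "?g x \<le> \<Phi> s x" if x: "0 \<le> x" "x \<le> R2" for x
    proof -
      have "((\<lambda>l. \<Phi> l x) \<longlongrightarrow> \<Phi> s x) (at_left s)"
        using isCont\<Phi>[OF s0(2)] by (auto simp: isCont_def intro: tendsto_within_subset)
      moreover have "\<forall>\<^sub>F l in at_left s. ?g x \<le> \<Phi> l x"
        using eventually_at_left_real[OF s0(2)]
      proof (rule eventually_mono)
        fix l assume l: "l \<in> {0<..<s}"
        then have "l \<notin> fst ` T" using cInf_lower[OF _ bdd, of l] by (auto simp: s_def)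
        then show "?g x \<le> \<Phi> l x" using above[of l x] l s1 x by auto
      qed
      ultimately show ?thesis by (intro tendsto_lowerbound) auto
    qed
    obtain x where x: "0 \<le> x" "x \<le> R2" "\<Phi> s x \<le> ?g x" using sT by (auto simp: T_def)
    \<comment> \<open>Here \<open>p < p_c\<close> is used: \<open>m - 1\<close> times the exponent
      of the reaction coefficient is \<open>\<sigma> (m - 1) + 2 (p - 1) < 0\<close>, so the
      coefficient exceeds 1 for \<open>s < 1\<close>.\<close>
    have K: "1 < s powr (e * (m - p) + (\<sigma> + 2))"
    proof -
      have "\<sigma> * (m - 1) + 2 * (p - 1) < 0" using ss_denominator_neg[OF p_crit] .
      moreover have "(m - 1) * (e * (m - p) + (\<sigma> + 2)) = \<sigma> * (m - 1) + 2 * (p - 1)"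
      proof -
        have "(m - 1) * (e * (m - p) + (\<sigma> + 2)) = (e * (m - 1)) * (m - p) + (\<sigma> + 2) * (m - 1)"
          by (simp add: algebra_simps)
        then show ?thesis unfolding e2 by (simp add: algebra_simps)
      qed
      ultimately have "e * (m - p) + (\<sigma> + 2) < 0" using m_gt by (metis diff_gt_0_iff_gt mult_less_0_iff not_less_iff_gr_or_eq)
      then show ?thesis using s0 s1 powr_less_mono2_neg[of "e * (m - p) + (\<sigma> + 2)" s 1] by simp
    qed
    have "?g x < \<Phi> s x"
      unfolding \<Phi>_ext[OF s0(2)]
      by (rule no_touching[OF scaled[OF s0(2)] g less_imp_le[OF \<alpha>_pos] \<beta>_pos zero_less_one K _ x(1,2)])
        (use le \<Phi>_ext[OF s0(2)] in auto)
    then show False using x by simp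
  qed
  have "((\<lambda>l. \<Phi> l x) \<longlongrightarrow> \<Phi> 1 x) (at_left 1)"
    using isCont\<Phi>[OF zero_less_one] by (auto simp: isCont_def intro: tendsto_within_subset)
  moreover have "\<forall>\<^sub>F l in at_left 1. ?g x \<le> \<Phi> l x"
    using eventually_at_left_real[OF zero_less_one]
  proof (rule eventually_mono)
    fix l :: real assume l: "l \<in> {0<..<1}"
    then have "l \<notin> fst ` T" using one by auto
    then show "?g x \<le> \<Phi> l x" using above[of l x] l x by auto
  qed
  ultimately have "?g x \<le> \<Phi> 1 x" by (intro tendsto_lowerbound) auto
  then show ?thesis by (simp add: \<Phi>_def)
qed

lemma prof_unique:
  assumes f: "prof \<alpha> \<beta> 1 D1 R1 f f'" and g: "prof \<alpha> \<beta> 1 D2 R2 g g'"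
  shows "R2 = R1" "\<And>x. 0 < x \<Longrightarrow> x < R1 \<Longrightarrow> g x = f x"
proof -
  have le: "R2 \<le> R1" if f: "prof \<alpha> \<beta> 1 D1 R1 f f'" and g: "prof \<alpha> \<beta> 1 D2 R2 g g'"
    for D1 R1 f f' D2 R2 g g'
  proof (rule ccontr)
    assume n: "\<not> R2 \<le> R1"
    have "sol \<alpha> \<beta> 1 R2 g g'" "0 < R1" using f g by (auto simp: prof_def vanishing_def)
    then show False
      using prof_dominates[OF f g, of R1] n solD(1)[of \<alpha> \<beta> 1 R2 g g' R1] by (auto simp: extend_def)
  qed
  show R: "R2 = R1" using le[OF f g] le[OF g f] by simp
  show "g x = f x" if "0 < x" "x < R1" for x
    using prof_dominates[OF f g, of x] prof_dominates[OF g f, of x] that R by (simp add: extend_def)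
qed

end

section \<open>The initial value problem at the origin\<close>

text \<open>The integrands below may be singular at 0, so they are dominated by an integrable power,
  and the end point 0 is added as a null set.\<close>

lemma integrable_bounded_by_powr:
  fixes h :: "real \<Rightarrow> real"
  assumes h: "continuous_on {0<..R} h" and a: "a > -1"
    and b: "\<And>s. 0 < s \<Longrightarrow> s \<le> R \<Longrightarrow> \<bar>h s\<bar> \<le> C * s powr a"
  shows "h integrable_on {0..R}"
proof (cases "R < 0")
  case False
  then have "(\<lambda>s. C * s powr a) integrable_on {0..R}"
    using has_integral_mult_right[OF has_integral_powr_from_0[OF a, of R], of C] by (auto simp: integrable_on_def)
  then have "(\<lambda>s. C * s powr a) integrable_on {0<..R}"
    by (rule integrable_spike_set) (auto intro: negligible_subset[of "{0}"])
  moreover have "h \<in> borel_measurable (lebesgue_on {0<..R})"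
    by (rule continuous_imp_measurable_on_sets_lebesgue[OF h]) simp
  ultimately have "h integrable_on {0<..R}"
  proof (elim measurable_bounded_by_integrable_imp_integrable[rotated])
    show "norm (h s) \<le> C * s powr a" if "s \<in> {0<..R}" for s using b[of s] that by simp
  qed simp
  then show ?thesis
    by (rule integrable_spike_set) (auto intro: negligible_subset[of "{0}"])
qed (simp add: integrable_on_empty)

lemma continuous_bound_Icc:
  fixes h :: "real \<Rightarrow> real"
  assumes "continuous_on {a..b} h"
  obtains B where "0 \<le> B" "\<And>s. a \<le> s \<Longrightarrow> s \<le> b \<Longrightarrow> \<bar>h s\<bar> \<le> B"
proof -
  have "bounded (h ` {a..b})"
    by (intro compact_imp_bounded compact_continuous_image assms compact_Icc)
  then obtain B where B: "\<And>s. s \<in> {a..b} \<Longrightarrow> \<bar>h s\<bar> \<le> B"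
    unfolding bounded_iff by (metis imageI real_norm_def)
  show ?thesis
  proof (rule that[of "max 0 B"])
    show "\<bar>h s\<bar> \<le> max 0 B" if "a \<le> s" "s \<le> b" for s using B[of s] that by simp
  qed simp
qed

lemma integral_from_0_deriv:
  fixes h :: "real \<Rightarrow> real"
  assumes h: "continuous_on {0<..R} h" and i: "h integrable_on {0..R}" and s: "0 < s" "s < R"
  shows "((\<lambda>s. integral {0..s} h) has_real_derivative h s) (at s)"
proof -
  \<comment> \<open>Splitting off \<open>[0, c]\<close> keeps the singular end point away from the
    fundamental theorem of calculus.\<close>
  define c where "c = s / 2"
  have c: "0 < c" "c < s" using s by (auto simp: c_def)
  have "((\<lambda>x. integral {c..x} h) has_real_derivative h s) (at s within {c..R})"
    by (rule integral_has_real_derivative) (use c s in \<open>auto intro: continuous_on_subset[OF h]\<close>)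
  moreover have "at s within {c..R} = at s"
    by (rule at_within_interior) (use c s in simp)
  ultimately have Dc: "((\<lambda>x. integral {c..x} h) has_real_derivative h s) (at s)" by simp
  have D: "((\<lambda>x. integral {0..c} h + integral {c..x} h) has_real_derivative h s) (at s)"
    using DERIV_add[OF DERIV_const[of "integral {0..c} h"] Dc] by simp
  have "\<forall>\<^sub>F x in nhds s. integral {0..c} h + integral {c..x} h = integral {0..x} h"
  proof (rule eventually_mono)
    show "\<forall>\<^sub>F x in nhds s. x \<in> {c<..<R}" using eventually_nhds_in_open[of "{c<..<R}" s] c s by simp
    fix x assume x: "x \<in> {c<..<R}"
    have "h integrable_on {0..x}" by (rule integrable_on_subinterval[OF i]) (use x c in auto)
    then show "integral {0..c} h + integral {c..x} h = integral {0..x} h"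
      using Henstock_Kurzweil_Integration.integral_combine[of 0 c x h] x c by simp
  qed
  from DERIV_cong_ev[OF refl this refl] D show ?thesis by blast
qed

lemma continuous_on_Ici:
  fixes h :: "real \<Rightarrow> 'a::topological_space"
  assumes "\<And>R. 0 < R \<Longrightarrow> continuous_on {0..R} h"
  shows "continuous_on {0..} h"
  unfolding continuous_on_def
proof
  fix x :: real assume x: "x \<in> {0..}"
  have "at x within {0..} = at x within {0..x+1}"
    by (rule at_within_nhd[of x "{..<x+1}"]) auto
  then show "(h \<longlongrightarrow> h x) (at x within {0..})"
    using assms[of "x+1"] x by (auto simp: continuous_on_def)
qed

lemma powr_lipschitz:
  fixes u v :: real
  assumes "0 < \<delta>" "\<delta> \<le> u" "\<delta> \<le> v" "0 < q" "q \<le> 1"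
  shows "\<bar>u powr q - v powr q\<bar> \<le> \<delta> powr (q - 1) * \<bar>u - v\<bar>"
proof -
  have *: "\<bar>u powr q - v powr q\<bar> \<le> \<delta> powr (q - 1) * \<bar>u - v\<bar>" if "v < u" "\<delta> \<le> v" for u v
  proof -
    have "\<exists>z>v. z < u \<and> u powr q - v powr q = (u - v) * (q * z powr (q - 1))"
      by (rule MVT2[OF that(1)]) (use assms(1) that in \<open>auto intro!: has_real_derivative_powr\<close>)
    then obtain z where z: "v < z" "z < u" "u powr q - v powr q = (u - v) * (q * z powr (q - 1))" by blast
    have "q * z powr (q - 1) \<le> 1 * \<delta> powr (q - 1)"
      using assms that z by (intro mult_mono powr_mono2') auto
    moreover have "0 \<le> q * z powr (q - 1)" using assms by simp
    ultimately show ?thesis using z that by (simp add: abs_mult mult.commute mult_right_mono)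
  qed
  show ?thesis
    using *[of v u] *[of u v] assms by (cases u v rule: linorder_cases) (auto simp: abs_minus_commute)
qed

section \<open>Volterra formulation at the singular origin\<close>

context profile_equation
begin

text \<open>The flux identity integrated twice: \<open>Zint\<close> is the flux, \<open>Gint\<close>
  the derivative of \<open>f^m\<close> recovered from it, \<open>Jint\<close> the increment of
  \<open>f^m\<close>. With \<open>x\<close>, \<open>y\<close>, \<open>z\<close> as free arguments
  these operators are linear, so one bound also covers differences of solutions.\<close>

definition src :: "(real \<Rightarrow> real) \<Rightarrow> (real \<Rightarrow> real) \<Rightarrow> real \<Rightarrow> real" where
  "src x y r = r powr (real N - 1) * x r + r powr (real N - 1 + \<sigma>) * y r"

definition Zint :: "(real \<Rightarrow> real) \<Rightarrow> (real \<Rightarrow> real) \<Rightarrow> real \<Rightarrow> real" where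
  "Zint x y s = integral {0..s} (src x y)"

definition Gint :: "(real \<Rightarrow> real) \<Rightarrow> (real \<Rightarrow> real) \<Rightarrow> (real \<Rightarrow> real) \<Rightarrow> real \<Rightarrow> real" where
  "Gint x y z s = s powr (1 - real N) * Zint x y s + s * z s"

definition Jint :: "(real \<Rightarrow> real) \<Rightarrow> (real \<Rightarrow> real) \<Rightarrow> (real \<Rightarrow> real) \<Rightarrow> real \<Rightarrow> real" where
  "Jint x y z \<eta> = integral {0..\<eta>} (Gint x y z)"

text \<open>The exponent is a primitive of the bound \<open>s + s\<^bsup>1+\<sigma>\<^esup>\<close> for the kernel, so that this weight makes
  the Volterra operator a contraction on the whole half line.\<close>
definition weight :: "real \<Rightarrow> real \<Rightarrow> real" where
  "weight l s = exp (l * (s\<^sup>2 / 2 + s powr (\<sigma> + 2) / (\<sigma> + 2)))"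

text \<open>Collects the constants of the integrated kernel: \<open>1/N <= 1\<close> together with
  the drift gives 2, the reaction gives \<open>1 / (N + \<sigma>)\<close>.\<close>

definition kconst :: real where "kconst = 2 + 1 / (real N + \<sigma>)"

lemma kconst_pos: "0 < kconst" using N\<sigma>_pos by (simp add: kconst_def add_pos_pos)

lemma weight_mono: "0 \<le> l \<Longrightarrow> 0 \<le> r \<Longrightarrow> r \<le> s \<Longrightarrow> weight l r \<le> weight l s"
  using \<sigma>_gt unfolding weight_def
  by (auto intro!: mult_left_mono add_mono divide_right_mono powr_mono2 power_mono)

lemma weight_ge_1: "0 \<le> l \<Longrightarrow> 0 \<le> s \<Longrightarrow> 1 \<le> weight l s"
  using weight_mono[of l 0 s] by (simp add: weight_def)

lemma weight_pos [simp]: "0 < weight l s" by (simp add: weight_def)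

lemma continuous_on_weight [continuous_intros]: "continuous_on {0..} (weight l)"
  unfolding weight_def using \<sigma>_gt by (auto intro!: continuous_intros continuous_on_powr')

lemma weight_deriv:
  assumes "0 < s"
  shows "(weight l has_real_derivative l * (s + s powr (1 + \<sigma>)) * weight l s) (at s)"
proof -
  have "((\<lambda>s. l * (s\<^sup>2 / 2 + s powr (\<sigma> + 2) / (\<sigma> + 2))) has_real_derivative l * (s + s powr (1 + \<sigma>))) (at s)"
    using assms \<sigma>_gt by (auto intro!: derivative_eq_intros simp: add.commute)
  from DERIV_fun_exp[OF this] show ?thesis unfolding weight_def [abs_def] by (simp add: mult_ac)
qed

lemma src_cont:
  assumes "continuous_on {0..R} x" "continuous_on {0..R} y"
  shows "continuous_on {0<..R} (src x y)"
  unfolding src_def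
  by (intro continuous_intros continuous_on_subset[OF assms(1)] continuous_on_subset[OF assms(2)]) auto

lemma src_bound:
  assumes "0 \<le> l" "\<And>s. 0 \<le> s \<Longrightarrow> s \<le> R \<Longrightarrow> \<bar>x s\<bar> \<le> d * weight l s \<and> \<bar>y s\<bar> \<le> d * weight l s" "0 \<le> d"
    and "0 < r" "r \<le> s" "s \<le> R"
  shows "\<bar>src x y r\<bar> \<le> d * weight l s * (r powr (real N - 1) + r powr (real N - 1 + \<sigma>))"
proof -
  have "d * weight l r \<le> d * weight l s"
    using assms weight_mono[of l r s] by (intro mult_left_mono) auto
  then have b: "\<bar>x r\<bar> \<le> d * weight l s" "\<bar>y r\<bar> \<le> d * weight l s"
    using assms(2)[of r] assms(4-6) by linarith+
  have "\<bar>src x y r\<bar> \<le> r powr (real N - 1) * \<bar>x r\<bar> + r powr (real N - 1 + \<sigma>) * \<bar>y r\<bar>"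
    unfolding src_def by (rule order_trans[OF abs_triangle_ineq]) (simp add: abs_mult)
  also have "\<dots> \<le> r powr (real N - 1) * (d * weight l s) + r powr (real N - 1 + \<sigma>) * (d * weight l s)"
    using b by (intro add_mono mult_left_mono) auto
  finally show ?thesis by (simp add: algebra_simps)
qed

lemma kernel_has_integral:
  assumes "0 \<le> s"
  shows "((\<lambda>r. c * (r powr (real N - 1) + r powr (real N - 1 + \<sigma>))) has_integral
     c * (s powr real N / real N + s powr (real N + \<sigma>) / (real N + \<sigma>))) {0..s}"
  using has_integral_powr_from_0[of "real N - 1" s] has_integral_powr_from_0[of "real N - 1 + \<sigma>" s] N_ge N\<sigma>_pos assms
  by (intro has_integral_mult_right has_integral_add) (auto simp: algebra_simps)

lemma src_integrable:
  assumes c: "continuous_on {0..R} x" "continuous_on {0..R} y" and s: "0 \<le> s" "s \<le> R"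
  shows "src x y integrable_on {0..s}"
proof -
  obtain B1 B2 where B: "\<And>s. 0 \<le> s \<Longrightarrow> s \<le> R \<Longrightarrow> \<bar>x s\<bar> \<le> B1" "\<And>s. 0 \<le> s \<Longrightarrow> s \<le> R \<Longrightarrow> \<bar>y s\<bar> \<le> B2"
    using continuous_bound_Icc[OF c(1)] continuous_bound_Icc[OF c(2)] by metis
  have i: "(\<lambda>s. s powr q * u s) integrable_on {0..s}"
    if "q > -1" "continuous_on {0..R} u" "\<And>s. 0 \<le> s \<Longrightarrow> s \<le> R \<Longrightarrow> \<bar>u s\<bar> \<le> B" for q u B
  proof (rule integrable_bounded_by_powr[OF _ that(1), of _ _ B])
    show "continuous_on {0<..s} (\<lambda>s. s powr q * u s)"
      using s by (intro continuous_intros continuous_on_subset[OF that(2)]) auto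
    show "\<bar>r powr q * u r\<bar> \<le> B * r powr q" if "0 < r" "r \<le> s" for r
      using that s \<open>\<And>s. 0 \<le> s \<Longrightarrow> s \<le> R \<Longrightarrow> \<bar>u s\<bar> \<le> B\<close>[of r] by (simp add: abs_mult mult.commute mult_right_mono)
  qed
  show ?thesis unfolding src_def [abs_def]
    by (intro integrable_add i[OF _ c(1) B(1)] i[OF _ c(2) B(2)]) (use N_ge N\<sigma>_pos in auto)
qed

lemma Zint_deriv:
  assumes c: "continuous_on {0..R} x" "continuous_on {0..R} y" and s: "0 < s" "s < R"
  shows "(Zint x y has_real_derivative src x y s) (at s)"
  unfolding Zint_def [abs_def]
  by (rule integral_from_0_deriv[OF src_cont[OF c] src_integrable[OF c] s]) (use s in auto)

lemma Zint_cont: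
  assumes c: "continuous_on {0..R} x" "continuous_on {0..R} y" and R: "0 \<le> R"
  shows "continuous_on {0..R} (Zint x y)"
  unfolding Zint_def [abs_def]
  by (rule indefinite_integral_continuous_1[OF src_integrable[OF c R order_refl]])

lemma Zint_bound:
  assumes c: "continuous_on {0..R} x" "continuous_on {0..R} y" and l: "0 \<le> l" "0 \<le> d"
    and b: "\<And>s. 0 \<le> s \<Longrightarrow> s \<le> R \<Longrightarrow> \<bar>x s\<bar> \<le> d * weight l s \<and> \<bar>y s\<bar> \<le> d * weight l s"
    and s: "0 \<le> s" "s \<le> R"
  shows "\<bar>Zint x y s\<bar> \<le> d * weight l s * (s powr real N / real N + s powr (real N + \<sigma>) / (real N + \<sigma>))"
proof -
  have "norm (integral {0..s} (src x y)) \<le>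
      integral {0..s} (\<lambda>r. d * weight l s * (r powr (real N - 1) + r powr (real N - 1 + \<sigma>)))"
  proof (rule integral_norm_bound_integral[OF src_integrable[OF c s]])
    show "(\<lambda>r. d * weight l s * (r powr (real N - 1) + r powr (real N - 1 + \<sigma>))) integrable_on {0..s}"
      using kernel_has_integral[OF s(1)] by blast
    fix r assume r: "r \<in> {0..s}"
    show "norm (src x y r) \<le> d * weight l s * (r powr (real N - 1) + r powr (real N - 1 + \<sigma>))"
    \<comment> \<open>At 0 all powers are 0 by convention, even \<open>0 powr 0\<close> when
      \<open>N = 1\<close>, so \<open>src\<close> vanishes there.\<close>
    proof (cases "r = 0")
      case False
      then show ?thesis using src_bound[OF l(1) b l(2), of R r s] r s by auto
    qed (simp add: src_def)
  qed
  also have "\<dots> = d * weight l s * (s powr real N / real N + s powr (real N + \<sigma>) / (real N + \<sigma>))"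
    by (rule integral_unique[OF kernel_has_integral[OF s(1)]])
  finally show ?thesis by (simp add: Zint_def)
qed

lemma Gint_bound:
  assumes c: "continuous_on {0..R} x" "continuous_on {0..R} y" and l: "0 \<le> l" "0 \<le> d"
    and b: "\<And>s. 0 \<le> s \<Longrightarrow> s \<le> R \<Longrightarrow> \<bar>x s\<bar> \<le> d * weight l s \<and> \<bar>y s\<bar> \<le> d * weight l s \<and> \<bar>z s\<bar> \<le> d * weight l s"
    and s: "0 < s" "s \<le> R"
  shows "\<bar>Gint x y z s\<bar> \<le> d * kconst * (s + s powr (1 + \<sigma>)) * weight l s"
proof -
  define W where "W = d * weight l s"
  have W: "0 \<le> W" using l by (simp add: W_def less_imp_le)
  have 1: "s powr (1 - real N) * s powr real N = s" "s powr (1 - real N) * s powr (real N + \<sigma>) = s powr (1 + \<sigma>)"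
    using s by (simp_all flip: powr_add)
  have "\<bar>Zint x y s\<bar> \<le> W * (s powr real N / real N + s powr (real N + \<sigma>) / (real N + \<sigma>))"
    unfolding W_def by (rule Zint_bound[OF c l]) (use b s in auto)
  then have "s powr (1 - real N) * \<bar>Zint x y s\<bar> \<le>
     s powr (1 - real N) * (W * (s powr real N / real N + s powr (real N + \<sigma>) / (real N + \<sigma>)))"
    by (intro mult_left_mono) auto
  also have "\<dots> = W * ((s powr (1 - real N) * s powr real N) / real N
      + (s powr (1 - real N) * s powr (real N + \<sigma>)) / (real N + \<sigma>))"
    by (simp add: algebra_simps)
  also have "\<dots> = W * (s / real N + s powr (1 + \<sigma>) / (real N + \<sigma>))" unfolding 1 ..
  also have "\<dots> \<le> W * (s + s powr (1 + \<sigma>) / (real N + \<sigma>))"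
    using N_ge s W by (intro mult_left_mono add_mono) (auto simp: divide_le_eq)
  finally have a1: "s powr (1 - real N) * \<bar>Zint x y s\<bar> \<le> \<dots>" .
  have a2: "s * \<bar>z s\<bar> \<le> s * W" using b[of s] s by (auto simp: W_def intro!: mult_left_mono)
  have "\<bar>Gint x y z s\<bar> \<le> s powr (1 - real N) * \<bar>Zint x y s\<bar> + s * \<bar>z s\<bar>"
    unfolding Gint_def using s by (intro order_trans[OF abs_triangle_ineq]) (simp add: abs_mult)
  also have "\<dots> \<le> W * (2 * s + s powr (1 + \<sigma>) / (real N + \<sigma>))"
    using a1 a2 by (simp add: algebra_simps)
  also have "\<dots> \<le> W * (kconst * (s + s powr (1 + \<sigma>)))"
  proof (intro mult_left_mono W)
    have "0 \<le> s / (real N + \<sigma>)" "0 \<le> 2 * s powr (1 + \<sigma>)" using s N\<sigma>_pos by auto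
    then show "2 * s + s powr (1 + \<sigma>) / (real N + \<sigma>) \<le> kconst * (s + s powr (1 + \<sigma>))"
      by (simp add: kconst_def algebra_simps)
  qed
  finally show ?thesis by (simp add: W_def mult_ac)
qed

lemma Gint_cont:
  assumes c: "continuous_on {0..R} x" "continuous_on {0..R} y" "continuous_on {0..R} z" and R: "0 \<le> R"
  shows "continuous_on {0<..R} (Gint x y z)"
  unfolding Gint_def [abs_def]
  by (intro continuous_intros continuous_on_subset[OF Zint_cont[OF c(1,2) R]] continuous_on_subset[OF c(3)]) auto

lemma Gint_integrable:
  assumes c: "continuous_on {0..R} x" "continuous_on {0..R} y" "continuous_on {0..R} z"
    and s: "0 \<le> s" "s \<le> R"
  shows "Gint x y z integrable_on {0..s}"
proof (cases "s = 0")
  case False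
  have R: "0 \<le> R" using s by simp
  obtain B1 B2 B3 where B: "0 \<le> B1" "\<And>s. 0 \<le> s \<Longrightarrow> s \<le> R \<Longrightarrow> \<bar>x s\<bar> \<le> B1" "\<And>s. 0 \<le> s \<Longrightarrow> s \<le> R \<Longrightarrow> \<bar>y s\<bar> \<le> B2"
     "\<And>s. 0 \<le> s \<Longrightarrow> s \<le> R \<Longrightarrow> \<bar>z s\<bar> \<le> B3"
    using continuous_bound_Icc[OF c(1)] continuous_bound_Icc[OF c(2)] continuous_bound_Icc[OF c(3)] by metis
  define d where "d = max B1 (max B2 B3)"
  have d0: "0 \<le> d" using B(1) by (simp add: d_def)
  \<comment> \<open>At \<open>l = 0\<close> the weight is identically 1, so the weighted estimate
    covers plain bounds.\<close>
  have b: "\<bar>x s\<bar> \<le> d * weight 0 s \<and> \<bar>y s\<bar> \<le> d * weight 0 s \<and> \<bar>z s\<bar> \<le> d * weight 0 s" if "0 \<le> s" "s \<le> R" for s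
    using B(2-4)[of s] that by (auto simp: d_def weight_def)
  \<comment> \<open>The smaller exponent in \<open>r + r^(1+\<sigma>)\<close>. It may be negative,
    but \<open>\<sigma> > -2\<close> keeps it above -1, hence integrable.\<close>
  define a where "a = min 1 (1 + \<sigma>)"
  have a: "a > -1" using \<sigma>_gt by (simp add: a_def)
  define C where "C = d * kconst * (2 * max 1 R powr 2)"
  show ?thesis
  proof (rule integrable_bounded_by_powr[OF _ a, of _ _ C])
    show "continuous_on {0<..s} (Gint x y z)"
      using Gint_cont[OF c R] s by (auto intro: continuous_on_subset)
    fix r assume r: "0 < r" "r \<le> s"
    have q: "r powr q \<le> max 1 R powr 2 * r powr a" if "a \<le> q" "q - a \<le> 2" for q
    proof -
      have "r powr (q - a) \<le> max 1 R powr (q - a)" using r s that by (intro powr_mono2) auto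
      also have "\<dots> \<le> max 1 R powr 2" using that by (intro powr_mono) auto
      finally have "r powr (q - a) * r powr a \<le> max 1 R powr 2 * r powr a" by (intro mult_right_mono) auto
      then show ?thesis by (simp flip: powr_add)
    qed
    have "r powr 1 + r powr (1 + \<sigma>) \<le> 2 * max 1 R powr 2 * r powr a"
      using q[of 1] q[of "1 + \<sigma>"] \<sigma>_neg \<sigma>_gt by (auto simp: a_def)
    then have "d * kconst * (r + r powr (1 + \<sigma>)) \<le> d * kconst * (2 * max 1 R powr 2 * r powr a)"
      using d0 kconst_pos r by (intro mult_left_mono) auto
    moreover have "\<bar>Gint x y z r\<bar> \<le> d * kconst * (r + r powr (1 + \<sigma>)) * weight 0 r"
      by (rule Gint_bound[OF c(1,2) _ d0]) (use b r s in auto)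
    ultimately show "\<bar>Gint x y z r\<bar> \<le> C * r powr a" by (simp add: weight_def C_def mult_ac)
  qed
qed (use integrable_on_refl[of "Gint x y z" "0::real"] in simp)

lemma Jint_deriv:
  assumes c: "continuous_on {0..R} x" "continuous_on {0..R} y" "continuous_on {0..R} z"
    and s: "0 < s" "s < R"
  shows "(Jint x y z has_real_derivative Gint x y z s) (at s)"
  unfolding Jint_def [abs_def]
  by (rule integral_from_0_deriv[OF Gint_cont[OF c] Gint_integrable[OF c] s]) (use s in auto)

lemma Jint_cont:
  assumes c: "continuous_on {0..R} x" "continuous_on {0..R} y" "continuous_on {0..R} z" and R: "0 \<le> R"
  shows "continuous_on {0..R} (Jint x y z)"
  unfolding Jint_def [abs_def]
  by (rule indefinite_integral_continuous_1[OF Gint_integrable[OF c R order_refl]])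

text \<open>The kernel bound times the weight is, up to the factor \<open>1 / l\<close>, the
  derivative of the weight, so integration gains \<open>1 / l\<close>; a large \<open>l\<close>
  makes the operator small.\<close>

lemma Jint_bound:
  assumes c: "continuous_on {0..R} x" "continuous_on {0..R} y" "continuous_on {0..R} z"
    and l: "0 < l" "0 \<le> d"
    and b: "\<And>s. 0 \<le> s \<Longrightarrow> s \<le> R \<Longrightarrow> \<bar>x s\<bar> \<le> d * weight l s \<and> \<bar>y s\<bar> \<le> d * weight l s \<and> \<bar>z s\<bar> \<le> d * weight l s"
    and \<eta>: "0 \<le> \<eta>" "\<eta> \<le> R"
  shows "\<bar>Jint x y z \<eta>\<bar> \<le> d * kconst / l * weight l \<eta>"
proof -
  have hi: "((\<lambda>s. d * kconst / l * (l * (s + s powr (1 + \<sigma>)) * weight l s)) has_integral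
       d * kconst / l * (weight l \<eta> - weight l 0)) {0..\<eta>}"
  proof (intro has_integral_mult_right fundamental_theorem_of_calculus_interior \<eta>)
    show "continuous_on {0..\<eta>} (weight l)"
      by (rule continuous_on_subset[OF continuous_on_weight]) auto
  qed (use weight_deriv in \<open>auto simp: has_real_derivative_iff_has_vector_derivative\<close>)
  have e: "(\<lambda>s. d * kconst / l * (l * (s + s powr (1 + \<sigma>)) * weight l s)) = (\<lambda>s. d * kconst * (s + s powr (1 + \<sigma>)) * weight l s)"
    using l by auto
  have "norm (integral {0..\<eta>} (Gint x y z)) \<le> integral {0..\<eta>} (\<lambda>s. d * kconst * (s + s powr (1 + \<sigma>)) * weight l s)"
  proof (rule integral_norm_bound_integral[OF Gint_integrable[OF c \<eta>]])
    show "(\<lambda>s. d * kconst * (s + s powr (1 + \<sigma>)) * weight l s) integrable_on {0..\<eta>}"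
      using hi unfolding e by blast
    fix s assume s: "s \<in> {0..\<eta>}"
    show "norm (Gint x y z s) \<le> d * kconst * (s + s powr (1 + \<sigma>)) * weight l s"
    proof (cases "s = 0")
      case False
      then show ?thesis using Gint_bound[OF c(1,2) less_imp_le[OF l(1)] l(2) b, of s] s \<eta> by simp
    qed (simp add: Gint_def)
  qed
  also have "\<dots> = d * kconst / l * (weight l \<eta> - weight l 0)"
    using integral_unique[OF hi] unfolding e .
  also have "\<dots> \<le> d * kconst / l * weight l \<eta>"
    using l kconst_pos weight_pos[of l 0] by (intro mult_left_mono) (auto simp del: weight_pos intro: less_imp_le)
  finally show ?thesis by (simp add: Jint_def)
qed

lemma Gint_diff:
  assumes c: "continuous_on {0..R} x" "continuous_on {0..R} y" "continuous_on {0..R} x'" "continuous_on {0..R} y'"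
    and s: "0 \<le> s" "s \<le> R"
  shows "Gint x y z s - Gint x' y' z' s = Gint (\<lambda>r. x r - x' r) (\<lambda>r. y r - y' r) (\<lambda>r. z r - z' r) s"
proof -
  have "Zint x y s - Zint x' y' s = Zint (\<lambda>r. x r - x' r) (\<lambda>r. y r - y' r) s"
    unfolding Zint_def integral_diff[OF src_integrable[OF c(1,2) s] src_integrable[OF c(3,4) s], symmetric]
    by (intro integral_cong) (simp add: src_def algebra_simps)
  moreover have "Gint x y z s - Gint x' y' z' s = s powr (1 - real N) * (Zint x y s - Zint x' y' s) + s * (z s - z' s)"
    by (simp add: Gint_def algebra_simps)
  ultimately show ?thesis by (simp add: Gint_def)
qed

lemma Jint_diff:
  assumes c: "continuous_on {0..R} x" "continuous_on {0..R} y" "continuous_on {0..R} z"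
      "continuous_on {0..R} x'" "continuous_on {0..R} y'" "continuous_on {0..R} z'"
    and s: "0 \<le> s" "s \<le> R"
  shows "Jint x y z s - Jint x' y' z' s = Jint (\<lambda>r. x r - x' r) (\<lambda>r. y r - y' r) (\<lambda>r. z r - z' r) s"
  unfolding Jint_def integral_diff[OF Gint_integrable[OF c(1-3) s] Gint_integrable[OF c(4-6) s], symmetric]
  by (intro integral_cong) (use Gint_diff[OF c(1,2,4,5)] s in auto)

lemma Gint_cong:
  assumes "\<And>r. 0 \<le> r \<Longrightarrow> r \<le> s \<Longrightarrow> x r = x' r \<and> y r = y' r \<and> z r = z' r" "0 \<le> s"
  shows "Gint x y z s = Gint x' y' z' s"
proof -
  have "Zint x y s = Zint x' y' s"
    unfolding Zint_def by (intro integral_cong) (use assms in \<open>auto simp: src_def\<close>)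
  then show ?thesis using assms by (simp add: Gint_def)
qed

lemma Jint_cong:
  assumes "\<And>r. 0 \<le> r \<Longrightarrow> r \<le> s \<Longrightarrow> x r = x' r \<and> y r = y' r \<and> z r = z' r"
  shows "Jint x y z s = Jint x' y' z' s"
  unfolding Jint_def by (intro integral_cong Gint_cong) (use assms in auto)

text \<open>Cutting off at level \<open>\<delta>\<close> makes the nonlinearities Lipschitz; solutions are unaffected while they
  stay above \<open>\<delta>\<close>.\<close>
definition trunc :: "real \<Rightarrow> real \<Rightarrow> real \<Rightarrow> real" where
  "trunc \<delta> q w = max \<delta> w powr q"

definition xterm :: "real \<Rightarrow> real \<Rightarrow> (real \<Rightarrow> real) \<Rightarrow> real \<Rightarrow> real" where
  "xterm \<delta> e w s = e * (\<alpha> + real N * \<beta>) * trunc \<delta> (1 / m) (w s)"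
definition yterm :: "real \<Rightarrow> (real \<Rightarrow> real) \<Rightarrow> real \<Rightarrow> real" where
  "yterm \<delta> w s = - trunc \<delta> (p / m) (w s)"
definition zterm :: "real \<Rightarrow> real \<Rightarrow> (real \<Rightarrow> real) \<Rightarrow> real \<Rightarrow> real" where
  "zterm \<delta> e w s = - (e * \<beta> * trunc \<delta> (1 / m) (w s))"

definition Gw :: "real \<Rightarrow> real \<Rightarrow> (real \<Rightarrow> real) \<Rightarrow> real \<Rightarrow> real" where
  "Gw \<delta> e w = Gint (xterm \<delta> e w) (yterm \<delta> w) (zterm \<delta> e w)"
definition Jw :: "real \<Rightarrow> real \<Rightarrow> (real \<Rightarrow> real) \<Rightarrow> real \<Rightarrow> real" where
  "Jw \<delta> e w = Jint (xterm \<delta> e w) (yterm \<delta> w) (zterm \<delta> e w)"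

text \<open>An integral equation for \<open>f^m\<close>. It contains both the initial value 1 and
  the vanishing of the flux at 0, without prescribing a derivative at the origin.\<close>

definition trunc_sol :: "real \<Rightarrow> real \<Rightarrow> real \<Rightarrow> (real \<Rightarrow> real) \<Rightarrow> bool" where
  "trunc_sol \<delta> e R w \<longleftrightarrow> continuous_on {0..R} w \<and> (\<forall>\<eta>\<in>{0..R}. w \<eta> = 1 + Jw \<delta> e w \<eta>)"

section \<open>The truncated problem: existence, uniqueness and dependence on
  \<open>e\<close>\<close>

lemma exponents: "0 < 1 / m" "1 / m \<le> 1" "0 < p / m" "p / m \<le> 1"
  using m_gt p_ge p_lt_m by auto

definition lip :: "real \<Rightarrow> real" where
  "lip \<delta> = \<delta> powr (1 / m - 1) + \<delta> powr (p / m - 1)"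

lemma lip_pos: "0 < \<delta> \<Longrightarrow> 0 < lip \<delta>" by (simp add: lip_def add_pos_pos)

lemma trunc_lipschitz:
  assumes "0 < \<delta>"
  shows "\<bar>trunc \<delta> (1 / m) u - trunc \<delta> (1 / m) v\<bar> \<le> lip \<delta> * \<bar>u - v\<bar>"
    "\<bar>trunc \<delta> (p / m) u - trunc \<delta> (p / m) v\<bar> \<le> lip \<delta> * \<bar>u - v\<bar>"
proof -
  have *: "\<bar>trunc \<delta> q u - trunc \<delta> q v\<bar> \<le> \<delta> powr (q - 1) * \<bar>u - v\<bar>" if "0 < q" "q \<le> 1" for q
  proof -
    have "\<bar>trunc \<delta> q u - trunc \<delta> q v\<bar> \<le> \<delta> powr (q - 1) * \<bar>max \<delta> u - max \<delta> v\<bar>"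
      unfolding trunc_def using assms that by (intro powr_lipschitz) auto
    also have "\<dots> \<le> \<delta> powr (q - 1) * \<bar>u - v\<bar>" by (intro mult_left_mono) auto
    finally show ?thesis .
  qed
  have **: "c * \<bar>u - v\<bar> \<le> lip \<delta> * \<bar>u - v\<bar>" if "c \<le> lip \<delta>" for c using that by (intro mult_right_mono) auto
  show "\<bar>trunc \<delta> (1 / m) u - trunc \<delta> (1 / m) v\<bar> \<le> lip \<delta> * \<bar>u - v\<bar>"
    by (rule order_trans[OF *[OF exponents(1,2)] **]) (simp add: lip_def)
  show "\<bar>trunc \<delta> (p / m) u - trunc \<delta> (p / m) v\<bar> \<le> lip \<delta> * \<bar>u - v\<bar>"
    by (rule order_trans[OF *[OF exponents(3,4)] **]) (simp add: lip_def)
qed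

lemma trunc_nonneg: "0 \<le> trunc \<delta> q u" by (simp add: trunc_def)

lemma continuous_on_trunc:
  assumes "0 < \<delta>" "continuous_on A w"
  shows "continuous_on A (\<lambda>s. trunc \<delta> q (w s))"
proof -
  have "max \<delta> (w s) \<noteq> 0" for s using assms(1) by (simp add: max_def)
  then show ?thesis unfolding trunc_def
    by (intro continuous_on_powr continuous_on_max continuous_on_const assms(2)) auto
qed

lemma terms_cont:
  assumes "0 < \<delta>" "continuous_on A w"
  shows "continuous_on A (xterm \<delta> e w)" "continuous_on A (yterm \<delta> w)" "continuous_on A (zterm \<delta> e w)"
  unfolding xterm_def [abs_def] yterm_def [abs_def] zterm_def [abs_def]
  by (intro continuous_intros continuous_on_trunc assms)+

text \<open>Serves the contraction, where \<open>e' = e\<close>, as well as the dependence on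
  \<open>e\<close>. Only the reference function \<open>w'\<close> has to be bounded, by
  \<open>T\<close>; the Lipschitz bound takes care of \<open>w\<close>.\<close>

lemma terms_diff:
  assumes \<delta>: "0 < \<delta>" and e: "0 \<le> e" "e \<le> e1" and T: "trunc \<delta> (1 / m) v \<le> T"
    and K: "K = (e1 * (\<alpha> + real N * \<beta> + \<beta>) + 1) * lip \<delta>" and B: "B = (\<alpha> + real N * \<beta> + \<beta>) * T"
    and uv: "u = w s" "v = w' s"
  shows "\<bar>xterm \<delta> e w s - xterm \<delta> e' w' s\<bar> \<le> K * \<bar>u - v\<bar> + B * \<bar>e - e'\<bar>"
    "\<bar>yterm \<delta> w s - yterm \<delta> w' s\<bar> \<le> K * \<bar>u - v\<bar> + B * \<bar>e - e'\<bar>"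
    "\<bar>zterm \<delta> e w s - zterm \<delta> e' w' s\<bar> \<le> K * \<bar>u - v\<bar> + B * \<bar>e - e'\<bar>"
proof -
  note L = trunc_lipschitz[OF \<delta>, of u v]
  have ab: "0 < \<alpha>" "0 < \<beta>" "0 \<le> real N * \<beta>" using \<alpha>_pos \<beta>_pos by auto
  have T0: "0 \<le> T" using T trunc_nonneg[of \<delta> "1/m" v] by linarith
  have l0: "0 < lip \<delta>" using lip_pos[OF \<delta>] .
  have gen: "\<bar>e * c * trunc \<delta> (1/m) u - e' * c * trunc \<delta> (1/m) v\<bar> \<le> K * \<bar>u - v\<bar> + B * \<bar>e - e'\<bar>"
    if c: "0 \<le> c" "c \<le> \<alpha> + real N * \<beta> + \<beta>" for c
  proof -
    have "e * c * trunc \<delta> (1/m) u - e' * c * trunc \<delta> (1/m) v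
       = e * c * (trunc \<delta> (1/m) u - trunc \<delta> (1/m) v) + (e - e') * (c * trunc \<delta> (1/m) v)"
      by (simp add: algebra_simps)
    then have "\<bar>e * c * trunc \<delta> (1/m) u - e' * c * trunc \<delta> (1/m) v\<bar>
       \<le> e * c * \<bar>trunc \<delta> (1/m) u - trunc \<delta> (1/m) v\<bar> + \<bar>e - e'\<bar> * (c * trunc \<delta> (1/m) v)"
      using e c trunc_nonneg[of \<delta> "1/m" v] by (auto intro!: order_trans[OF abs_triangle_ineq] simp: abs_mult)
    also have "\<dots> \<le> (e1 * (\<alpha> + real N * \<beta> + \<beta>)) * (lip \<delta> * \<bar>u - v\<bar>) + \<bar>e - e'\<bar> * ((\<alpha> + real N * \<beta> + \<beta>) * T)"
      using e c T T0 L(1) ab trunc_nonneg[of \<delta> "1/m" v]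
      by (intro add_mono mult_mono mult_nonneg_nonneg) auto
    also have "\<dots> \<le> K * \<bar>u - v\<bar> + B * \<bar>e - e'\<bar>"
      using l0 by (simp add: K B algebra_simps)
    finally show ?thesis .
  qed
  show "\<bar>xterm \<delta> e w s - xterm \<delta> e' w' s\<bar> \<le> K * \<bar>u - v\<bar> + B * \<bar>e - e'\<bar>"
    using gen[of "\<alpha> + real N * \<beta>"] ab by (simp add: xterm_def uv)
  have "\<bar>yterm \<delta> w s - yterm \<delta> w' s\<bar> \<le> lip \<delta> * \<bar>u - v\<bar>"
    using L(2) by (simp add: yterm_def uv abs_minus_commute)
  also have "\<dots> \<le> K * \<bar>u - v\<bar>"
  proof (rule mult_right_mono)
    have "0 \<le> e1 * (\<alpha> + real N * \<beta> + \<beta>) * lip \<delta>" using e ab l0 by (intro mult_nonneg_nonneg) auto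
    then show "lip \<delta> \<le> K" by (simp add: K algebra_simps)
  qed simp
  also have "\<dots> \<le> K * \<bar>u - v\<bar> + B * \<bar>e - e'\<bar>" using ab T0 by (simp add: B)
  finally show "\<bar>yterm \<delta> w s - yterm \<delta> w' s\<bar> \<le> K * \<bar>u - v\<bar> + B * \<bar>e - e'\<bar>" .
  show "\<bar>zterm \<delta> e w s - zterm \<delta> e' w' s\<bar> \<le> K * \<bar>u - v\<bar> + B * \<bar>e - e'\<bar>"
    using gen[of \<beta>] ab by (simp add: zterm_def uv abs_minus_commute)
qed

text \<open>In the weighted maximum norm the integral equation bounds the distance \<open>M\<close>
  by half of itself plus a multiple of \<open>|e - e'|\<close>, and the half is absorbed on the
  left. Uniqueness is the case of equal parameters.\<close>

lemma trunc_sol_dependence: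
  assumes \<delta>: "0 < \<delta>" and R: "0 \<le> R" and w': "trunc_sol \<delta> e' R w'" and e': "0 \<le> e'" "e' \<le> e1"
  obtains Q where "0 \<le> Q" "\<And>e w \<eta>. 0 \<le> e \<Longrightarrow> e \<le> e1 \<Longrightarrow> trunc_sol \<delta> e R w \<Longrightarrow> 0 \<le> \<eta> \<Longrightarrow> \<eta> \<le> R \<Longrightarrow>
      \<bar>w \<eta> - w' \<eta>\<bar> \<le> Q * \<bar>e - e'\<bar>"
    "\<And>e w \<eta>. 0 \<le> e \<Longrightarrow> e \<le> e1 \<Longrightarrow> trunc_sol \<delta> e R w \<Longrightarrow> 0 < \<eta> \<Longrightarrow> \<eta> \<le> R \<Longrightarrow>
      \<bar>Gw \<delta> e w \<eta> - Gw \<delta> e' w' \<eta>\<bar> \<le> Q * (\<eta> + \<eta> powr (1 + \<sigma>)) * \<bar>e - e'\<bar>"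
proof -
  have c': "continuous_on {0..R} w'" and eq': "\<And>\<eta>. \<eta> \<in> {0..R} \<Longrightarrow> w' \<eta> = 1 + Jw \<delta> e' w' \<eta>"
    using w' by (auto simp: trunc_sol_def)
  obtain T where T: "0 \<le> T" "\<And>s. 0 \<le> s \<Longrightarrow> s \<le> R \<Longrightarrow> \<bar>trunc \<delta> (1/m) (w' s)\<bar> \<le> T"
    using continuous_bound_Icc[OF continuous_on_trunc[OF \<delta> c']] by metis
  define K where "K = (e1 * (\<alpha> + real N * \<beta> + \<beta>) + 1) * lip \<delta>"
  define B where "B = (\<alpha> + real N * \<beta> + \<beta>) * T"
  have ab: "0 < \<alpha>" "0 < \<beta>" "0 \<le> real N * \<beta>" using \<alpha>_pos \<beta>_pos by auto
  have K: "0 < K" unfolding K_def using ab e' lip_pos[OF \<delta>] by (intro mult_pos_pos add_nonneg_pos mult_nonneg_nonneg) auto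
  have B: "0 \<le> B" unfolding B_def using ab T by (intro mult_nonneg_nonneg) auto
  \<comment> \<open>With this \<open>l\<close> the factor \<open>kconst / l\<close> of the integral
    operator, times the Lipschitz constant \<open>K\<close>, is 1/2.\<close>
  define l where "l = 2 * kconst * K"
  have l: "0 < l" using K kconst_pos by (simp add: l_def)
  define Q where "Q = (B / K + 2 * B * kconst) * weight l R"
  have main: "\<bar>w \<eta> - w' \<eta>\<bar> \<le> Q * \<bar>e - e'\<bar> \<and> (0 < \<eta> \<longrightarrow> \<bar>Gw \<delta> e w \<eta> - Gw \<delta> e' w' \<eta>\<bar> \<le> Q * (\<eta> + \<eta> powr (1 + \<sigma>)) * \<bar>e - e'\<bar>)"
    if e: "0 \<le> e" "e \<le> e1" and w: "trunc_sol \<delta> e R w" and \<eta>: "0 \<le> \<eta>" "\<eta> \<le> R" for e w \<eta>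
  proof -
    have c: "continuous_on {0..R} w" and eq: "\<And>\<eta>. \<eta> \<in> {0..R} \<Longrightarrow> w \<eta> = 1 + Jw \<delta> e w \<eta>"
      using w by (auto simp: trunc_sol_def)
    define D where "D s = \<bar>w s - w' s\<bar> / weight l s" for s
    have "continuous_on {0..R} D" unfolding D_def
      by (intro continuous_intros c c' continuous_on_subset[OF continuous_on_weight]) (auto simp: less_imp_neq[OF weight_pos, symmetric])
    then obtain s0 where s0: "s0 \<in> {0..R}" "\<And>s. s \<in> {0..R} \<Longrightarrow> D s \<le> D s0"
      using continuous_attains_sup[of "{0..R}" D] R by auto
    define M where "M = D s0"
    have M0: "0 \<le> M" by (simp add: M_def D_def less_imp_le)
    have M: "\<bar>w s - w' s\<bar> \<le> M * weight l s" if "0 \<le> s" "s \<le> R" for s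
      using s0(2)[of s] that by (simp add: M_def D_def divide_le_eq)
    define d where "d = K * M + B * \<bar>e - e'\<bar>"
    have d0: "0 \<le> d" using K B M0 by (simp add: d_def)
    have b: "\<bar>xterm \<delta> e w s - xterm \<delta> e' w' s\<bar> \<le> d * weight l s \<and> \<bar>yterm \<delta> w s - yterm \<delta> w' s\<bar> \<le> d * weight l s
        \<and> \<bar>zterm \<delta> e w s - zterm \<delta> e' w' s\<bar> \<le> d * weight l s" if s: "0 \<le> s" "s \<le> R" for s
    proof -
      have "K * \<bar>w s - w' s\<bar> + B * \<bar>e - e'\<bar> \<le> K * (M * weight l s) + B * \<bar>e - e'\<bar> * weight l s"
        using K B M[OF s] mult_left_mono[OF weight_ge_1[of l s], of "B * \<bar>e - e'\<bar>"] l s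
        by (intro add_mono mult_left_mono) auto
      then have le: "K * \<bar>w s - w' s\<bar> + B * \<bar>e - e'\<bar> \<le> d * weight l s" by (simp add: d_def algebra_simps)
      have Ts: "trunc \<delta> (1/m) (w' s) \<le> T" using T(2)[OF s] by simp
      note t = terms_diff[OF \<delta> e Ts K_def B_def, of "w s" w s w' e', OF refl refl]
      show ?thesis using t le by linarith
    qed
    note tc = terms_cont[OF \<delta> c] terms_cont[OF \<delta> c']
    have J: "\<bar>Jw \<delta> e w s - Jw \<delta> e' w' s\<bar> \<le> d * kconst / l * weight l s" if s: "0 \<le> s" "s \<le> R" for s
      unfolding Jw_def Jint_diff[OF tc s]
      by (rule Jint_bound[OF _ _ _ l d0 _ s]) (use b tc in \<open>auto intro!: continuous_on_diff\<close>)
    have "\<bar>w s0 - w' s0\<bar> \<le> d * kconst / l * weight l s0"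
      using J[of s0] eq[of s0] eq'[of s0] s0(1) by simp
    then have "M \<le> d * kconst / l" by (simp add: M_def D_def divide_le_eq)
    also have "d * kconst / l = d / (2 * K)" using kconst_pos K by (simp add: l_def)
    finally have "2 * K * M \<le> d" using K by (simp add: field_simps)
    then have KM: "K * M \<le> B * \<bar>e - e'\<bar>" by (simp add: d_def)
    then have M': "M \<le> B / K * \<bar>e - e'\<bar>" using K by (simp add: field_simps)
    have Q1: "B / K * weight l R \<le> Q" "2 * B * kconst * weight l R \<le> Q"
      unfolding Q_def using B K kconst_pos by (intro mult_right_mono; simp add: less_imp_le)+
    have wR: "weight l \<eta> \<le> weight l R" using weight_mono l \<eta> by simp
    have "\<bar>w \<eta> - w' \<eta>\<bar> \<le> M * weight l R" using M[OF \<eta>] mult_left_mono[OF wR M0] by linarith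
    also have "\<dots> \<le> B / K * \<bar>e - e'\<bar> * weight l R" using M' by (intro mult_right_mono) (auto simp: less_imp_le)
    also have "\<dots> = (B / K * weight l R) * \<bar>e - e'\<bar>" by simp
    also have "\<dots> \<le> Q * \<bar>e - e'\<bar>" using Q1 by (intro mult_right_mono) auto
    finally have 1: "\<bar>w \<eta> - w' \<eta>\<bar> \<le> Q * \<bar>e - e'\<bar>" .
    have 2: "\<bar>Gw \<delta> e w \<eta> - Gw \<delta> e' w' \<eta>\<bar> \<le> Q * (\<eta> + \<eta> powr (1 + \<sigma>)) * \<bar>e - e'\<bar>" if "0 < \<eta>"
    proof -
      have P: "0 \<le> \<eta> + \<eta> powr (1 + \<sigma>)" using that by simp
      have "\<bar>Gw \<delta> e w \<eta> - Gw \<delta> e' w' \<eta>\<bar> \<le> d * kconst * (\<eta> + \<eta> powr (1 + \<sigma>)) * weight l \<eta>"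
        unfolding Gw_def Gint_diff[OF tc(1,2,4,5) \<eta>]
        by (rule Gint_bound[OF _ _ less_imp_le[OF l] d0 _ that \<eta>(2)]) (use b tc in \<open>auto intro!: continuous_on_diff\<close>)
      also have "\<dots> \<le> d * kconst * (\<eta> + \<eta> powr (1 + \<sigma>)) * weight l R"
        using wR d0 kconst_pos P by (intro mult_left_mono) auto
      also have "\<dots> \<le> (2 * B * \<bar>e - e'\<bar>) * kconst * (\<eta> + \<eta> powr (1 + \<sigma>)) * weight l R"
        using KM kconst_pos P by (intro mult_right_mono) (auto simp: d_def less_imp_le)
      also have "\<dots> = (2 * B * kconst * weight l R) * ((\<eta> + \<eta> powr (1 + \<sigma>)) * \<bar>e - e'\<bar>)" by (simp add: mult_ac)
      also have "\<dots> \<le> Q * ((\<eta> + \<eta> powr (1 + \<sigma>)) * \<bar>e - e'\<bar>)" using Q1 P by (intro mult_right_mono) auto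
      finally show ?thesis by (simp add: mult_ac)
    qed
    show ?thesis using 1 2 by blast
  qed
  have "0 \<le> Q" using B K kconst_pos by (simp add: Q_def less_imp_le)
  then show ?thesis using main by (intro that[of Q]) auto
qed

lemma trunc_sol_unique:
  assumes "0 < \<delta>" "0 \<le> e" "trunc_sol \<delta> e R w" "trunc_sol \<delta> e R w'"
  shows "\<And>\<eta>. 0 \<le> \<eta> \<Longrightarrow> \<eta> \<le> R \<Longrightarrow> w \<eta> = w' \<eta>" "\<And>\<eta>. 0 < \<eta> \<Longrightarrow> \<eta> \<le> R \<Longrightarrow> Gw \<delta> e w \<eta> = Gw \<delta> e w' \<eta>"
proof -
  have "w \<eta> = w' \<eta> \<and> (0 < \<eta> \<longrightarrow> Gw \<delta> e w \<eta> = Gw \<delta> e w' \<eta>)" if \<eta>: "0 \<le> \<eta>" "\<eta> \<le> R" for \<eta>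
  proof -
    have R: "0 \<le> R" using \<eta> by simp
    from trunc_sol_dependence[OF assms(1) R assms(4,2) order_refl] obtain Q where
      "\<And>u w \<eta>. 0 \<le> u \<Longrightarrow> u \<le> e \<Longrightarrow> trunc_sol \<delta> u R w \<Longrightarrow> 0 \<le> \<eta> \<Longrightarrow> \<eta> \<le> R \<Longrightarrow> \<bar>w \<eta> - w' \<eta>\<bar> \<le> Q * \<bar>u - e\<bar>"
      "\<And>u w \<eta>. 0 \<le> u \<Longrightarrow> u \<le> e \<Longrightarrow> trunc_sol \<delta> u R w \<Longrightarrow> 0 < \<eta> \<Longrightarrow> \<eta> \<le> R \<Longrightarrow>
      \<bar>Gw \<delta> u w \<eta> - Gw \<delta> e w' \<eta>\<bar> \<le> Q * (\<eta> + \<eta> powr (1 + \<sigma>)) * \<bar>u - e\<bar>" by metis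
    from this(1)[OF assms(2) order_refl assms(3) \<eta>] this(2)[OF assms(2) order_refl assms(3) _ \<eta>(2)]
    show ?thesis by simp
  qed
  then show "\<And>\<eta>. 0 \<le> \<eta> \<Longrightarrow> \<eta> \<le> R \<Longrightarrow> w \<eta> = w' \<eta>" "\<And>\<eta>. 0 < \<eta> \<Longrightarrow> \<eta> \<le> R \<Longrightarrow> Gw \<delta> e w \<eta> = Gw \<delta> e w' \<eta>"
    by auto
qed

text \<open>Banach's fixed point theorem is applied to the quotient of \<open>w\<close> by the
  weight, which is bounded even where \<open>w\<close> grows; this gives one solution on the whole
  half line at once.\<close>

lemma trunc_sol_exists:
  assumes \<delta>: "0 < \<delta>" and e: "0 \<le> e"
  obtains w where "\<And>R. 0 < R \<Longrightarrow> trunc_sol \<delta> e R w"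
proof -
  define K where "K = (e * (\<alpha> + real N * \<beta> + \<beta>) + 1) * lip \<delta>"
  have ab: "0 < \<alpha>" "0 < \<beta>" "0 \<le> real N * \<beta>" using \<alpha>_pos \<beta>_pos by auto
  have K: "0 < K" unfolding K_def using ab e lip_pos[OF \<delta>] by (intro mult_pos_pos add_nonneg_pos mult_nonneg_nonneg) auto
  define l where "l = 2 * kconst * K"
  have l: "0 < l" using K kconst_pos by (simp add: l_def)
  define W where "W u s = weight l s * u s" for u :: "real \<Rightarrow> real" and s
  \<comment> \<open>The argument \<open>max 0 s\<close> makes the image constant on the negative
    axis, since the fixed point is sought among bounded continuous functions on the whole
    line.\<close>
  define op where "op u s = (1 + Jw \<delta> e (W u) (max 0 s)) / weight l (max 0 s)" for u s
  have cW: "continuous_on {0..} (W u)" if "continuous_on UNIV u" for u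
    unfolding W_def by (intro continuous_intros continuous_on_subset[OF that]) auto
  have Jdiff: "\<bar>Jw \<delta> e (W u) s - Jw \<delta> e (W v) s\<bar> \<le> D / 2 * weight l s"
    if u: "continuous_on UNIV u" and v: "continuous_on UNIV v" and D: "\<And>s. \<bar>u s - v s\<bar> \<le> D" and s: "0 \<le> s" for u v D s
  proof -
    have D0: "0 \<le> D" using D[of 0] by linarith
    have c: "continuous_on {0..s} (W u)" "continuous_on {0..s} (W v)"
      using cW[OF u] cW[OF v] by (auto intro: continuous_on_subset)
    note tc = terms_cont[OF \<delta> c(1)] terms_cont[OF \<delta> c(2)]
    have b: "\<bar>xterm \<delta> e (W u) r - xterm \<delta> e (W v) r\<bar> \<le> (K * D) * weight l r \<and> \<bar>yterm \<delta> (W u) r - yterm \<delta> (W v) r\<bar> \<le> (K * D) * weight l r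
        \<and> \<bar>zterm \<delta> e (W u) r - zterm \<delta> e (W v) r\<bar> \<le> (K * D) * weight l r" for r
    proof -
      have "\<bar>W u r - W v r\<bar> = weight l r * \<bar>u r - v r\<bar>"
        unfolding W_def by (simp add: abs_mult abs_of_pos flip: right_diff_distrib)
      also have "\<dots> \<le> weight l r * D" using D by (intro mult_left_mono) (auto simp: less_imp_le)
      finally have "K * \<bar>W u r - W v r\<bar> \<le> K * (weight l r * D)" using K by (intro mult_left_mono) auto
      then have "K * \<bar>W u r - W v r\<bar> \<le> (K * D) * weight l r" by (simp add: mult_ac)
      moreover note terms_diff[OF \<delta> e order_refl order_refl K_def refl,
          where v = "W v r" and u = "W u r" and w = "W u" and s = r and w' = "W v" and e' = e, OF refl refl]
      ultimately show ?thesis by simp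
    qed
    have "\<bar>Jw \<delta> e (W u) s - Jw \<delta> e (W v) s\<bar> \<le> (K * D) * kconst / l * weight l s"
      unfolding Jw_def Jint_diff[OF tc s order_refl]
      by (rule Jint_bound[OF _ _ _ l _ _ s order_refl]) (use b tc K D0 in \<open>auto intro!: continuous_on_diff\<close>)
    also have "(K * D) * kconst / l = D / 2" using K kconst_pos by (simp add: l_def)
    finally show ?thesis .
  qed
  have Jcont: "continuous_on {0..} (Jw \<delta> e (W u))" if "continuous_on UNIV u" for u
    unfolding Jw_def
    by (intro continuous_on_Ici Jint_cont terms_cont[OF \<delta>] continuous_on_subset[OF cW[OF that]]) auto
  have opcont: "continuous_on UNIV (op u)" if "continuous_on UNIV u" for u
  proof -
    have "continuous_on {0..} (\<lambda>s. (1 + Jw \<delta> e (W u) s) / weight l s)"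
      by (intro continuous_intros Jcont that) (auto simp: less_imp_neq[OF weight_pos, symmetric])
    then show ?thesis unfolding op_def
      by (rule continuous_on_compose2[where f = "\<lambda>s. max 0 s"]) (auto intro!: continuous_intros)
  qed
  have opdiff: "\<bar>op u s - op v s\<bar> \<le> D / 2"
    if "continuous_on UNIV u" "continuous_on UNIV v" "\<And>s. \<bar>u s - v s\<bar> \<le> D" for u v D s
  proof -
    define t where "t = max 0 s"
    have "op u s - op v s = (Jw \<delta> e (W u) t - Jw \<delta> e (W v) t) / weight l t"
      by (simp add: op_def t_def diff_divide_distrib add_divide_distrib)
    then have "\<bar>op u s - op v s\<bar> = \<bar>Jw \<delta> e (W u) t - Jw \<delta> e (W v) t\<bar> / weight l t"
      by (simp add: less_imp_le)
    also have "\<dots> \<le> (D / 2 * weight l t) / weight l t"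
      using Jdiff[OF that, of t] by (intro divide_right_mono) (auto simp: t_def less_imp_le)
    also have "\<dots> = D / 2" by (simp add: less_imp_neq[OF weight_pos, symmetric])
    finally show ?thesis .
  qed
  \<comment> \<open>Together with the contraction estimate, a bound for the image of the zero
    function shows that bounded functions are mapped to bounded ones.\<close>
  have op0: "\<bar>op (\<lambda>_. 0) s\<bar> \<le> 1 + (K + e * (\<alpha> + real N * \<beta> + \<beta>) * trunc \<delta> (1/m) 0 + trunc \<delta> (p/m) 0) * kconst / l" for s
  proof -
    define t where "t = max 0 s"
    define d where "d = K + e * (\<alpha> + real N * \<beta> + \<beta>) * trunc \<delta> (1/m) 0 + trunc \<delta> (p/m) 0"
    have nn: "0 \<le> e * (\<alpha> + real N * \<beta>) * trunc \<delta> (1/m) 0" "0 \<le> e * \<beta> * trunc \<delta> (1/m) 0" "0 \<le> trunc \<delta> (p/m) 0"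
      using e ab trunc_nonneg by (auto intro!: mult_nonneg_nonneg)
    then have d0: "0 \<le> d" using K by (simp add: d_def algebra_simps)
    have W0: "W (\<lambda>_. 0) = (\<lambda>_. 0)" by (simp add: W_def fun_eq_iff)
    have b: "\<bar>xterm \<delta> e (W (\<lambda>_. 0)) r\<bar> \<le> d * weight l r \<and> \<bar>yterm \<delta> (W (\<lambda>_. 0)) r\<bar> \<le> d * weight l r
        \<and> \<bar>zterm \<delta> e (W (\<lambda>_. 0)) r\<bar> \<le> d * weight l r" if "0 \<le> r" for r
    proof -
      have "d * 1 \<le> d * weight l r" using d0 weight_ge_1[of l r] l that by (intro mult_left_mono) auto
      moreover have "\<bar>xterm \<delta> e (W (\<lambda>_. 0)) r\<bar> \<le> d" "\<bar>yterm \<delta> (W (\<lambda>_. 0)) r\<bar> \<le> d" "\<bar>zterm \<delta> e (W (\<lambda>_. 0)) r\<bar> \<le> d"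
        using nn K unfolding W0 xterm_def yterm_def zterm_def d_def by (simp_all add: algebra_simps)
      ultimately show ?thesis by simp
    qed
    have c: "continuous_on {0..t} (W (\<lambda>_. 0))" unfolding W0 by simp
    have "\<bar>Jw \<delta> e (W (\<lambda>_. 0)) t\<bar> \<le> d * kconst / l * weight l t"
      unfolding Jw_def by (rule Jint_bound[OF terms_cont[OF \<delta> c] l d0 _ _ order_refl]) (use b in \<open>auto simp: t_def\<close>)
    then have "\<bar>1 + Jw \<delta> e (W (\<lambda>_. 0)) t\<bar> \<le> (1 + d * kconst / l) * weight l t"
      using weight_ge_1[of l t] l by (simp add: t_def algebra_simps)
    then have "\<bar>1 + Jw \<delta> e (W (\<lambda>_. 0)) t\<bar> / weight l t \<le> 1 + d * kconst / l"
      by (simp add: divide_le_eq)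
    moreover have "\<bar>op (\<lambda>_. 0) s\<bar> = \<bar>1 + Jw \<delta> e (W (\<lambda>_. 0)) t\<bar> / weight l t"
      unfolding op_def t_def[symmetric] by (simp add: abs_divide abs_of_pos)
    ultimately show ?thesis unfolding d_def by simp
  qed
  have opb: "op (apply_bcontfun u) \<in> bcontfun" for u :: "real \<Rightarrow>\<^sub>C real"
  proof -
    define C where "C = 1 + (K + e * (\<alpha> + real N * \<beta> + \<beta>) * trunc \<delta> (1/m) 0 + trunc \<delta> (p/m) 0) * kconst / l"
    have "\<bar>apply_bcontfun u s - 0\<bar> \<le> norm u" for s using norm_bounded[of u s] by simp
    from opdiff[OF continuous_on_apply_bcontfun continuous_on_const this]
    have "norm (op (apply_bcontfun u) s) \<le> norm u / 2 + C" for s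
      using op0[of s] unfolding C_def[symmetric] by (smt (verit) real_norm_def)
    then show ?thesis by (rule bcontfun_normI[OF opcont[OF continuous_on_apply_bcontfun]])
  qed
  define Op where "Op u = Bcontfun (op (apply_bcontfun u))" for u :: "real \<Rightarrow>\<^sub>C real"
  have Op: "apply_bcontfun (Op u) = op (apply_bcontfun u)" for u
    unfolding Op_def by (rule Bcontfun_inverse[OF opb])
  have "\<exists>!u. Op u = u"
  proof (rule banach_fix_type[of "1/2"])
    show "\<forall>u v. dist (Op u) (Op v) \<le> 1 / 2 * dist u v"
    proof (intro allI dist_bound)
      fix u v :: "real \<Rightarrow>\<^sub>C real" and s
      have "\<bar>apply_bcontfun u s - apply_bcontfun v s\<bar> \<le> dist u v" for s
        using dist_bounded[of u s v] by (simp add: dist_real_def)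
      from opdiff[OF continuous_on_apply_bcontfun continuous_on_apply_bcontfun this]
      show "dist (apply_bcontfun (Op u) s) (apply_bcontfun (Op v) s) \<le> 1 / 2 * dist u v"
        by (simp add: Op dist_real_def)
    qed
  qed auto
  then obtain u where u: "Op u = u" by blast
  define v where "v = apply_bcontfun u"
  have v: "continuous_on UNIV v" "op v = v" using u Op[of u] by (auto simp: v_def)
  have eq: "W v s = 1 + Jw \<delta> e (W v) s" if "0 \<le> s" for s
  proof -
    have "v s = (1 + Jw \<delta> e (W v) s) / weight l s"
      using fun_cong[OF v(2), of s] that by (simp add: op_def)
    then have "weight l s * v s = 1 + Jw \<delta> e (W v) s"
      using less_imp_neq[OF weight_pos[of l s]] by simp
    then show ?thesis by (simp add: W_def)
  qed
  show ?thesis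
  proof (rule that[of "W v"])
    show "trunc_sol \<delta> e R (W v)" if "0 < R" for R
      unfolding trunc_sol_def using eq continuous_on_subset[OF cW[OF v(1)], of "{0..R}"] by auto
  qed
qed

section \<open>Maximal positive solutions\<close>

definition Wt :: "real \<Rightarrow> real \<Rightarrow> real \<Rightarrow> real" where
  "Wt \<delta> e = (SOME w. \<forall>R>0. trunc_sol \<delta> e R w)"

lemma Wt: "0 < \<delta> \<Longrightarrow> 0 \<le> e \<Longrightarrow> 0 < R \<Longrightarrow> trunc_sol \<delta> e R (Wt \<delta> e)"
  unfolding Wt_def using someI_ex[of "\<lambda>w. \<forall>R>0. trunc_sol \<delta> e R w"] trunc_sol_exists[of \<delta> e] by metis

text \<open>A strict bound on a compact interval leaves a margin, hence survives small changes of
  \<open>R\<close> and of \<open>e\<close>; on such an interval the truncation is inactive.\<close>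

definition stays_above :: "real \<Rightarrow> real \<Rightarrow> real \<Rightarrow> bool" where
  "stays_above \<delta> e R \<longleftrightarrow> 0 < \<delta> \<and> (\<forall>s\<in>{0..R}. \<delta> < Wt \<delta> e s)"

text \<open>\<open>pdom e\<close> is the maximal interval of positivity of the solution \<open>wmax e\<close> with
  \<open>(a, b, k) = (e \<alpha>, e \<beta>, 1)\<close> and value 1 at the origin; \<open>gmax e\<close> is its derivative.\<close>
definition pdom :: "real \<Rightarrow> real set" where
  "pdom e = {R. 0 \<le> R \<and> (\<exists>\<delta>. stays_above \<delta> e R)}"

definition wmax :: "real \<Rightarrow> real \<Rightarrow> real" where
  "wmax e s = Wt (SOME \<delta>. stays_above \<delta> e s) e s"

definition gmax :: "real \<Rightarrow> real \<Rightarrow> real" where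
  "gmax e s = Gw (SOME \<delta>. stays_above \<delta> e s) e (Wt (SOME \<delta>. stays_above \<delta> e s) e) s"

definition fmax :: "real \<Rightarrow> real \<Rightarrow> real" where
  "fmax e s = wmax e s powr (1 / m)"

lemma trunc_sol_cong_level:
  assumes "trunc_sol \<delta> e R w" "\<And>s. 0 \<le> s \<Longrightarrow> s \<le> R \<Longrightarrow> \<delta> \<le> w s \<and> \<delta>' \<le> w s"
  shows "trunc_sol \<delta>' e R w" "\<And>s. 0 \<le> s \<Longrightarrow> s \<le> R \<Longrightarrow> Gw \<delta>' e w s = Gw \<delta> e w s"
proof -
  have t: "trunc \<delta> q (w s) = trunc \<delta>' q (w s)" if "0 \<le> s" "s \<le> R" for q s
    using assms(2)[OF that] by (simp add: trunc_def max_absorb2)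
  then have x: "xterm \<delta> e w s = xterm \<delta>' e w s \<and> yterm \<delta> w s = yterm \<delta>' w s \<and> zterm \<delta> e w s = zterm \<delta>' e w s"
    if "0 \<le> s" "s \<le> R" for s using that by (simp add: xterm_def yterm_def zterm_def)
  show "Gw \<delta>' e w s = Gw \<delta> e w s" if "0 \<le> s" "s \<le> R" for s
    unfolding Gw_def by (rule Gint_cong) (use x that in auto)
  have "Jw \<delta>' e w s = Jw \<delta> e w s" if "0 \<le> s" "s \<le> R" for s
    unfolding Jw_def by (rule Jint_cong) (use x that in auto)
  then show "trunc_sol \<delta>' e R w" using assms(1) by (auto simp: trunc_sol_def)
qed

lemma trunc_sol_agree:
  assumes \<delta>: "0 < \<delta>" "0 < \<delta>'" and e: "0 \<le> e" and w: "trunc_sol \<delta> e R w" and R: "0 < R"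
    and b: "\<And>s. 0 \<le> s \<Longrightarrow> s \<le> R \<Longrightarrow> \<delta> \<le> w s \<and> \<delta>' \<le> w s"
  shows "\<And>s. 0 \<le> s \<Longrightarrow> s \<le> R \<Longrightarrow> Wt \<delta>' e s = w s" "\<And>s. 0 < s \<Longrightarrow> s \<le> R \<Longrightarrow> Gw \<delta>' e (Wt \<delta>' e) s = Gw \<delta> e w s"
  using trunc_sol_unique[OF \<delta>(2) e Wt[OF \<delta>(2) e R] trunc_sol_cong_level(1)[OF w b]]
    trunc_sol_cong_level(2)[OF w b] by auto

lemma trunc_sol_0: "trunc_sol \<delta> e R w \<Longrightarrow> 0 \<le> R \<Longrightarrow> w 0 = 1"
  by (auto simp: trunc_sol_def Jw_def Jint_def)

lemma stays_above_mono: "stays_above \<delta> e R \<Longrightarrow> R' \<le> R \<Longrightarrow> stays_above \<delta> e R'"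
  by (auto simp: stays_above_def)

text \<open>The solution for the larger level lies above both levels, so it also solves the problem
  for the smaller one, where uniqueness applies. Hence the level picked in \<open>wmax\<close> and
  \<open>gmax\<close> does not matter.\<close>

lemma stays_above_agree:
  assumes a: "stays_above \<delta> e R" "stays_above \<delta>' e R" and e: "0 \<le> e"
  shows "\<And>s. 0 \<le> s \<Longrightarrow> s \<le> R \<Longrightarrow> Wt \<delta> e s = Wt \<delta>' e s"
    "\<And>s. 0 < s \<Longrightarrow> s \<le> R \<Longrightarrow> Gw \<delta> e (Wt \<delta> e) s = Gw \<delta>' e (Wt \<delta>' e) s"
proof -
  have main: "(\<forall>s\<in>{0..R}. Wt \<delta>' e s = Wt \<delta> e s) \<and> (\<forall>s\<in>{0<..R}. Gw \<delta>' e (Wt \<delta>' e) s = Gw \<delta> e (Wt \<delta> e) s)"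
    if le: "\<delta>' \<le> \<delta>" and R: "0 < R" and a: "stays_above \<delta> e R" "0 < \<delta>'" for \<delta> \<delta>'
  proof -
    have "0 < \<delta>" using a by (simp add: stays_above_def)
    note t = trunc_sol_agree[OF this a(2) e Wt[OF this e R] R]
    have "\<delta> \<le> Wt \<delta> e s \<and> \<delta>' \<le> Wt \<delta> e s" if "0 \<le> s" "s \<le> R" for s
      using a le that by (force simp: stays_above_def)
    then show ?thesis using t by simp
  qed
  have pos: "0 < \<delta>" "0 < \<delta>'" using a by (auto simp: stays_above_def)
  have both: "(\<forall>s\<in>{0..R}. Wt \<delta> e s = Wt \<delta>' e s) \<and> (\<forall>s\<in>{0<..R}. Gw \<delta> e (Wt \<delta> e) s = Gw \<delta>' e (Wt \<delta>' e) s)"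
    if "0 < R"
  proof (cases "\<delta>' \<le> \<delta>")
    case True
    then show ?thesis using main[OF True that a(1) pos(2)] by simp
  next
    case False
    then have "\<delta> \<le> \<delta>'" by simp
    from main[OF this that a(2) pos(1)] show ?thesis by simp
  qed
  show "Wt \<delta> e s = Wt \<delta>' e s" if s: "0 \<le> s" "s \<le> R" for s
  proof (cases "R = 0")
    case True
    then have "s = 0" using s by simp
    then show ?thesis
      using trunc_sol_0[OF Wt[OF pos(1) e zero_less_one]] trunc_sol_0[OF Wt[OF pos(2) e zero_less_one]] by simp
  next
    case False
    then show ?thesis using both s by simp
  qed
  show "Gw \<delta> e (Wt \<delta> e) s = Gw \<delta>' e (Wt \<delta>' e) s" if s: "0 < s" "s \<le> R" for s
    using both s by simp
qed

lemma wmax_eq: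
  assumes a: "stays_above \<delta> e R" and e: "0 \<le> e"
  shows "\<And>s. 0 \<le> s \<Longrightarrow> s \<le> R \<Longrightarrow> wmax e s = Wt \<delta> e s" "\<And>s. 0 < s \<Longrightarrow> s \<le> R \<Longrightarrow> gmax e s = Gw \<delta> e (Wt \<delta> e) s"
proof -
  have sel: "stays_above (SOME \<delta>. stays_above \<delta> e s) e s" if "s \<le> R" for s
    by (rule someI[of _ \<delta>]) (rule stays_above_mono[OF a that])
  show "wmax e s = Wt \<delta> e s" if "0 \<le> s" "s \<le> R" for s
    unfolding wmax_def
    by (rule stays_above_agree(1)[OF sel[OF that(2)] stays_above_mono[OF a that(2)] e that(1) order_refl])
  show "gmax e s = Gw \<delta> e (Wt \<delta> e) s" if "0 < s" "s \<le> R" for s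
    unfolding gmax_def
    by (rule stays_above_agree(2)[OF sel[OF that(2)] stays_above_mono[OF a that(2)] e that(1) order_refl])
qed

lemma pdomD:
  assumes "R \<in> pdom e" "0 \<le> e"
  obtains \<delta> where "0 < \<delta>" "stays_above \<delta> e R" "\<And>s. 0 \<le> s \<Longrightarrow> s \<le> R \<Longrightarrow> wmax e s = Wt \<delta> e s \<and> \<delta> < Wt \<delta> e s"
    "\<And>s. 0 < s \<Longrightarrow> s \<le> R \<Longrightarrow> gmax e s = Gw \<delta> e (Wt \<delta> e) s"
proof -
  obtain \<delta> where a: "stays_above \<delta> e R" using assms by (auto simp: pdom_def)
  show ?thesis
  proof (rule that[OF _ a])
    show "0 < \<delta>" using a by (simp add: stays_above_def)
    show "wmax e s = Wt \<delta> e s \<and> \<delta> < Wt \<delta> e s" if "0 \<le> s" "s \<le> R" for s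
      using wmax_eq(1)[OF a assms(2) that] a that by (simp add: stays_above_def)
    show "gmax e s = Gw \<delta> e (Wt \<delta> e) s" if "0 < s" "s \<le> R" for s
      by (rule wmax_eq(2)[OF a assms(2) that])
  qed
qed

lemma pdom_mono: "R \<in> pdom e \<Longrightarrow> 0 \<le> R' \<Longrightarrow> R' \<le> R \<Longrightarrow> R' \<in> pdom e"
  unfolding pdom_def using stays_above_mono by blast

lemma Wt_cont:
  assumes "0 < \<delta>" "0 \<le> e"
  shows "continuous_on {0..} (Wt \<delta> e)"
  by (rule continuous_on_Ici) (use Wt[OF assms] in \<open>auto simp: trunc_sol_def\<close>)

lemma stays_above_extend:
  assumes a: "stays_above \<delta> e R" and R: "0 \<le> R" and e: "0 \<le> e"
  obtains R' where "R < R'" "stays_above \<delta> e R'"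
proof -
  have \<delta>: "0 < \<delta>" "\<delta> < Wt \<delta> e R" using a R by (auto simp: stays_above_def)
  have "(Wt \<delta> e \<longlongrightarrow> Wt \<delta> e R) (at R within {0..})"
    using Wt_cont[OF \<delta>(1) e] R by (auto simp: continuous_on_def)
  then have "\<forall>\<^sub>F s in at R within {0..}. \<delta> < Wt \<delta> e s" using \<delta>(2) by (rule order_tendstoD)
  then obtain d where d: "0 < d" "\<And>s. 0 \<le> s \<Longrightarrow> s \<noteq> R \<Longrightarrow> \<bar>s - R\<bar> < d \<Longrightarrow> \<delta> < Wt \<delta> e s"
    unfolding eventually_at by (auto simp: dist_real_def)
  show ?thesis
  proof (rule that[of "R + d/2"])
    have "\<delta> < Wt \<delta> e s" if "0 \<le> s" "s \<le> R + d/2" for s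
    proof (cases "s \<le> R")
      case True then show ?thesis using a that by (auto simp: stays_above_def)
    next
      case False then show ?thesis using d(2)[of s] d(1) that by auto
    qed
    then show "stays_above \<delta> e (R + d/2)" using \<delta> by (auto simp: stays_above_def)
  qed (use d in simp)
qed

lemma pdom_open:
  assumes "R \<in> pdom e" "0 \<le> e"
  obtains R' where "R < R'" "R' \<in> pdom e"
proof -
  obtain \<delta> where "stays_above \<delta> e R" "0 \<le> R" using assms by (auto simp: pdom_def)
  from stays_above_extend[OF this assms(2)] obtain R' where "R < R'" "stays_above \<delta> e R'" by metis
  then show ?thesis using that[of R'] \<open>0 \<le> R\<close> by (auto simp: pdom_def)
qed

lemma zero_in_pdom: "0 \<le> e \<Longrightarrow> 0 \<in> pdom e"
proof -
  assume e: "0 \<le> e"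
  have "Wt (1/2) e 0 = 1" using trunc_sol_0[OF Wt[of "1/2" e 1]] e by simp
  then have "stays_above (1/2) e 0" by (simp add: stays_above_def)
  then show ?thesis by (auto simp: pdom_def)
qed

lemma wmax_pos: "s \<in> pdom e \<Longrightarrow> 0 \<le> e \<Longrightarrow> 0 < wmax e s"
proof -
  assume s: "s \<in> pdom e" "0 \<le> e"
  from pdomD[OF s] obtain \<delta> where "0 < \<delta>" "\<And>r. 0 \<le> r \<Longrightarrow> r \<le> s \<Longrightarrow> wmax e r = Wt \<delta> e r \<and> \<delta> < Wt \<delta> e r" by metis
  from this(1) this(2)[of s] show ?thesis using s by (auto simp: pdom_def)
qed

lemma wmax_0: "0 \<le> e \<Longrightarrow> wmax e 0 = 1"
proof -
  assume e: "0 \<le> e"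
  from pdomD[OF zero_in_pdom[OF e] e] obtain \<delta> where "0 < \<delta>" "wmax e 0 = Wt \<delta> e 0" by (metis order_refl)
  then show ?thesis using trunc_sol_0[OF Wt[of \<delta> e 1]] e by simp
qed

lemma wmax_cont:
  assumes "R \<in> pdom e" "0 \<le> e"
  shows "continuous_on {0..R} (wmax e)"
proof -
  from pdomD[OF assms] obtain \<delta> where \<delta>: "0 < \<delta>" "\<And>s. 0 \<le> s \<Longrightarrow> s \<le> R \<Longrightarrow> wmax e s = Wt \<delta> e s" by metis
  have "continuous_on {0..R} (Wt \<delta> e)" using Wt_cont[OF \<delta>(1) assms(2)] continuous_on_subset by fastforce
  then show ?thesis by (rule continuous_on_eq) (use \<delta>(2) in simp)
qed

text \<open>If \<open>wmax e\<close> were at least \<open>c\<close> throughout, it would agree with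
  the solution truncated at \<open>c / 2\<close>, which continues past
  \<open>X = Sup (pdom e)\<close> and is still at least \<open>c\<close> at \<open>X\<close>. Then
  \<open>X\<close> would belong to \<open>pdom e\<close>, which has no greatest element.\<close>

lemma pdom_bounded_imp_inf_0:
  assumes e: "0 \<le> e" and bdd: "bdd_above (pdom e)" and c: "0 < c"
  obtains s where "s \<in> pdom e" "wmax e s < c"
proof (rule ccontr)
  note witness = that
  assume n: "\<not> thesis"
  have ge: "c \<le> wmax e s" if "s \<in> pdom e" for s using witness[OF that] n by (meson not_le)
  define X where "X = Sup (pdom e)"
  have ne: "pdom e \<noteq> {}" using zero_in_pdom[OF e] by auto
  have X0: "0 \<le> X" unfolding X_def using zero_in_pdom[OF e] bdd by (rule cSup_upper)
  have in_dom: "s \<in> pdom e" if s: "0 \<le> s" "s < X" for s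
  proof -
    obtain t where "t \<in> pdom e" "s < t" using s(2) less_cSup_iff[OF ne bdd] by (auto simp: X_def)
    then show ?thesis using pdom_mono s by auto
  qed
  have Wc: "c \<le> Wt (c/2) e s" if s: "0 \<le> s" "s < X" for s
  proof (cases "s = 0")
    case True
    then show ?thesis
      using ge[OF zero_in_pdom[OF e]] wmax_0[OF e] trunc_sol_0[OF Wt[of "c/2" e 1]] c e by simp
  next
    case False
    from pdomD[OF in_dom[OF s] e] obtain \<delta> where d: "0 < \<delta>"
      "\<And>r. 0 \<le> r \<Longrightarrow> r \<le> s \<Longrightarrow> wmax e r = Wt \<delta> e r \<and> \<delta> < Wt \<delta> e r" by metis
    have ge': "c \<le> Wt \<delta> e r" if "0 \<le> r" "r \<le> s" for r
      using ge[OF in_dom[of r]] d(2)[OF that] that s by auto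
    have "Wt (c/2) e s = Wt \<delta> e s"
    proof (rule trunc_sol_agree(1)[OF d(1) _ e Wt[OF d(1) e]])
      show "\<delta> \<le> Wt \<delta> e r \<and> c / 2 \<le> Wt \<delta> e r" if "0 \<le> r" "r \<le> s" for r
        using d(2)[OF that] ge'[OF that] c by auto
    qed (use False s c in auto)
    then show ?thesis using ge'[of s] s by simp
  qed
  have "c \<le> Wt (c/2) e X"
  proof (cases "X = 0")
    case True
    then show ?thesis
      using ge[OF zero_in_pdom[OF e]] wmax_0[OF e] trunc_sol_0[OF Wt[of "c/2" e 1]] c e by simp
  next
    case False
    then have X: "0 < X" using X0 by simp
    have "(Wt (c/2) e \<longlongrightarrow> Wt (c/2) e X) (at X within {0..})"
      using Wt_cont[of "c/2" e] c e X by (auto simp: continuous_on_def)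
    moreover have "at X within {0..} = at X" by (rule at_within_interior) (use X in simp)
    ultimately have "(Wt (c/2) e \<longlongrightarrow> Wt (c/2) e X) (at_left X)"
      by (simp add: filterlim_at_split)
    moreover have "\<forall>\<^sub>F s in at_left X. c \<le> Wt (c/2) e s"
      using eventually_at_left_real[OF X] by (rule eventually_mono) (use Wc in auto)
    ultimately show ?thesis by (intro tendsto_lowerbound) auto
  qed
  then have "c / 2 < Wt (c/2) e s" if "0 \<le> s" "s \<le> X" for s
    using Wc[of s] that c by (cases "s = X") auto
  then have "stays_above (c/2) e X" using c by (auto simp: stays_above_def)
  then have "X \<in> pdom e" using X0 by (auto simp: pdom_def)
  from pdom_open[OF this e] obtain R' where "X < R'" "R' \<in> pdom e" .
  then show False using cSup_upper[OF _ bdd] by (force simp: X_def)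
qed

text \<open>The reference solution exceeds its level on \<open>[0, R]\<close> by a margin, so
  solutions of the same truncated problem for nearby \<open>e\<close> also remain above that level,
  and truncation does not affect them either.\<close>

lemma pdom_depend:
  assumes R: "R \<in> pdom e0" "0 < R" and e0: "0 \<le> e0" and \<kappa>: "0 < \<kappa>"
  obtains r where "0 < r" "\<And>e. 0 \<le> e \<Longrightarrow> \<bar>e - e0\<bar> < r \<Longrightarrow>
     R \<in> pdom e \<and> \<bar>wmax e R - wmax e0 R\<bar> < \<kappa> \<and> \<bar>gmax e R - gmax e0 R\<bar> < \<kappa>"
proof -
  from R(1) obtain \<delta> where a: "stays_above \<delta> e0 R" by (auto simp: pdom_def)
  have \<delta>: "0 < \<delta>" using a by (simp add: stays_above_def)
  have "continuous_on {0..R} (Wt \<delta> e0)" using Wt_cont[OF \<delta> e0] continuous_on_subset by fastforce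
  then obtain s0 where s0: "s0 \<in> {0..R}" "\<And>s. s \<in> {0..R} \<Longrightarrow> Wt \<delta> e0 s0 \<le> Wt \<delta> e0 s"
    using continuous_attains_inf[of "{0..R}" "Wt \<delta> e0"] R by auto
  define \<theta> where "\<theta> = Wt \<delta> e0 s0 - \<delta>"
  have \<theta>: "0 < \<theta>" using a s0 by (simp add: \<theta>_def stays_above_def)
  from trunc_sol_dependence[OF \<delta> less_imp_le[OF R(2)] Wt[OF \<delta> e0 R(2)] e0, of "e0 + 1"] obtain Q where Q: "0 \<le> Q"
    "\<And>e w \<eta>. 0 \<le> e \<Longrightarrow> e \<le> e0 + 1 \<Longrightarrow> trunc_sol \<delta> e R w \<Longrightarrow> 0 \<le> \<eta> \<Longrightarrow> \<eta> \<le> R \<Longrightarrow>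
      \<bar>w \<eta> - Wt \<delta> e0 \<eta>\<bar> \<le> Q * \<bar>e - e0\<bar>"
    "\<And>e w \<eta>. 0 \<le> e \<Longrightarrow> e \<le> e0 + 1 \<Longrightarrow> trunc_sol \<delta> e R w \<Longrightarrow> 0 < \<eta> \<Longrightarrow> \<eta> \<le> R \<Longrightarrow>
      \<bar>Gw \<delta> e w \<eta> - Gw \<delta> e0 (Wt \<delta> e0) \<eta>\<bar> \<le> Q * (\<eta> + \<eta> powr (1 + \<sigma>)) * \<bar>e - e0\<bar>" by (metis less_add_one less_imp_le)
  define P where "P = Q * (1 + R + R powr (1 + \<sigma>)) + 1"
  have P: "0 < P" using Q R by (auto simp: P_def intro!: add_nonneg_pos mult_nonneg_nonneg)
  define r where "r = min 1 (min (\<theta> / P) (\<kappa> / P))"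
  have r: "0 < r" using \<theta> \<kappa> P by (simp add: r_def)
  show ?thesis
  proof (rule that[OF r])
    fix e assume e: "0 \<le> e" "\<bar>e - e0\<bar> < r"
    then have e1: "e \<le> e0 + 1" by (auto simp: r_def)
    have Pr: "P * \<bar>e - e0\<bar> < \<theta>" "P * \<bar>e - e0\<bar> < \<kappa>"
      using e(2) P by (auto simp: r_def pos_less_divide_eq mult.commute)
    have QP: "Q \<le> P" "Q * (R + R powr (1 + \<sigma>)) \<le> P"
      using Q(1) R by (auto simp: P_def algebra_simps)
    have 1: "\<bar>Wt \<delta> e s - Wt \<delta> e0 s\<bar> \<le> P * \<bar>e - e0\<bar>" if "0 \<le> s" "s \<le> R" for s
      using Q(2)[OF e(1) e1 Wt[OF \<delta> e(1) R(2)] that] mult_right_mono[OF QP(1), of "\<bar>e - e0\<bar>"] by simp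
    have 2: "\<bar>Gw \<delta> e (Wt \<delta> e) R - Gw \<delta> e0 (Wt \<delta> e0) R\<bar> \<le> P * \<bar>e - e0\<bar>"
      using Q(3)[OF e(1) e1 Wt[OF \<delta> e(1) R(2)] R(2) order_refl] mult_right_mono[OF QP(2), of "\<bar>e - e0\<bar>"] by simp
    have "\<delta> < Wt \<delta> e s" if "s \<in> {0..R}" for s
      using 1[of s] s0(2)[OF that] that Pr by (auto simp: \<theta>_def abs_le_iff)
    then have ae: "stays_above \<delta> e R" using \<delta> by (auto simp: stays_above_def)
    then have "R \<in> pdom e" using R by (auto simp: pdom_def)
    moreover have "wmax e R = Wt \<delta> e R" "gmax e R = Gw \<delta> e (Wt \<delta> e) R"
      using wmax_eq[OF ae e(1), of R] R by auto
    moreover have "wmax e0 R = Wt \<delta> e0 R" "gmax e0 R = Gw \<delta> e0 (Wt \<delta> e0) R"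
      using wmax_eq[OF a e0, of R] R by auto
    ultimately show "R \<in> pdom e \<and> \<bar>wmax e R - wmax e0 R\<bar> < \<kappa> \<and> \<bar>gmax e R - gmax e0 R\<bar> < \<kappa>"
      using 1[of R] 2 Pr R by auto
  qed
qed

text \<open>Undoes the integral formulation: the identity
  \<open>g = s^(1-N) Z - e \<beta> s f\<close> is differentiated, with \<open>src\<close> as the
  derivative of \<open>Z\<close>.\<close>

lemma fmax_sol:
  assumes R: "R \<in> pdom e" and e: "0 \<le> e"
  shows "sol (e * \<alpha>) (e * \<beta>) 1 R (fmax e) (gmax e)"
  unfolding sol_def
proof (intro ballI conjI)
  fix s assume "s \<in> {0<..<R}"
  then have s: "0 < s" "s < R" by auto
  from pdomD[OF R e] obtain \<delta> where \<delta>: "0 < \<delta>" "\<And>s. 0 \<le> s \<Longrightarrow> s \<le> R \<Longrightarrow> wmax e s = Wt \<delta> e s \<and> \<delta> < Wt \<delta> e s"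
    "\<And>s. 0 < s \<Longrightarrow> s \<le> R \<Longrightarrow> gmax e s = Gw \<delta> e (Wt \<delta> e) s" by metis
  let ?w = "Wt \<delta> e"
  have R0: "0 < R" using s by simp
  have ts: "trunc_sol \<delta> e R ?w" by (rule Wt[OF \<delta>(1) e R0])
  have cw: "continuous_on {0..R} ?w" using ts by (simp add: trunc_sol_def)
  note tc = terms_cont[OF \<delta>(1) cw]
  have in_dom: "s \<in> pdom e" using pdom_mono[OF R] s by simp
  have w0: "0 < wmax e s" using wmax_pos[OF in_dom e] .
  then show f0: "0 < fmax e s" by (simp add: fmax_def)
  have evs: "\<forall>\<^sub>F r in nhds s. r \<in> {0<..<R}"
    using eventually_nhds_in_open[of "{0<..<R}" s] s by simp
  have tr: "trunc \<delta> (1/m) (?w r) = fmax e r" "trunc \<delta> (p/m) (?w r) = fmax e r powr p"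
    if "0 < r" "r < R" for r
    using \<delta>(2)[of r] that \<delta>(1) by (auto simp: trunc_def fmax_def powr_powr max_def)
  have dw: "(wmax e has_real_derivative gmax e s) (at s)"
  proof -
    have ev: "\<forall>\<^sub>F r in nhds s. wmax e r = 1 + Jw \<delta> e ?w r"
      using evs by (rule eventually_mono) (use \<delta>(2) ts in \<open>auto simp: trunc_sol_def\<close>)
    have "((\<lambda>r. 1 + Jw \<delta> e ?w r) has_real_derivative 0 + Gw \<delta> e ?w s) (at s)"
      unfolding Jw_def Gw_def by (intro DERIV_add DERIV_const Jint_deriv[OF tc s])
    then show ?thesis using DERIV_cong_ev[OF refl ev refl] \<delta>(3)[of s] s by auto
  qed
  have df: "(fmax e has_real_derivative gmax e s * fmax e s powr (1 - m) / m) (at s)"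
  proof -
    have "((\<lambda>r. wmax e r powr (1/m)) has_real_derivative (1/m) * wmax e s powr (1/m - 1) * gmax e s) (at s)"
      by (rule DERIV_cong[OF DERIV_fun_powr[OF dw w0]]) simp
    moreover have "wmax e s powr (1/m - 1) = fmax e s powr (1 - m)"
      using m_gt by (simp add: fmax_def powr_powr diff_divide_distrib)
    ultimately show ?thesis unfolding fmax_def [abs_def] by (simp add: mult_ac)
  qed
  then show "(fmax e has_real_derivative gmax e s * fmax e s powr (1 - m) / m) (at s)" .
  define Z where "Z = Zint (xterm \<delta> e ?w) (yterm \<delta> ?w)"
  have g_eq: "gmax e r = r powr (1 - real N) * Z r - e * \<beta> * r * fmax e r" if "0 < r" "r < R" for r
    using \<delta>(3)[of r] that tr(1)[OF that] by (simp add: Gw_def Gint_def zterm_def Z_def)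
  have dZ: "(Z has_real_derivative src (xterm \<delta> e ?w) (yterm \<delta> ?w) s) (at s)"
    unfolding Z_def by (rule Zint_deriv[OF tc(1,2) s])
  have srcs: "src (xterm \<delta> e ?w) (yterm \<delta> ?w) s
      = s powr (real N - 1) * (e * (\<alpha> + real N * \<beta>) * fmax e s - s powr \<sigma> * fmax e s powr p)"
    unfolding src_def xterm_def yterm_def tr[OF s] powr_add[of s "real N - 1" \<sigma>]
    by (simp add: algebra_simps)
  have ev: "\<forall>\<^sub>F r in nhds s. gmax e r = r powr (1 - real N) * Z r - e * \<beta> * r * fmax e r"
    using evs by (rule eventually_mono) (use g_eq in auto)
  have dp: "((\<lambda>r. r powr (1 - real N)) has_real_derivative (1 - real N) * s powr (1 - real N - 1)) (at s)"
    using s by (auto intro!: derivative_eq_intros)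
  have D: "((\<lambda>r. r powr (1 - real N) * Z r - e * \<beta> * r * fmax e r) has_real_derivative
      ((1 - real N) * s powr (1 - real N - 1) * Z s + src (xterm \<delta> e ?w) (yterm \<delta> ?w) s * s powr (1 - real N))
      - ((e * \<beta> * 1) * fmax e s + (gmax e s * fmax e s powr (1 - m) / m) * (e * \<beta> * s))) (at s)"
    by (intro DERIV_diff DERIV_mult dp dZ df DERIV_cmult DERIV_ident)
  have Zs: "s powr (1 - real N) * Z s = gmax e s + e * \<beta> * s * fmax e s" using g_eq[OF s] by simp
  have pw: "s powr (1 - real N - 1) = s powr (1 - real N) / s" "s powr (real N - 1) * s powr (1 - real N) = 1"
    using s powr_diff[of s "1 - real N" 1] by (simp_all flip: powr_add)
  have t1: "(1 - real N) * s powr (1 - real N - 1) * Z s = - ((real N - 1) / s * gmax e s) - (real N - 1) * (e * \<beta> * fmax e s)"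
  proof -
    have "(1 - real N) * s powr (1 - real N - 1) * Z s = (1 - real N) / s * (s powr (1 - real N) * Z s)"
      unfolding pw(1) by simp
    also have "\<dots> = (1 - real N) / s * (gmax e s + e * \<beta> * s * fmax e s)" unfolding Zs ..
    also have "\<dots> = (1 - real N) / s * gmax e s + (1 - real N) * (e * \<beta> * fmax e s)"
      using s by (simp add: distrib_left)
    finally show ?thesis by (simp add: algebra_simps diff_divide_distrib)
  qed
  have t2: "src (xterm \<delta> e ?w) (yterm \<delta> ?w) s * s powr (1 - real N) = e * (\<alpha> + real N * \<beta>) * fmax e s - s powr \<sigma> * fmax e s powr p"
  proof -
    have "x * y * z = (x * z) * y" for x y z :: real by simp
    from this[of "s powr (real N - 1)" _ "s powr (1 - real N)"]
    show ?thesis unfolding srcs pw(2) by (simp only: mult_1)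
  qed
  have "((1 - real N) * s powr (1 - real N - 1) * Z s + src (xterm \<delta> e ?w) (yterm \<delta> ?w) s * s powr (1 - real N))
      - ((e * \<beta> * 1) * fmax e s + (gmax e s * fmax e s powr (1 - m) / m) * (e * \<beta> * s))
     = - ((real N - 1) / s * gmax e s) + e * \<alpha> * fmax e s
        - e * \<beta> * s * (gmax e s * fmax e s powr (1 - m) / m) - 1 * s powr \<sigma> * fmax e s powr p"
    unfolding t1 t2 by (simp add: algebra_simps)
  then show "(gmax e has_real_derivative - ((real N - 1) / s * gmax e s) + e * \<alpha> * fmax e s
        - e * \<beta> * s * (gmax e s * fmax e s powr (1 - m) / m) - 1 * s powr \<sigma> * fmax e s powr p) (at s)"
    using D unfolding DERIV_cong_ev[OF refl ev refl] by simp
qed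

text \<open>The flux replaces the derivative as initial datum: it tends to 0 although
  \<open>gmax e\<close> behaves like \<open>- s^(1+\<sigma>) / (N + \<sigma>)\<close> and is
  unbounded when \<open>\<sigma> < -1\<close>.\<close>

lemma fmax_origin:
  assumes e: "0 \<le> e"
  shows "(fmax e \<longlongrightarrow> 1) (at_right 0)" "(flux (e * \<beta>) (fmax e) (gmax e) \<longlongrightarrow> 0) (at_right 0)"
proof -
  obtain R where R: "0 < R" "R \<in> pdom e" using pdom_open[OF zero_in_pdom[OF e] e] by metis
  from pdomD[OF R(2) e] obtain \<delta> where \<delta>: "0 < \<delta>" "\<And>s. 0 \<le> s \<Longrightarrow> s \<le> R \<Longrightarrow> wmax e s = Wt \<delta> e s \<and> \<delta> < Wt \<delta> e s"
    "\<And>s. 0 < s \<Longrightarrow> s \<le> R \<Longrightarrow> gmax e s = Gw \<delta> e (Wt \<delta> e) s" by metis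
  have "(wmax e \<longlongrightarrow> wmax e 0) (at 0 within {0..R})"
    using wmax_cont[OF R(2) e] R by (auto simp: continuous_on_def)
  moreover have "at 0 within {0..R} = at_right 0" using at_within_Icc_at_right[OF R(1)] .
  ultimately have "(wmax e \<longlongrightarrow> 1) (at_right 0)" using wmax_0[OF e] by simp
  then have "((\<lambda>s. wmax e s powr (1/m)) \<longlongrightarrow> 1 powr (1/m)) (at_right 0)" by (intro tendsto_intros) auto
  then show f: "(fmax e \<longlongrightarrow> 1) (at_right 0)" unfolding fmax_def [abs_def] by simp
  let ?w = "Wt \<delta> e"
  have ts: "trunc_sol \<delta> e R ?w" by (rule Wt[OF \<delta>(1) e R(1)])
  have cw: "continuous_on {0..R} ?w" using ts by (simp add: trunc_sol_def)
  note tc = terms_cont[OF \<delta>(1) cw]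
  define Z where "Z = Zint (xterm \<delta> e ?w) (yterm \<delta> ?w)"
  have "continuous_on {0..R} Z" unfolding Z_def by (rule Zint_cont[OF tc(1,2)]) (use R in simp)
  then have "(Z \<longlongrightarrow> Z 0) (at 0 within {0..R})" using R by (auto simp: continuous_on_def)
  then have "(Z \<longlongrightarrow> 0) (at_right 0)"
    using at_within_Icc_at_right[OF R(1)] by (simp add: Z_def Zint_def)
  moreover have "\<forall>\<^sub>F s in at_right 0. Z s = flux (e * \<beta>) (fmax e) (gmax e) s"
    using eventually_at_right_real[OF R(1)]
  proof (rule eventually_mono)
    fix s assume "s \<in> {0<..<R}"
    then have s: "0 < s" "s \<le> R" by auto
    have "fmax e s = trunc \<delta> (1/m) (?w s)" using \<delta>(2)[of s] s by (simp add: fmax_def trunc_def max_def)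
    then have g: "gmax e s = s powr (1 - real N) * Z s - e * \<beta> * s * fmax e s"
      using \<delta>(3)[OF s] by (simp add: Gw_def Gint_def zterm_def Z_def)
    have p1: "s powr (real N - 1) * s powr (1 - real N) = 1"
      using s by (simp flip: powr_add)
    have p2: "s powr real N = s powr (real N - 1) * s"
      using s powr_add[of s "real N - 1" 1] by simp
    have "flux (e * \<beta>) (fmax e) (gmax e) s = (s powr (real N - 1) * s powr (1 - real N)) * Z s
        + e * \<beta> * fmax e s * (s powr real N - s powr (real N - 1) * s)"
      unfolding flux_def g by (simp add: right_diff_distrib mult_ac)
    then show "Z s = flux (e * \<beta>) (fmax e) (gmax e) s" unfolding p1 p2 by simp
  qed
  ultimately show "(flux (e * \<beta>) (fmax e) (gmax e) \<longlongrightarrow> 0) (at_right 0)"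
    by (rule Lim_transform_eventually)
qed

end

section \<open>Shooting\<close>

lemma right_limit_bound:
  fixes u u' :: "real \<Rightarrow> real"
  assumes "0 < s" and d: "\<And>r. 0 < r \<Longrightarrow> r \<le> s \<Longrightarrow> (u has_real_derivative u' r) (at r)"
    and b: "\<And>r. 0 < r \<Longrightarrow> r \<le> s \<Longrightarrow> u' r \<le> 0" and l: "(u \<longlongrightarrow> c) (at_right 0)"
  shows "u s \<le> c"
proof -
  have "\<forall>\<^sub>F r in at_right 0. u s \<le> u r"
    using eventually_at_right_real[OF assms(1)]
  proof (rule eventually_mono)
    fix r assume r: "r \<in> {0<..<s}"
    show "u s \<le> u r"
    proof (rule DERIV_nonpos_imp_nonincreasing[of r s u])
      fix z assume "r \<le> z" "z \<le> s"
      then have "0 < z" "z \<le> s" using r by auto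
      then show "\<exists>y. DERIV u z :> y \<and> y \<le> 0" using d b by blast
    qed (use r in simp)
  qed
  then show ?thesis by (intro tendsto_lowerbound[OF l]) auto
qed

lemma tendsto_at_left_decreasing:
  fixes u :: "real \<Rightarrow> real"
  assumes "a < b" and dec: "\<And>x y. a < x \<Longrightarrow> x < y \<Longrightarrow> y < b \<Longrightarrow> u y \<le> u x" and low: "\<And>x. a < x \<Longrightarrow> x < b \<Longrightarrow> c \<le> u x"
  obtains l where "c \<le> l" "(u \<longlongrightarrow> l) (at_left b)" "\<And>x. a < x \<Longrightarrow> x < b \<Longrightarrow> l \<le> u x"
proof -
  define l where "l = Inf (u ` {a<..<b})"
  have ne: "u ` {a<..<b} \<noteq> {}" using assms(1) by simp
  have bdd: "bdd_below (u ` {a<..<b})" by (rule bdd_belowI[of _ c]) (use low in auto)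
  have lx: "l \<le> u x" if "a < x" "x < b" for x
    unfolding l_def using bdd that by (intro cInf_lower) auto
  have cl: "c \<le> l" unfolding l_def using ne low by (intro cInf_greatest) auto
  have "(u \<longlongrightarrow> l) (at_left b)"
  proof (rule order_tendstoI)
    fix y assume "y < l"
    then show "\<forall>\<^sub>F x in at_left b. y < u x"
      using eventually_at_left_real[OF assms(1)] by (auto elim!: eventually_mono dest!: lx)
  next
    fix y assume "l < y"
    then obtain x where x: "a < x" "x < b" "u x < y"
      using cInf_less_iff[OF ne bdd, of y] by (auto simp: l_def)
    show "\<forall>\<^sub>F x in at_left b. u x < y"
      using eventually_at_left_real[OF x(2)]
    proof (rule eventually_mono)
      fix z assume "z \<in> {x<..<b}"
      then show "u z < y" using dec[of x z] x by auto
    qed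
  qed
  then show ?thesis using that cl lx by blast
qed

context profile_equation
begin

abbreviation EN :: "real \<Rightarrow> real \<Rightarrow> real" where
  "EN e \<equiv> en (e * \<alpha>) 1 (fmax e) (gmax e)"

lemma pdom_sol:
  assumes "s \<in> pdom e" "0 \<le> e"
  obtains R where "s < R" "R \<in> pdom e" "sol (e * \<alpha>) (e * \<beta>) 1 R (fmax e) (gmax e)"
  using pdom_open[OF assms] fmax_sol assms(2) by metis

lemma fmax_pos: "s \<in> pdom e \<Longrightarrow> 0 \<le> e \<Longrightarrow> 0 < fmax e s"
  using wmax_pos[of s e] by (simp add: fmax_def)

lemma fmax_pow_m: "s \<in> pdom e \<Longrightarrow> 0 \<le> e \<Longrightarrow> fmax e s powr m = wmax e s"
  using wmax_pos[of s e] m_gt by (simp add: fmax_def powr_powr)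

lemma sol_near_origin:
  assumes "0 \<le> e"
  obtains R where "0 < R" "R \<in> pdom e" "sol (e * \<alpha>) (e * \<beta>) 1 R (fmax e) (gmax e)"
  using pdom_sol[OF zero_in_pdom[OF assms] assms] by metis

section \<open>Expansion at the origin\<close>

lemma tendsto_powr_at_right_0: "0 < q \<Longrightarrow> ((\<lambda>x::real. x powr q) \<longlongrightarrow> 0) (at_right 0)"
  using tendsto_powr2[OF tendsto_ident_at tendsto_const, of 0 "{0<..}" q]
    eventually_at_right_less[of "0::real", THEN eventually_mono, of "\<lambda>x. 0 \<le> x"] by simp

text \<open>L'Hopital's rule for the flux over \<open>s^(N+\<sigma>)\<close>: as
  \<open>\<sigma> < 0\<close>, the reaction dominates the linear source, and the drift part of the
  flux is smaller by the factor \<open>s^(-\<sigma>)\<close>. Therefore the limit is the same for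
  every \<open>e\<close>.\<close>

lemma gmax_origin:
  assumes e: "0 \<le> e"
  shows "((\<lambda>s. gmax e s / s powr (1 + \<sigma>)) \<longlongrightarrow> - 1 / (real N + \<sigma>)) (at_right 0)"
proof -
  obtain R where R: "0 < R" "sol (e * \<alpha>) (e * \<beta>) 1 R (fmax e) (gmax e)"
    using sol_near_origin[OF e] by metis
  note ev = eventually_at_right_real[OF R(1)]
  let ?c = "e * \<alpha> + real N * (e * \<beta>)"
  define F' where "F' s = ?c * (s powr (real N - 1) * fmax e s) - 1 * (s powr (real N - 1 + \<sigma>) * fmax e s powr p)" for s
  define G' where "G' s = (real N + \<sigma>) * s powr (real N + \<sigma> - 1)" for s
  have nz: "\<forall>\<^sub>F x in at_right 0. x powr (real N + \<sigma>) \<noteq> 0" "\<forall>\<^sub>F x in at_right 0. G' x \<noteq> 0"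
    using ev N\<sigma>_pos by (auto elim!: eventually_mono simp: G'_def)
  have dF: "\<forall>\<^sub>F x in at_right 0. (flux (e * \<beta>) (fmax e) (gmax e) has_real_derivative F' x) (at x)"
    using ev unfolding F'_def by (rule eventually_mono) (use flux_deriv[OF R(2)] in auto)
  have dG: "\<forall>\<^sub>F x in at_right 0. ((\<lambda>x. x powr (real N + \<sigma>)) has_real_derivative G' x) (at x)"
    using ev unfolding G'_def by (rule eventually_mono) (auto intro!: derivative_eq_intros)
  have "((\<lambda>s. (?c * s powr (- \<sigma>) * fmax e s - fmax e s powr p) / (real N + \<sigma>)) \<longlongrightarrow> (?c * 0 * 1 - 1 powr p) / (real N + \<sigma>)) (at_right 0)"
    using \<sigma>_neg N\<sigma>_pos by (intro tendsto_intros fmax_origin(1)[OF e] tendsto_powr_at_right_0) auto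
  moreover have "\<forall>\<^sub>F s in at_right 0. (?c * s powr (- \<sigma>) * fmax e s - fmax e s powr p) / (real N + \<sigma>) = F' s / G' s"
    using ev
  proof (rule eventually_mono)
    fix s assume "s \<in> {0<..<R}"
    then have s: "0 < s" by simp
    define P where "P = s powr (real N + \<sigma> - 1)"
    have P: "0 < P" using s by (simp add: P_def)
    have "s powr (real N - 1) = P * s powr (- \<sigma>)" "s powr (real N - 1 + \<sigma>) = P"
      by (simp_all add: P_def algebra_simps flip: powr_add)
    then have "F' s = P * (?c * s powr (- \<sigma>) * fmax e s - fmax e s powr p)"
      by (simp add: F'_def algebra_simps)
    moreover have "G' s = P * (real N + \<sigma>)" by (simp add: G'_def P_def)
    ultimately show "(?c * s powr (- \<sigma>) * fmax e s - fmax e s powr p) / (real N + \<sigma>) = F' s / G' s"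
      using P by simp
  qed
  ultimately have "((\<lambda>s. F' s / G' s) \<longlongrightarrow> - 1 / (real N + \<sigma>)) (at_right 0)"
    using Lim_transform_eventually by fastforce
  from lhopital_right_0[OF fmax_origin(2)[OF e] tendsto_powr_at_right_0[OF N\<sigma>_pos] nz dF dG this]
  have l: "((\<lambda>s. flux (e * \<beta>) (fmax e) (gmax e) s / s powr (real N + \<sigma>)) \<longlongrightarrow> - 1 / (real N + \<sigma>)) (at_right 0)" .
  have "((\<lambda>s. flux (e * \<beta>) (fmax e) (gmax e) s / s powr (real N + \<sigma>) - e * \<beta> * s powr (- \<sigma>) * fmax e s)
      \<longlongrightarrow> - 1 / (real N + \<sigma>) - e * \<beta> * 0 * 1) (at_right 0)"
    using \<sigma>_neg by (intro tendsto_intros l fmax_origin(1)[OF e] tendsto_powr_at_right_0) auto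
  moreover have "\<forall>\<^sub>F s in at_right 0. flux (e * \<beta>) (fmax e) (gmax e) s / s powr (real N + \<sigma>) - e * \<beta> * s powr (- \<sigma>) * fmax e s
     = gmax e s / s powr (1 + \<sigma>)"
    using ev
  proof (rule eventually_mono)
    fix s assume "s \<in> {0<..<R}"
    then have s: "0 < s" by simp
    define P where "P = s powr (real N - 1)"
    define Q where "Q = s powr (1 + \<sigma>)"
    have P: "0 < P" "0 < Q" using s by (simp_all add: P_def Q_def)
    have 1: "s powr real N = P * s" "s powr (real N + \<sigma>) = P * Q" "Q * s powr (- \<sigma>) = s"
      using powr_add[of s "real N - 1" 1] powr_add[of s "real N - 1" "1 + \<sigma>"] powr_add[of s "1 + \<sigma>" "- \<sigma>"] s
      by (simp_all add: P_def Q_def)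
    define V where "V = s powr (- \<sigma>)"
    have V: "Q * V = s" using 1(3) by (simp add: V_def)
    have "flux (e * \<beta>) (fmax e) (gmax e) s = P * (gmax e s + e * \<beta> * s * fmax e s)"
      unfolding flux_def 1(1) P_def[symmetric] by (simp add: algebra_simps)
    also have "\<dots> = P * (gmax e s + e * \<beta> * (Q * V) * fmax e s)" unfolding V ..
    finally show "flux (e * \<beta>) (fmax e) (gmax e) s / s powr (real N + \<sigma>) - e * \<beta> * s powr (- \<sigma>) * fmax e s
     = gmax e s / s powr (1 + \<sigma>)"
      unfolding 1(2) Q_def[symmetric] V_def[symmetric] using P by (simp add: field_simps)
  qed
  ultimately show ?thesis using Lim_transform_eventually by fastforce
qed

text \<open>L'Hopital's rule once more, now for \<open>f^(m-p)\<close>, whose derivative is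
  \<open>(m - p) / m * f^(-p) g\<close>; the normalisation \<open>f(0) = 1\<close> gives
  \<open>D = 1\<close>.\<close>

lemma fmax_expansion:
  assumes e: "0 \<le> e"
  shows "((\<lambda>s. (fmax e s powr (m - p) - 1) / s powr (\<sigma> + 2)) \<longlongrightarrow> - 1 * origin_coeff) (at_right 0)"
proof -
  obtain R where R: "0 < R" "sol (e * \<alpha>) (e * \<beta>) 1 R (fmax e) (gmax e)"
    using sol_near_origin[OF e] by metis
  note ev = eventually_at_right_real[OF R(1)]
  have s2: "0 < \<sigma> + 2" using \<sigma>_gt by simp
  define F' where "F' s = (m - p) / m * fmax e s powr (m - p - m) * gmax e s" for s
  define G' where "G' s = (\<sigma> + 2) * s powr (\<sigma> + 2 - 1)" for s
  have nz: "\<forall>\<^sub>F x in at_right 0. x powr (\<sigma> + 2) \<noteq> 0" "\<forall>\<^sub>F x in at_right 0. G' x \<noteq> 0"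
    using ev s2 by (auto elim!: eventually_mono simp: G'_def)
  have dF: "\<forall>\<^sub>F x in at_right 0. ((\<lambda>s. fmax e s powr (m - p) - 1) has_real_derivative F' x) (at x)"
    using ev
  proof (rule eventually_mono)
    fix x assume "x \<in> {0<..<R}"
    then show "((\<lambda>s. fmax e s powr (m - p) - 1) has_real_derivative F' x) (at x)"
      unfolding F'_def using DERIV_diff[OF sol_pow_deriv[OF R(2)] DERIV_const, of x "m - p" 1] by simp
  qed
  have dG: "\<forall>\<^sub>F x in at_right 0. ((\<lambda>x. x powr (\<sigma> + 2)) has_real_derivative G' x) (at x)"
    using ev unfolding G'_def by (rule eventually_mono) (auto intro!: derivative_eq_intros)
  have "((\<lambda>s. fmax e s powr (m - p) - 1) \<longlongrightarrow> 1 powr (m - p) - 1) (at_right 0)"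
    by (intro tendsto_intros fmax_origin(1)[OF e]) auto
  then have l0: "((\<lambda>s. fmax e s powr (m - p) - 1) \<longlongrightarrow> 0) (at_right 0)" by simp
  have "((\<lambda>s. (m - p) / m * fmax e s powr (m - p - m) * (gmax e s / s powr (1 + \<sigma>)) / (\<sigma> + 2))
     \<longlongrightarrow> (m - p) / m * 1 powr (m - p - m) * (- 1 / (real N + \<sigma>)) / (\<sigma> + 2)) (at_right 0)"
    using s2 by (intro tendsto_intros fmax_origin(1)[OF e] gmax_origin[OF e]) auto
  moreover have "(m - p) / m * 1 powr (m - p - m) * (- 1 / (real N + \<sigma>)) / (\<sigma> + 2) = - 1 * origin_coeff"
  proof -
    have "A / m * (- 1 / X) / Y = - 1 * (A / (m * X * Y))" for A X Y :: real by simp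
    from this[of "m - p" "real N + \<sigma>" "\<sigma> + 2"] show ?thesis unfolding origin_coeff_def powr_one_eq_one mult_1_right .
  qed
  moreover have "(\<lambda>s. (m - p) / m * fmax e s powr (m - p - m) * (gmax e s / s powr (1 + \<sigma>)) / (\<sigma> + 2)) = (\<lambda>s. F' s / G' s)"
    by (auto simp: F'_def G'_def fun_eq_iff add.commute mult_ac)
  ultimately have "((\<lambda>s. F' s / G' s) \<longlongrightarrow> - 1 * origin_coeff) (at_right 0)" by simp
  from lhopital_right_0[OF l0 tendsto_powr_at_right_0[OF s2] nz dF dG this] show ?thesis .
qed

lemma gmax_neg_origin:
  assumes e: "0 \<le> e"
  shows "\<forall>\<^sub>F s in at_right 0. gmax e s < 0"
proof -
  have "- 1 / (real N + \<sigma>) < 0" using N\<sigma>_pos by simp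
  from order_tendstoD(2)[OF gmax_origin[OF e] this] eventually_at_right_real[OF zero_less_one]
  show ?thesis
  proof eventually_elim
    case (elim s)
    have "0 < s powr (1 + \<sigma>)" using elim(2) by simp
    then show ?case using elim(1) by (simp add: divide_less_0_iff)
  qed
qed

text \<open>The parameters for which the solution turns back before reaching zero.\<close>
definition shoot :: "real set" where
  "shoot = {e. 0 \<le> e \<and> (\<exists>R\<in>pdom e. 0 < R \<and> EN e R < 0)}"

section \<open>Energy along the shooting family\<close>

lemma zero_notin_shoot: "0 \<notin> shoot"
proof
  assume "0 \<in> shoot"
  then obtain R where R: "EN 0 R < 0" by (auto simp: shoot_def)
  have "0 \<le> m / (m + p) * (R powr \<sigma> * fmax 0 R powr (m + p))" using m_gt p_ge by simp
  then show False using R zero_le_power2[of "gmax 0 R"] by (simp add: en_def)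
qed

lemma EN_depend:
  assumes R: "R \<in> pdom e0" "0 < R" and e0: "0 \<le> e0"
  shows "\<forall>\<^sub>F e in at e0 within {0..}. R \<in> pdom e"
    "((\<lambda>e. fmax e R) \<longlongrightarrow> fmax e0 R) (at e0 within {0..})"
    "((\<lambda>e. EN e R) \<longlongrightarrow> EN e0 R) (at e0 within {0..})"
proof -
  have ev: "\<forall>\<^sub>F e in at e0 within {0..}. R \<in> pdom e \<and> \<bar>wmax e R - wmax e0 R\<bar> < \<kappa> \<and> \<bar>gmax e R - gmax e0 R\<bar> < \<kappa>"
    if \<kappa>: "0 < \<kappa>" for \<kappa>
  proof -
    obtain r where r: "0 < r" "\<And>e. 0 \<le> e \<Longrightarrow> \<bar>e - e0\<bar> < r \<Longrightarrow>
       R \<in> pdom e \<and> \<bar>wmax e R - wmax e0 R\<bar> < \<kappa> \<and> \<bar>gmax e R - gmax e0 R\<bar> < \<kappa>"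
      using pdom_depend[OF R e0 \<kappa>] by metis
    then show ?thesis unfolding eventually_at by (intro exI[of _ r]) (auto simp: dist_real_def)
  qed
  show "\<forall>\<^sub>F e in at e0 within {0..}. R \<in> pdom e"
    using ev[OF zero_less_one] by (rule eventually_mono) auto
  have w: "((\<lambda>e. wmax e R) \<longlongrightarrow> wmax e0 R) (at e0 within {0..})"
  proof (rule tendstoI)
    fix \<kappa> :: real assume "0 < \<kappa>"
    from ev[OF this] show "\<forall>\<^sub>F e in at e0 within {0..}. dist (wmax e R) (wmax e0 R) < \<kappa>"
      by (rule eventually_mono) (simp add: dist_real_def)
  qed
  have g: "((\<lambda>e. gmax e R) \<longlongrightarrow> gmax e0 R) (at e0 within {0..})"
  proof (rule tendstoI)
    fix \<kappa> :: real assume "0 < \<kappa>"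
    from ev[OF this] show "\<forall>\<^sub>F e in at e0 within {0..}. dist (gmax e R) (gmax e0 R) < \<kappa>"
      by (rule eventually_mono) (simp add: dist_real_def)
  qed
  have wp: "wmax e0 R \<noteq> 0" using wmax_pos[OF R(1) e0] by simp
  show f: "((\<lambda>e. fmax e R) \<longlongrightarrow> fmax e0 R) (at e0 within {0..})"
    unfolding fmax_def using wp by (intro tendsto_intros w) auto
  have fp: "fmax e0 R \<noteq> 0" using fmax_pos[OF R(1) e0] by simp
  show "((\<lambda>e. EN e R) \<longlongrightarrow> EN e0 R) (at e0 within {0..})"
    unfolding en_def using m_gt p_ge fp by (intro tendsto_intros f g) auto
qed

lemma shoot_open:
  assumes e0: "e0 \<in> shoot"
  obtains r where "0 < r" "\<And>e. 0 \<le> e \<Longrightarrow> \<bar>e - e0\<bar> < r \<Longrightarrow> e \<in> shoot"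
proof -
  obtain R where R: "R \<in> pdom e0" "0 < R" "EN e0 R < 0" "0 \<le> e0" using e0 by (auto simp: shoot_def)
  from order_tendstoD(2)[OF EN_depend(3)[OF R(1,2,4)] R(3)] EN_depend(1)[OF R(1,2,4)]
  have "\<forall>\<^sub>F e in at e0 within {0..}. R \<in> pdom e \<and> EN e R < 0" by eventually_elim auto
  then obtain r where r: "0 < r" "\<And>e. 0 \<le> e \<Longrightarrow> e \<noteq> e0 \<Longrightarrow> \<bar>e - e0\<bar> < r \<Longrightarrow> R \<in> pdom e \<and> EN e R < 0"
    unfolding eventually_at by (auto simp: dist_real_def)
  show ?thesis
  proof (rule that[OF r(1)])
    fix e assume "0 \<le> e" "\<bar>e - e0\<bar> < r"
    then show "e \<in> shoot" using r(2)[of e] R e0 by (cases "e = e0") (auto simp: shoot_def)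
  qed
qed

lemma EN_decreasing:
  assumes "0 \<le> e" "0 < x" "x < y" "y \<in> pdom e"
  shows "EN e y < EN e x"
proof -
  obtain R where R: "y < R" "sol (e * \<alpha>) (e * \<beta>) 1 R (fmax e) (gmax e)" using pdom_sol[OF assms(4,1)] by metis
  show ?thesis
    by (rule en_strict_decreasing[OF R(2) _ zero_less_one assms(2,3) R(1)]) (use assms \<beta>_pos in simp)
qed

lemma gmax_neg_of_EN_pos:
  assumes e: "0 \<le> e" and S: "sol (e * \<alpha>) (e * \<beta>) 1 R (fmax e) (gmax e)"
    and pos: "\<And>s. 0 < s \<Longrightarrow> s < R \<Longrightarrow> 0 < EN e s" and s: "0 < s" "s < R"
  shows "gmax e s < 0"
proof -
  have "\<forall>\<^sub>F r in at_right 0. gmax e r < 0 \<and> r \<in> {0<..<s}"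
    using gmax_neg_origin[OF e] eventually_at_right_real[OF s(1)] by eventually_elim auto
  then obtain x0 where x0: "0 < x0" "x0 < s" "gmax e x0 < 0"
    using eventually_happens'[OF trivial_limit_at_right_real] by (metis (no_types, lifting) greaterThanLessThan_iff)
  show ?thesis
    by (rule energy_pos_imp_decreasing[OF S _ zero_less_one x0(1) _ x0(3)])
      (use x0 s e pos \<alpha>_pos in auto)
qed

text \<open>Outside \<open>shoot\<close> the energy is by definition only nonnegative, but it
  decreases strictly on a domain without last point and so is positive; then \<open>g\<close> stays
  negative, as it is near the origin.\<close>

lemma notin_shoot:
  assumes e: "0 \<le> e" "e \<notin> shoot" and s: "s \<in> pdom e" "0 < s"
  shows "0 < EN e s" "gmax e s < 0" "fmax e s \<le> 1" "\<And>r. 0 < r \<Longrightarrow> r < s \<Longrightarrow> fmax e s < fmax e r"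
proof -
  have pos: "0 < EN e s" if s: "s \<in> pdom e" "0 < s" for s
  proof -
    obtain R where R: "s < R" "R \<in> pdom e" using pdom_open[OF s(1) e(1)] .
    have "0 \<le> EN e R" using e R s by (force simp: shoot_def)
    then show ?thesis using EN_decreasing[OF e(1) s(2) R] by simp
  qed
  show "0 < EN e s" by (rule pos[OF s])
  obtain R where R: "s < R" "R \<in> pdom e" "sol (e * \<alpha>) (e * \<beta>) 1 R (fmax e) (gmax e)"
    using pdom_sol[OF s(1) e(1)] .
  have neg: "gmax e r < 0" if "0 < r" "r < R" for r
    by (rule gmax_neg_of_EN_pos[OF e(1) R(3) _ that]) (use pos pdom_mono[OF R(2)] in auto)
  show "gmax e s < 0" using neg s R by simp
  show dec: "fmax e s < fmax e r" if "0 < r" "r < s" for r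
    using sol_decreasing[OF R(3) neg that(1,2) R(1)] by simp
  have "\<forall>\<^sub>F r in at_right 0. fmax e s \<le> fmax e r"
    using eventually_at_right_real[OF s(2)] by (rule eventually_mono) (use dec in \<open>auto intro: less_imp_le\<close>)
  then show "fmax e s \<le> 1" by (intro tendsto_lowerbound[OF fmax_origin(1)[OF e(1)]]) auto
qed

section \<open>Extinction at a finite point\<close>

lemma pdom_unbounded:
  assumes "0 \<le> e" "\<not> bdd_above (pdom e)" "0 \<le> s"
  shows "s \<in> pdom e"
proof -
  have "\<exists>R\<in>pdom e. s < R" using assms(2) by (auto simp: bdd_above_def not_le)
  then show ?thesis using pdom_mono assms(3) by force
qed

lemma global_sol:
  assumes "0 \<le> e" "\<not> bdd_above (pdom e)"
  shows "sol (e * \<alpha>) (e * \<beta>) 1 R (fmax e) (gmax e)"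
proof -
  have "sol (e * \<alpha>) (e * \<beta>) 1 (max R 1) (fmax e) (gmax e)"
    by (rule fmax_sol[OF pdom_unbounded[OF assms] assms(1)]) simp
  then show ?thesis by (rule sol_subset) simp
qed

text \<open>For \<open>e > 0\<close>, positivity of the energy forces \<open>g \<le> - c f\<^bsup>(m+1)/2\<^esup>\<close> for large \<open>s\<close>; since
  \<open>(m+1)/2 < m\<close> this makes \<open>f\<close> vanish at a finite point.\<close>
lemma pdom_bounded_pos:
  assumes e: "0 < e" "e \<notin> shoot"
  shows "bdd_above (pdom e)"
proof (rule ccontr)
  assume n: "\<not> bdd_above (pdom e)"
  have e0: "0 \<le> e" using e by simp
  note dom = pdom_unbounded[OF e0 n]
  note S = global_sol[OF e0 n]
  \<comment> \<open>\<open>A f^(m+1)\<close> is the negative term of the energy. As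
    \<open>s^\<sigma>\<close> tends to 0 and \<open>f <= 1\<close>, the reaction term is eventually
    at most half of it, so positive energy gives \<open>g^2 >= A f^(m+1)\<close>.\<close>
  define A where "A = e * \<alpha> * m / (m + 1)"
  have A: "0 < A" using e \<alpha>_pos m_gt by (simp add: A_def)
  have "((\<lambda>s::real. s powr \<sigma>) \<longlongrightarrow> 0) at_top" using \<sigma>_neg by (intro tendsto_neg_powr filterlim_ident)
  from order_tendstoD(2)[OF this, of "A / 2"] A
  have "\<forall>\<^sub>F s in at_top. s powr \<sigma> < A / 2" by simp
  then obtain s1 where s1: "\<And>s. s1 \<le> s \<Longrightarrow> s powr \<sigma> < A / 2" unfolding eventually_at_top_linorder by auto
  define s2 where "s2 = max s1 1"
  define c where "c = (m - 1) / (2 * m) * sqrt A"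
  have c: "0 < c" using A m_gt by (simp add: c_def)
  \<comment> \<open>For this power of \<open>f\<close> the exponents cancel, and the derivative is
    at most the constant \<open>- c\<close>.\<close>
  define u where "u s = fmax e s powr ((m - 1) / 2)" for s
  have du: "(u has_real_derivative ((m - 1) / 2 / m) * fmax e s powr ((m - 1) / 2 - m) * gmax e s) (at s)"
    and du': "((m - 1) / 2 / m) * fmax e s powr ((m - 1) / 2 - m) * gmax e s \<le> - c" if s: "s2 \<le> s" for s
  proof -
    have s0: "0 < s" "s < s + 1" "s1 \<le> s" using s by (auto simp: s2_def)
    have sd: "s \<in> pdom e" using dom s0 by simp
    show "(u has_real_derivative ((m - 1) / 2 / m) * fmax e s powr ((m - 1) / 2 - m) * gmax e s) (at s)"
      unfolding u_def by (rule sol_pow_deriv[OF S s0(1,2)])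
    note N = notin_shoot[OF e0 e(2) sd s0(1)]
    have fp: "0 < fmax e s" using fmax_pos[OF sd e0] .
    have "m / (m + p) * (s powr \<sigma> * fmax e s powr (m + p)) \<le> 1 * (A / 2 * fmax e s powr (m + 1))"
      using s1[OF s0(3)] N(3) fp m_gt p_ge less_imp_le[OF A] by (intro mult_mono powr_mono') auto
    also have "\<dots> = A * fmax e s powr (m + 1) / 2" by simp
    finally have "m / (m + p) * (s powr \<sigma> * fmax e s powr (m + p)) \<le> A * fmax e s powr (m + 1) / 2" .
    moreover have "EN e s = (gmax e s)\<^sup>2 / 2 - A * fmax e s powr (m + 1) + m / (m + p) * (s powr \<sigma> * fmax e s powr (m + p))"
      by (simp add: en_def A_def)
    ultimately have "(gmax e s)\<^sup>2 \<ge> A * fmax e s powr (m + 1)" using N(1) by linarith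
    also have "A * fmax e s powr (m + 1) = (sqrt A * fmax e s powr ((m + 1) / 2))\<^sup>2"
    proof -
      have "fmax e s powr (m + 1) = (fmax e s powr ((m + 1) / 2))\<^sup>2"
        unfolding power2_eq_square powr_add[symmetric] by simp
      then show ?thesis using A by (simp add: power_mult_distrib)
    qed
    finally have "sqrt A * fmax e s powr ((m + 1) / 2) \<le> \<bar>gmax e s\<bar>"
      using A by (metis abs_ge_self abs_le_square_iff order_trans)
    then have g: "gmax e s \<le> - (sqrt A * fmax e s powr ((m + 1) / 2))" using N(2) by simp
    have "(m - 1) / 2 / m * fmax e s powr ((m - 1) / 2 - m) * gmax e s
      \<le> (m - 1) / 2 / m * fmax e s powr ((m - 1) / 2 - m) * - (sqrt A * fmax e s powr ((m + 1) / 2))"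
      using g m_gt by (intro mult_left_mono) auto
    also have "\<dots> = - ((m - 1) / 2 / m * sqrt A * (fmax e s powr ((m - 1) / 2 - m) * fmax e s powr ((m + 1) / 2)))"
      by simp
    also have "fmax e s powr ((m - 1) / 2 - m) * fmax e s powr ((m + 1) / 2) = 1"
      using fp by (simp add: field_simps flip: powr_add)
    finally show "((m - 1) / 2 / m) * fmax e s powr ((m - 1) / 2 - m) * gmax e s \<le> - c" by (simp add: c_def)
  qed
  \<comment> \<open>One unit beyond the point at which the linear bound for \<open>u\<close> reaches
    0.\<close>
  define s3 where "s3 = s2 + u s2 / c + 1"
  have "0 \<le> s2" by (simp add: s2_def)
  from fmax_pos[OF dom[OF this] e0] have u0: "0 < u s2" by (simp add: u_def)
  have s23: "s2 \<le> s3" using u0 c by (simp add: s3_def)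
  have "u s3 + c * s3 \<le> u s2 + c * s2"
  proof (rule DERIV_nonpos_imp_nonincreasing[of s2 s3 "\<lambda>s. u s + c * s"])
    fix s assume "s2 \<le> s" "s \<le> s3"
    from DERIV_add[OF du[OF this(1)] DERIV_cmult[OF DERIV_ident, of c]] du'[OF this(1)]
    show "\<exists>y. ((\<lambda>s. u s + c * s) has_real_derivative y) (at s) \<and> y \<le> 0" by (intro exI conjI) (assumption, simp)
  qed (rule s23)
  moreover have "c * s3 = c * s2 + u s2 + c" using c by (simp add: s3_def field_simps)
  ultimately have "u s3 < 0" using c by simp
  then show False by (simp add: u_def)
qed

text \<open>At \<open>e = 0\<close> the energy has no negative term to exploit, but the flux is just
  \<open>s^(N-1) g\<close> and can be integrated: \<open>f\<close> decreases, so
  \<open>g <= - s^(1+\<sigma>) f^p / (N + \<sigma>)\<close>, which bounds \<open>f^(m-p)\<close> by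
  \<open>1 - origin_coeff * s^(\<sigma>+2)\<close>.\<close>

lemma pdom_bounded_0: "bdd_above (pdom 0)"
proof (rule ccontr)
  assume n: "\<not> bdd_above (pdom 0)"
  note dom = pdom_unbounded[OF order_refl n]
  have S: "sol 0 0 1 R (fmax 0) (gmax 0)" for R using global_sol[OF order_refl n] by simp
  note N = notin_shoot[OF order_refl zero_notin_shoot dom]
  have s2: "0 < \<sigma> + 2" using \<sigma>_gt by simp
  have g: "gmax 0 s \<le> - (s powr (1 + \<sigma>) * fmax 0 s powr p / (real N + \<sigma>))" if s: "0 < s" for s
  proof -
    define v where "v r = flux 0 (fmax 0) (gmax 0) r + fmax 0 s powr p / (real N + \<sigma>) * r powr (real N + \<sigma>)" for r
    have "v s \<le> 0"
    proof (rule right_limit_bound[OF s])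
      have "(v \<longlongrightarrow> 0 + fmax 0 s powr p / (real N + \<sigma>) * 0) (at_right 0)"
        unfolding v_def using fmax_origin(2)[of 0] N\<sigma>_pos by (intro tendsto_intros tendsto_powr_at_right_0) auto
      then show "(v \<longlongrightarrow> 0) (at_right 0)" by simp
      fix r assume r: "0 < r" "r \<le> s"
      have d1: "((\<lambda>r. r powr (real N + \<sigma>)) has_real_derivative (real N + \<sigma>) * r powr (real N + \<sigma> - 1)) (at r)"
        using r by (auto intro!: derivative_eq_intros)
      have "r < r + 1" by simp
      note d2 = DERIV_add[OF flux_deriv[OF S r(1) this] DERIV_cmult[OF d1, of "fmax 0 s powr p / (real N + \<sigma>)"]]
      have e: "real N + \<sigma> - 1 = real N - 1 + \<sigma>" by simp
      show "(v has_real_derivative r powr (real N - 1 + \<sigma>) * (fmax 0 s powr p - fmax 0 r powr p)) (at r)"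
        unfolding v_def by (rule DERIV_cong[OF d2]) (use N\<sigma>_pos in \<open>simp add: right_diff_distrib e\<close>)
      have "fmax 0 s \<le> fmax 0 r" using N(4)[of s r] r s by (cases "r = s") auto
      then have "fmax 0 s powr p \<le> fmax 0 r powr p"
        using p_ge fmax_pos[OF dom order_refl, of s] s by (intro powr_mono2) auto
      then show "r powr (real N - 1 + \<sigma>) * (fmax 0 s powr p - fmax 0 r powr p) \<le> 0"
        by (intro mult_nonneg_nonpos) auto
    qed
    then have "s powr (real N - 1) * gmax 0 s \<le> - (fmax 0 s powr p / (real N + \<sigma>) * s powr (real N + \<sigma>))"
      by (simp add: v_def flux_def)
    also have "s powr (real N + \<sigma>) = s powr (real N - 1) * s powr (1 + \<sigma>)"
      by (simp flip: powr_add)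
    finally have "s powr (real N - 1) * gmax 0 s \<le> s powr (real N - 1) * - (s powr (1 + \<sigma>) * fmax 0 s powr p / (real N + \<sigma>))"
      by (simp add: mult_ac)
    from mult_left_le_imp_le[OF this] s show ?thesis by simp
  qed
  \<comment> \<open>A point at which the bound \<open>1 - origin_coeff * s^(\<sigma>+2)\<close>
    equals -1.\<close>
  define s where "s = (2 / origin_coeff) powr (1 / (\<sigma> + 2))"
  have s: "0 < s" using origin_coeff_pos by (simp add: s_def)
  have ss: "origin_coeff * s powr (\<sigma> + 2) = 2" using origin_coeff_pos s2 by (simp add: s_def powr_powr)
  define u where "u r = fmax 0 r powr (m - p) + origin_coeff * r powr (\<sigma> + 2)" for r
  have "u s \<le> 1"
  proof (rule right_limit_bound[OF s])
    have "(u \<longlongrightarrow> 1 powr (m - p) + origin_coeff * 0) (at_right 0)"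
      unfolding u_def using s2 by (intro tendsto_intros tendsto_powr_at_right_0 fmax_origin(1)) auto
    then show "(u \<longlongrightarrow> 1) (at_right 0)" by simp
    fix r assume r: "0 < r" "r \<le> s"
    define d where "d = (m - p) / m * fmax 0 r powr (m - p - m) * gmax 0 r + origin_coeff * ((\<sigma> + 2) * r powr (\<sigma> + 2 - 1))"
    have d1: "((\<lambda>r. r powr (\<sigma> + 2)) has_real_derivative (\<sigma> + 2) * r powr (\<sigma> + 2 - 1)) (at r)"
      using r by (auto intro!: derivative_eq_intros)
    have "r < r + 1" by simp
    from DERIV_add[OF sol_pow_deriv[OF S r(1) this, of "m - p"] DERIV_cmult[OF d1, of origin_coeff]]
    show "(u has_real_derivative d) (at r)" unfolding u_def d_def .
    have fp: "0 < fmax 0 r" using fmax_pos[OF dom order_refl, of r] r by simp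
    have "(m - p) / m * fmax 0 r powr (m - p - m) * gmax 0 r
       \<le> (m - p) / m * fmax 0 r powr (m - p - m) * - (r powr (1 + \<sigma>) * fmax 0 r powr p / (real N + \<sigma>))"
      using g[OF r(1)] p_lt_m m_gt by (intro mult_left_mono) auto
    also have "\<dots> = - ((m - p) / m * r powr (1 + \<sigma>) / (real N + \<sigma>) * (fmax 0 r powr (m - p - m) * fmax 0 r powr p))"
      by simp
    also have "fmax 0 r powr (m - p - m) * fmax 0 r powr p = 1" using fp by (simp flip: powr_add)
    also have "- ((m - p) / m * r powr (1 + \<sigma>) / (real N + \<sigma>) * 1) = - (origin_coeff * ((\<sigma> + 2) * r powr (\<sigma> + 2 - 1)))"
      using s2 by (simp add: origin_coeff_def add.commute)
    finally show "d \<le> 0" by (simp add: d_def)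
  qed
  then show False using ss powr_ge_zero[of "fmax 0 s" "m - p"] by (simp add: u_def)
qed

lemma pdom_bounded: "0 \<le> e \<Longrightarrow> e \<notin> shoot \<Longrightarrow> bdd_above (pdom e)"
  using pdom_bounded_pos[of e] pdom_bounded_0 by (cases "e = 0") auto

text \<open>\<open>L\<close> is half the squared slope of \<open>f\<^sup>m\<close> at the extinction point \<open>X\<close>.\<close>
lemma extinction:
  assumes e: "0 \<le> e" "e \<notin> shoot"
  obtains X L where "0 < X" "\<And>s. s \<in> pdom e \<longleftrightarrow> 0 \<le> s \<and> s < X" "sol (e * \<alpha>) (e * \<beta>) 1 X (fmax e) (gmax e)"
    "(fmax e \<longlongrightarrow> 0) (at_left X)" "(EN e \<longlongrightarrow> L) (at_left X)" "0 \<le> L" "\<And>s. 0 < s \<Longrightarrow> s < X \<Longrightarrow> L \<le> EN e s"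
    "(gmax e \<longlongrightarrow> - sqrt (2 * L)) (at_left X)"
proof -
  note bdd = pdom_bounded[OF e]
  define X where "X = Sup (pdom e)"
  have ne: "pdom e \<noteq> {}" using zero_in_pdom[OF e(1)] by auto
  obtain R where R: "0 < R" "R \<in> pdom e" using sol_near_origin[OF e(1)] by metis
  have X0: "0 < X" using cSup_upper[OF R(2) bdd] R(1) by (simp add: X_def)
  have dom: "s \<in> pdom e \<longleftrightarrow> 0 \<le> s \<and> s < X" for s
  proof
    assume s: "s \<in> pdom e"
    from pdom_open[OF this e(1)] obtain R' where "s < R'" "R' \<in> pdom e" .
    then show "0 \<le> s \<and> s < X" using cSup_upper[OF _ bdd, of R'] s by (auto simp: X_def pdom_def)
  next
    assume s: "0 \<le> s \<and> s < X"
    then obtain t where "t \<in> pdom e" "s < t" using less_cSup_iff[OF ne bdd] by (auto simp: X_def)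
    then show "s \<in> pdom e" using pdom_mono s by auto
  qed
  have S: "sol (e * \<alpha>) (e * \<beta>) 1 X (fmax e) (gmax e)"
    unfolding sol_def
  proof
    fix x assume "x \<in> {0<..<X}"
    then have x: "x \<in> pdom e" "0 < x" using dom by auto
    obtain R where R: "x < R" "sol (e * \<alpha>) (e * \<beta>) 1 R (fmax e) (gmax e)" using pdom_sol[OF x(1) e(1)] by metis
    show "0 < fmax e x \<and> (fmax e has_real_derivative gmax e x * fmax e x powr (1 - m) / m) (at x) \<and>
       (gmax e has_real_derivative - ((real N - 1) / x * gmax e x) + e * \<alpha> * fmax e x
        - e * \<beta> * x * (gmax e x * fmax e x powr (1 - m) / m) - 1 * x powr \<sigma> * fmax e x powr p) (at x)"
      using solD[OF R(2) x(2) R(1)] by blast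
  qed
  note N = notin_shoot[OF e]
  have f0: "(fmax e \<longlongrightarrow> 0) (at_left X)"
  proof (rule order_tendstoI)
    fix y :: real assume y: "y < 0"
    show "\<forall>\<^sub>F s in at_left X. y < fmax e s"
      using eventually_at_left_real[OF X0]
    proof (rule eventually_mono)
      fix s assume "s \<in> {0<..<X}"
      then have "s \<in> pdom e" using dom by simp
      from fmax_pos[OF this e(1)] show "y < fmax e s" using y by simp
    qed
  next
    fix y :: real assume y: "0 < y"
    obtain s where s: "s \<in> pdom e" "wmax e s < min 1 (y powr m)"
      using pdom_bounded_imp_inf_0[OF e(1) bdd, of "min 1 (y powr m)"] y by auto
    have s0: "0 < s" "s < X" using s dom wmax_0[OF e(1)] by (cases "s = 0"; auto)+
    have fs: "fmax e s < y"
    proof (rule ccontr)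
      assume "\<not> fmax e s < y"
      then have "y powr m \<le> fmax e s powr m" using y m_gt by (intro powr_mono2) auto
      then show False using s fmax_pow_m[OF s(1) e(1)] by simp
    qed
    show "\<forall>\<^sub>F s in at_left X. fmax e s < y"
      using eventually_at_left_real[OF s0(2)]
    proof (rule eventually_mono)
      fix r assume r: "r \<in> {s<..<X}"
      then have "r \<in> pdom e" "0 < r" using s0 dom by auto
      from N(4)[OF this s0(1)] show "fmax e r < y" using r fs by simp
    qed
  qed
  obtain L where L: "0 \<le> L" "(EN e \<longlongrightarrow> L) (at_left X)" "\<And>s. 0 < s \<Longrightarrow> s < X \<Longrightarrow> L \<le> EN e s"
  proof (rule tendsto_at_left_decreasing[OF X0, of "EN e" 0])
    show "EN e y \<le> EN e x" if "0 < x" "x < y" "y < X" for x y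
      using EN_decreasing[OF e(1) that(1,2)] dom that by (simp add: less_imp_le)
    show "0 \<le> EN e x" if "0 < x" "x < X" for x using N(1)[of x] dom that by (simp add: less_imp_le)
  next
    fix l assume "0 \<le> l" "(EN e \<longlongrightarrow> l) (at_left X)" "\<And>s. 0 < s \<Longrightarrow> s < X \<Longrightarrow> l \<le> EN e s"
    then show thesis by (rule that)
  qed
  have fn: "\<forall>\<^sub>F s in at_left X. 0 \<le> fmax e s"
    using eventually_at_left_real[OF X0] by (rule eventually_mono) (use solD(1)[OF S] in force)
  have pw: "((\<lambda>s. fmax e s powr q) \<longlongrightarrow> 0) (at_left X)" if "0 < q" for q
    using tendsto_powr2[OF f0 tendsto_const fn that] that by simp
  \<comment> \<open>As \<open>g\<close> is negative, it is the negative root in the definition of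
    the energy, in which the powers of \<open>f\<close> tend to 0.\<close>
  have "((\<lambda>s. - sqrt (2 * (EN e s + e * \<alpha> * m / (m + 1) * fmax e s powr (m + 1)
       - 1 * m / (m + p) * (s powr \<sigma> * fmax e s powr (m + p)))))
      \<longlongrightarrow> - sqrt (2 * (L + e * \<alpha> * m / (m + 1) * 0 - 1 * m / (m + p) * (X powr \<sigma> * 0)))) (at_left X)"
    using X0 m_gt p_ge by (intro tendsto_intros L(2) pw) auto
  moreover have "\<forall>\<^sub>F s in at_left X. - sqrt (2 * (EN e s + e * \<alpha> * m / (m + 1) * fmax e s powr (m + 1)
       - 1 * m / (m + p) * (s powr \<sigma> * fmax e s powr (m + p)))) = gmax e s"
    using eventually_at_left_real[OF X0]
  proof (rule eventually_mono)
    fix s assume "s \<in> {0<..<X}"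
    then have "gmax e s < 0" using N(2) dom by simp
    then show "- sqrt (2 * (EN e s + e * \<alpha> * m / (m + 1) * fmax e s powr (m + 1)
       - 1 * m / (m + p) * (s powr \<sigma> * fmax e s powr (m + p)))) = gmax e s"
      by (simp add: en_def)
  qed
  ultimately have "(gmax e \<longlongrightarrow> - sqrt (2 * L)) (at_left X)" using Lim_transform_eventually by fastforce
  then show ?thesis using that[OF X0 dom S f0 L(2,1,3)] by blast
qed

text \<open>A solution that reaches zero with a nonzero slope is stable: solutions with nearby parameters lose
  only little energy once they are small, so they also reach zero with positive energy.\<close>
lemma transversal_extinction_open:
  assumes e0: "0 \<le> e0" and X: "0 < X" "\<And>s. s \<in> pdom e0 \<longleftrightarrow> 0 \<le> s \<and> s < X"
    and lim: "(fmax e0 \<longlongrightarrow> 0) (at_left X)" "(EN e0 \<longlongrightarrow> L) (at_left X)" "0 < L" "\<And>s. 0 < s \<Longrightarrow> s < X \<Longrightarrow> L \<le> EN e0 s"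
  shows "\<forall>\<^sub>F e in at e0 within {0..}. e \<notin> shoot"
proof -
  define Xm where "Xm = X / 2"
  define a1 where "a1 = (e0 + 1) * \<alpha>"
  define b1 where "b1 = (e0 + 1) * \<beta>"
  have ab: "0 \<le> a1" "0 \<le> b1" using e0 \<alpha>_pos \<beta>_pos by (auto simp: a1_def b1_def)
  \<comment> \<open>Bounds for \<open>|g|\<close> while the energy lies between \<open>L / 2\<close>
    and \<open>2 L\<close> and \<open>f <= \<tau>\<close>: then \<open>g^2\<close> is at most
    \<open>4 L + 2 a1\<close> and at least \<open>L - L / 2\<close>.\<close>
  define Gm where "Gm = sqrt (4 * L + 2 * a1)"
  define c where "c = sqrt (L / 2)"
  have c: "0 < c" "c\<^sup>2 = L / 2" using lim by (auto simp: c_def)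
  have Gm: "0 \<le> Gm" "Gm\<^sup>2 = 4 * L + 2 * a1" using lim ab by (auto simp: Gm_def)
  have Xm: "0 < Xm" "Xm < X" using X by (auto simp: Xm_def)
  \<comment> \<open>The energy loss is charged to the decrease of \<open>f^m\<close> and of
    \<open>f\<close>: with these constants \<open>EN - A1 f^m - A2 f\<close> is nondecreasing. The
    drift loss contains \<open>g f^(1-m)\<close>, which is singular at \<open>f = 0\<close> but
    equals \<open>m f'\<close>.\<close>
  define A1 where "A1 = (real N - 1) / Xm * Gm + - \<sigma> * Xm powr (\<sigma> - 1) / c"
  define A2 where "A2 = b1 * (X + 1) * Gm"
  have A: "0 \<le> A1" "0 \<le> A2"
  proof -
    have "0 \<le> (real N - 1) / Xm * Gm"
      using N_ge Xm(1) Gm(1) by (intro mult_nonneg_nonneg divide_nonneg_nonneg) auto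
    moreover have "0 \<le> - \<sigma> * Xm powr (\<sigma> - 1) / c"
      using \<sigma>_neg c(1) by (intro mult_nonneg_nonneg divide_nonneg_nonneg) auto
    ultimately show "0 \<le> A1" by (simp add: A1_def)
    show "0 \<le> A2" using ab(2) X(1) Gm(1) unfolding A2_def by (intro mult_nonneg_nonneg) auto
  qed
  \<comment> \<open>The entries ensure, in turn, \<open>f <= 1\<close>, an energy loss of at most
    \<open>L / 8\<close>, a reaction term of at most \<open>L / 2\<close> in \<open>g^2\<close>, and
    a length of at most 1 for the interval from \<open>\<eta>\<close> to \<open>R'\<close>.\<close>
  define \<tau> where "\<tau> = min 1 (min (L / (8 * (A1 + A2 + 1))) (min (L / (4 * Xm powr \<sigma>)) c))"
  have \<tau>: "0 < \<tau>" "\<tau> \<le> 1" "\<tau> \<le> c" using lim(3) A c(1) Xm(1) by (simp_all add: \<tau>_def)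
  have \<tau>A: "(A1 + A2) * \<tau> \<le> L / 8"
  proof -
    define B where "B = A1 + A2 + 1"
    have B: "0 < B" "A1 + A2 \<le> B" using A by (simp_all add: B_def)
    have "\<tau> \<le> L / (8 * B)" by (simp add: \<tau>_def B_def)
    then have "\<tau> * (8 * B) \<le> L" using B(1) by (simp add: pos_le_divide_eq)
    moreover have "(A1 + A2) * \<tau> \<le> B * \<tau>" using B(2) \<tau>(1) by (intro mult_right_mono) auto
    moreover have "\<tau> * (8 * B) = 8 * (B * \<tau>)" by simp
    ultimately show ?thesis by linarith
  qed
  have \<tau>X: "2 * (Xm powr \<sigma> * \<tau>) \<le> L / 2"
  proof -
    have "\<tau> \<le> L / (4 * Xm powr \<sigma>)" by (simp add: \<tau>_def)
    then have "\<tau> * (4 * Xm powr \<sigma>) \<le> L" using Xm(1) by (simp add: pos_le_divide_eq)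
    moreover have "\<tau> * (4 * Xm powr \<sigma>) = 4 * (Xm powr \<sigma> * \<tau>)" by simp
    ultimately show ?thesis by linarith
  qed
  have "L < 2 * L" using lim(3) by simp
  from order_tendstoD(2)[OF lim(1) \<tau>(1)] order_tendstoD(2)[OF lim(2) this] eventually_at_left_real[OF Xm(2)]
  have "\<forall>\<^sub>F s in at_left X. fmax e0 s < \<tau> \<and> EN e0 s < 2 * L \<and> s \<in> {Xm<..<X}" by eventually_elim auto
  \<comment> \<open>The point at which continuity in \<open>e\<close> is used; beyond
    \<open>\<eta>\<close> the argument relies on the energy estimate.\<close>
  then obtain \<eta> where \<eta>: "fmax e0 \<eta> < \<tau>" "EN e0 \<eta> < 2 * L" "Xm < \<eta>" "\<eta> < X"
    using eventually_happens'[OF trivial_limit_at_left_real] by (metis (no_types, lifting) greaterThanLessThan_iff)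
  have \<eta>0: "0 < \<eta>" "\<eta> \<in> pdom e0" using \<eta> Xm X(2) by auto
  have EL: "3 / 4 * L < EN e0 \<eta>" using lim(4)[OF \<eta>0(1) \<eta>(4)] lim(3) by simp
  note D = EN_depend[OF \<eta>0(2,1) e0]
  have "\<forall>\<^sub>F e in at e0 within {0..}. e \<in> {0..} \<and> e < e0 + 1"
    using eventually_at_topological[of "\<lambda>e. e \<in> {0..} \<and> e < e0 + 1" e0 "{0..}"] by (auto intro!: exI[of _ "{..<e0+1}"])
  with D(1) order_tendstoD(2)[OF D(2) \<eta>(1)] order_tendstoD(2)[OF D(3) \<eta>(2)] order_tendstoD(1)[OF D(3) EL]
  show ?thesis
  proof eventually_elim
    case (elim e)
    then have e: "0 \<le> e" "e \<le> e0 + 1" and \<eta>d: "\<eta> \<in> pdom e" and f\<eta>: "fmax e \<eta> < \<tau>"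
      and E\<eta>: "EN e \<eta> < 2 * L" "3 / 4 * L < EN e \<eta>" by auto
    have ab1: "0 \<le> e * \<alpha>" "e * \<alpha> \<le> a1" "0 \<le> e * \<beta>" "e * \<beta> \<le> b1"
      using e \<alpha>_pos \<beta>_pos by (auto simp: a1_def b1_def)
    show "e \<notin> shoot"
    proof
      assume "e \<in> shoot"
      then obtain R where R: "R \<in> pdom e" "0 < R" "EN e R < 0" by (auto simp: shoot_def)
      have R\<eta>: "\<eta> < R"
      proof (rule ccontr)
        assume "\<not> \<eta> < R"
        then have "EN e \<eta> \<le> EN e R" using EN_decreasing[OF e(1) R(2) _ \<eta>d] by (cases "\<eta> = R") (auto simp: less_imp_le)
        then show False using E\<eta> R lim(3) by simp
      qed
      obtain R2 where R2: "R < R2" "R2 \<in> pdom e" "sol (e * \<alpha>) (e * \<beta>) 1 R2 (fmax e) (gmax e)"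
        using pdom_sol[OF R(1) e(1)] .
      have S: "sol (e * \<alpha>) (e * \<beta>) 1 R2 (fmax e) (gmax e)" by (rule R2(3))
      have contE: "continuous_on {\<eta>..R} (EN e)"
        using en_deriv[OF S] \<eta>0 R2 by (intro continuous_at_imp_continuous_on ballI DERIV_isCont[OF en_deriv[OF S]]) auto
      \<comment> \<open>Before turning negative the energy would have to cross the level
        \<open>L / 2\<close>; the estimates hold up to that crossing \<open>R'\<close>.\<close>
      have "\<exists>r\<ge>\<eta>. r \<le> R \<and> EN e r = L / 2"
        by (rule IVT2') (use contE R\<eta> R E\<eta> lim(3) in auto)
      then obtain R' where R': "\<eta> \<le> R'" "R' \<le> R" "EN e R' = L / 2" by blast
      have R'\<eta>: "\<eta> < R'" using R'(1,3) E\<eta> lim(3) by (cases "\<eta> = R'") auto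
      have R'2: "R' < R2" "R' \<in> pdom e" "0 < R'" using R' R2 pdom_mono[OF R(1)] \<eta>0 by auto
      have EN_ge: "L / 2 < EN e s" if "0 < s" "s < R'" for s
        using EN_decreasing[OF e(1) that R'2(2)] R'(3) by simp
      have neg: "gmax e s < 0" if "0 < s" "s < R'" for s
      proof (rule gmax_neg_of_EN_pos[OF e(1) sol_subset[OF S less_imp_le[OF R'2(1)]] _ that])
        show "0 < EN e r" if "0 < r" "r < R'" for r using EN_ge[OF that] lim(3) by simp
      qed
      have fp: "0 < fmax e s" if "0 < s" "s \<le> R'" for s using solD(1)[OF S that(1)] that R'2 by simp
      have f_nz: "fmax e s \<noteq> 0" if "s \<in> {\<eta>..R'}" for s using fp[of s] that \<eta>0(1) by simp
      have fcont: "continuous_on {\<eta>..R'} (fmax e)"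
        using sol_isCont(1)[OF S] \<eta>0 R'2 by (intro continuous_at_imp_continuous_on) auto
      have f_le: "fmax e s \<le> \<tau>" if "\<eta> \<le> s" "s < R'" for s
        using sol_decreasing[OF sol_subset[OF S less_imp_le[OF R'2(1)]] neg, of \<eta> s] that \<eta>0 f\<eta> by (cases "s = \<eta>") auto
      have g_bounds: "gmax e s \<le> - c" "- Gm \<le> gmax e s" if s: "\<eta> \<le> s" "s < R'" for s
      proof -
        have s0: "0 < s" "Xm \<le> s" using s \<eta> \<eta>0 by auto
        have f: "0 < fmax e s" "fmax e s \<le> \<tau>" "fmax e s \<le> 1" using fp[of s] f_le[OF s] s s0 \<tau> by auto
        have sE: "EN e s \<le> 2 * L" using EN_decreasing[OF e(1) \<eta>0(1), of s] s E\<eta> pdom_mono[OF R'2(2), of s] s0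
          by (cases "s = \<eta>") auto
        have gE: "(gmax e s)\<^sup>2 = 2 * EN e s + 2 * (e * \<alpha> * m / (m + 1) * fmax e s powr (m + 1))
            - 2 * (m / (m + p) * (s powr \<sigma> * fmax e s powr (m + p)))" by (simp add: en_def)
        have "fmax e s powr (m + p) \<le> fmax e s powr 1" using f m_gt p_ge by (intro powr_mono') auto
        then have fmp: "fmax e s powr (m + p) \<le> \<tau>" using f by simp
        have "m / (m + p) * (s powr \<sigma> * fmax e s powr (m + p)) \<le> 1 * (Xm powr \<sigma> * \<tau>)"
          using m_gt p_ge s0 Xm fmp \<sigma>_neg by (intro mult_mono powr_mono2') auto
        moreover have "0 \<le> m / (m + p) * (s powr \<sigma> * fmax e s powr (m + p))" using m_gt p_ge by simp
        moreover have "0 \<le> e * \<alpha> * m / (m + 1) * fmax e s powr (m + 1)" using ab1 m_gt by simp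
        moreover have "e * \<alpha> * m / (m + 1) * fmax e s powr (m + 1) \<le> a1 * 1"
        proof (rule mult_mono)
          have "e * \<alpha> * m / (m + 1) = e * \<alpha> * (m / (m + 1))" by simp
          also have "\<dots> \<le> a1 * 1" using ab1 ab m_gt by (intro mult_mono) auto
          finally show "e * \<alpha> * m / (m + 1) \<le> a1" by simp
          show "fmax e s powr (m + 1) \<le> 1" using f m_gt by (intro powr_le1) auto
        qed (use ab in auto)
        ultimately have "c\<^sup>2 \<le> (gmax e s)\<^sup>2" "(gmax e s)\<^sup>2 \<le> Gm\<^sup>2"
          using EN_ge[OF s0(1) s(2)] sE \<tau>X unfolding gE c(2) Gm(2) by linarith+
        then have "\<bar>c\<bar> \<le> \<bar>gmax e s\<bar>" "\<bar>gmax e s\<bar> \<le> \<bar>Gm\<bar>" by (simp_all only: abs_le_square_iff)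
        then show "gmax e s \<le> - c" "- Gm \<le> gmax e s" using neg[OF s0(1) s(2)] c(1) Gm(1) by simp_all
      qed
      have wd: "((\<lambda>s. fmax e s powr m) has_real_derivative gmax e s) (at s)" if "0 < s" "s \<le> R'" for s
        using sol_w_deriv[OF S that(1)] that R'2 by simp
      have w\<eta>: "fmax e \<eta> powr m \<le> \<tau>"
      proof -
        have "fmax e \<eta> powr m \<le> fmax e \<eta> powr 1"
          using fp[of \<eta>] \<eta>0 R'\<eta> f\<eta> \<tau> m_gt by (intro powr_mono') auto
        then show ?thesis using f\<eta> fp[of \<eta>] \<eta>0 R'\<eta> by simp
      qed
      \<comment> \<open>\<open>f^m\<close> starts below \<open>\<tau> <= c\<close> and falls at rate
        at least \<open>c\<close>, so \<open>R'\<close> lies within distance 1 of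
        \<open>\<eta>\<close>; this gives the bound \<open>s <= X + 1\<close> built into
        \<open>A2\<close>.\<close>
      have "fmax e R' powr m + c * R' \<le> fmax e \<eta> powr m + c * \<eta>"
      proof (rule DERIV_nonpos_imp_decreasing_open[of \<eta> R' "\<lambda>s. fmax e s powr m + c * s"])
        fix s assume s: "\<eta> < s" "s < R'"
        have "((\<lambda>s. fmax e s powr m + c * s) has_real_derivative gmax e s + c * 1) (at s)"
          by (intro DERIV_add wd DERIV_cmult DERIV_ident) (use s \<eta>0 in auto)
        moreover have "gmax e s + c * 1 \<le> 0" using g_bounds(1)[of s] s by simp
        ultimately show "\<exists>y. ((\<lambda>s. fmax e s powr m + c * s) has_real_derivative y) (at s) \<and> y \<le> 0" by blast
      next
        show "continuous_on {\<eta>..R'} (\<lambda>s. fmax e s powr m + c * s)"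
          using f_nz by (intro continuous_intros fcont) auto
      qed (use R'\<eta> in simp)
      then have "c * (R' - \<eta>) \<le> \<tau>"
        unfolding right_diff_distrib using w\<eta> powr_ge_zero[of "fmax e R'" m] by linarith
      also have "\<tau> \<le> c * 1" using \<tau> by simp
      finally have "R' - \<eta> \<le> 1" using c(1) by (simp only: mult_le_cancel_left_pos)
      then have R'X: "R' \<le> X + 1" using \<eta> by simp
      define \<Phi> where "\<Phi> s = EN e s - A1 * fmax e s powr m - A2 * fmax e s" for s
      have "\<Phi> \<eta> \<le> \<Phi> R'"
      proof (rule DERIV_nonneg_imp_increasing_open[of \<eta> R' \<Phi>])
        fix s assume s: "\<eta> < s" "s < R'"
        then have s0: "0 < s" "Xm \<le> s" "s < R2" "s \<le> X + 1" using \<eta>0 R'2 \<eta> R'X by auto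
        define f' where "f' = gmax e s * fmax e s powr (1 - m) / m"
        define d where "d = (- ((real N - 1) / s * (gmax e s)\<^sup>2) - e * \<beta> * s * ((gmax e s)\<^sup>2 * fmax e s powr (1 - m) / m)
            + 1 * \<sigma> * m / (m + p) * (s powr (\<sigma> - 1) * fmax e s powr (m + p))) - A1 * gmax e s - A2 * f'"
        have "(\<Phi> has_real_derivative d) (at s)"
          unfolding \<Phi>_def d_def f'_def
          by (intro DERIV_diff en_deriv[OF S s0(1,3)] DERIV_cmult sol_w_deriv[OF S s0(1,3)] solD(2)[OF S s0(1,3)])
        moreover have "0 \<le> d"
        proof -
          have s1: "\<eta> \<le> s" using s by simp
          note g = g_bounds[OF s1 s(2)]
          have g0: "gmax e s < 0" using g c by linarith
          have f: "0 < fmax e s" "fmax e s \<le> 1" using fp[of s] f_le[OF s1 s(2)] s s0 \<tau> by auto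
          have f': "f' \<le> 0" using g0 m_gt by (simp add: f'_def divide_nonpos_pos mult_nonpos_nonneg)
          have "(real N - 1) / s * (gmax e s)\<^sup>2 \<le> (real N - 1) / Xm * (Gm * - gmax e s)"
          proof (rule mult_mono)
            show "(real N - 1) / s \<le> (real N - 1) / Xm" using s0 Xm N_ge by (intro divide_left_mono) auto
            show "(gmax e s)\<^sup>2 \<le> Gm * - gmax e s"
              using g g0 mult_right_mono[of "- gmax e s" Gm "- gmax e s"] by (simp add: power2_eq_square)
          qed (use N_ge Xm in auto)
          moreover have "e * \<beta> * s * ((gmax e s)\<^sup>2 * fmax e s powr (1 - m) / m) \<le> A2 * - f'"
          proof -
            have "e * \<beta> * s * ((gmax e s)\<^sup>2 * fmax e s powr (1 - m) / m) = (e * \<beta> * s * - gmax e s) * - f'"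
              by (simp add: f'_def power2_eq_square)
            also have "\<dots> \<le> (b1 * (X + 1) * Gm) * - f'"
              using ab1 ab s0 X g g0 f' by (intro mult_right_mono mult_mono mult_nonneg_nonneg) auto
            finally show ?thesis by (simp add: A2_def)
          qed
          moreover have "- \<sigma> * (m / (m + p)) * (s powr (\<sigma> - 1) * fmax e s powr (m + p)) \<le> - \<sigma> * Xm powr (\<sigma> - 1) / c * - gmax e s"
          proof -
            have "(m / (m + p)) * (s powr (\<sigma> - 1) * fmax e s powr (m + p)) \<le> 1 * (Xm powr (\<sigma> - 1) * 1)"
              using m_gt p_ge s0 Xm \<sigma>_neg f by (intro mult_mono powr_mono2' powr_le1) auto
            also have "\<dots> \<le> Xm powr (\<sigma> - 1) * (- gmax e s / c)"
            proof -
              have "1 \<le> - gmax e s / c" by (subst pos_le_divide_eq[OF c(1)]) (use g(1) in simp)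
              then show ?thesis unfolding mult_1 by (rule mult_left_mono[OF _ powr_ge_zero])
            qed
            finally have "- \<sigma> * ((m / (m + p)) * (s powr (\<sigma> - 1) * fmax e s powr (m + p))) \<le> - \<sigma> * (Xm powr (\<sigma> - 1) * (- gmax e s / c))"
              using \<sigma>_neg by (intro mult_left_mono) auto
            then show ?thesis by (simp add: mult_ac)
          qed
          moreover have "A1 * - gmax e s = (real N - 1) / Xm * (Gm * - gmax e s) + - \<sigma> * Xm powr (\<sigma> - 1) / c * - gmax e s"
            by (simp only: A1_def distrib_right mult.assoc)
          moreover have "1 * \<sigma> * m / (m + p) * (s powr (\<sigma> - 1) * fmax e s powr (m + p))
              = - (- \<sigma> * (m / (m + p)) * (s powr (\<sigma> - 1) * fmax e s powr (m + p)))" by simp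
          ultimately show ?thesis unfolding d_def by linarith
        qed
        ultimately show "\<exists>y. (\<Phi> has_real_derivative y) (at s) \<and> 0 \<le> y" by blast
      next
        have "continuous_on {\<eta>..R'} (EN e)" using contE R' by (auto intro: continuous_on_subset)
        then show "continuous_on {\<eta>..R'} \<Phi>"
          unfolding \<Phi>_def using f_nz by (intro continuous_intros fcont) auto
      qed (use R'\<eta> in simp)
      then have "EN e \<eta> - A1 * fmax e \<eta> powr m - A2 * fmax e \<eta> \<le> L / 2"
        unfolding \<Phi>_def R'(3)
        using mult_nonneg_nonneg[OF A(1) powr_ge_zero[of "fmax e R'" m]]
          mult_nonneg_nonneg[OF A(2) less_imp_le[OF fp[OF R'2(3) order_refl]]] by linarith
      moreover have "A1 * fmax e \<eta> powr m \<le> A1 * \<tau>" "A2 * fmax e \<eta> \<le> A2 * \<tau>"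
        using A w\<eta> f\<eta> by (auto intro!: mult_left_mono)
      \<comment> \<open>A loss of at most \<open>L / 8\<close> cannot bring the energy from above
        \<open>3 / 4 * L\<close> down to \<open>L / 2\<close>.\<close>
      ultimately have "EN e \<eta> \<le> L / 2 + (A1 + A2) * \<tau>" by (simp add: distrib_right)
      then show False using \<tau>A E\<eta> lim(3) by simp
    qed
  qed
qed

text \<open>For \<open>e = 0\<close> the flux is \<open>s^(N-1) g\<close>, nonincreasing and already
  negative inside, so its limit at \<open>X\<close> is not 0. This keeps the critical parameter away
  from 0.\<close>

lemma transversal_at_0:
  assumes X: "0 < X" "\<And>s. s \<in> pdom 0 \<longleftrightarrow> 0 \<le> s \<and> s < X" and S: "sol 0 0 1 X (fmax 0) (gmax 0)"
    and g: "(gmax 0 \<longlongrightarrow> - sqrt (2 * L)) (at_left X)"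
  shows "L \<noteq> 0"
proof
  assume L: "L = 0"
  have neg: "gmax 0 s < 0" if "0 < s" "s < X" for s
    using notin_shoot(2)[OF order_refl zero_notin_shoot] X that by simp
  define c where "c = X / 2"
  have c: "0 < c" "c < X" using X by (auto simp: c_def)
  have dec: "flux 0 (fmax 0) (gmax 0) s \<le> flux 0 (fmax 0) (gmax 0) c" if s: "c < s" "s < X" for s
  proof (rule DERIV_nonpos_imp_nonincreasing[of c s "flux 0 (fmax 0) (gmax 0)"])
    fix r assume "c \<le> r" "r \<le> s"
    then have r: "0 < r" "r < X" using c s by auto
    have "0 \<le> r powr (real N - 1 + \<sigma>) * fmax 0 r powr p" by simp
    then show "\<exists>y. (flux 0 (fmax 0) (gmax 0) has_real_derivative y) (at r) \<and> y \<le> 0"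
      using flux_deriv[OF S r] by (intro exI conjI) (assumption, simp)
  qed (use s in simp)
  have "(flux 0 (fmax 0) (gmax 0) \<longlongrightarrow> X powr (real N - 1) * - sqrt (2 * L)) (at_left X)"
    unfolding flux_def [abs_def] mult_zero_left add_0_right using X by (intro tendsto_intros g) auto
  then have "0 \<le> flux 0 (fmax 0) (gmax 0) c"
    using dec eventually_at_left_real[OF c(2)] unfolding L
    by (intro tendsto_upperbound[of _ 0 "at_left X"]) (auto elim!: eventually_mono)
  moreover have "flux 0 (fmax 0) (gmax 0) c < 0"
    using neg[OF c] c by (simp add: flux_def mult_pos_neg)
  ultimately show False by simp
qed

text \<open>If \<open>shoot\<close> were empty, \<open>f\<close> would decrease from 1 for every
  \<open>e\<close>, and integrating the flux would bound \<open>g\<close> below by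
  \<open>e \<alpha> / N s f - s^(1+\<sigma>) / (N + \<sigma>)\<close>. The second term alone keeps
  \<open>f^m >= 1/2\<close> up to a point \<open>\<eta>\<close> independent of \<open>e\<close>;
  there a suitable \<open>e\<close> makes \<open>g\<close> nonnegative, a contradiction.\<close>

lemma shoot_nonempty: "shoot \<noteq> {}"
proof
  assume empty: "shoot = {}"
  define C where "C = 1 / ((real N + \<sigma>) * (\<sigma> + 2))"
  have s2: "0 < \<sigma> + 2" using \<sigma>_gt by simp
  have C: "0 < C" "C * (\<sigma> + 2) = 1 / (real N + \<sigma>)" using s2 N\<sigma>_pos by (auto simp: C_def)
  define \<eta> where "\<eta> = (1 / (2 * C)) powr (1 / (\<sigma> + 2))"
  have \<eta>: "0 < \<eta>" "C * \<eta> powr (\<sigma> + 2) = 1 / 2" using C s2 by (auto simp: \<eta>_def powr_powr)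
  \<comment> \<open>For this \<open>e\<close> the two terms of the lower bound for \<open>g\<close>
    balance at \<open>\<eta>\<close> if \<open>f(\<eta>)\<close> takes its least possible value
    \<open>(1/2)^(1/m)\<close>.\<close>
  define e where "e = (\<eta> powr (1 + \<sigma>) / (real N + \<sigma>)) / (\<alpha> / real N * \<eta> * (1 / 2) powr (1 / m))"
  have N0: "0 < real N" using N_ge by simp
  have den: "0 < \<alpha> / real N * \<eta> * (1 / 2) powr (1 / m)" using \<alpha>_pos N0 \<eta> by simp
  have e: "0 \<le> e" unfolding e_def by (rule divide_nonneg_pos[OF _ den]) (use N\<sigma>_pos in simp)
  have ns: "e \<notin> shoot" using empty by simp
  note N = notin_shoot[OF e ns]
  let ?f = "fmax e" and ?g = "gmax e"
  have g_low: "e * \<alpha> / real N * s * ?f s - s powr (1 + \<sigma>) / (real N + \<sigma>) \<le> ?g s" if s: "s \<in> pdom e" "0 < s" for s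
  proof -
    obtain R where R: "s < R" "R \<in> pdom e" "sol (e * \<alpha>) (e * \<beta>) 1 R ?f ?g" using pdom_sol[OF s(1) e] .
    define k where "k = e * \<alpha> + real N * (e * \<beta>)"
    have k: "0 \<le> k" using e \<alpha>_pos \<beta>_pos by (simp add: k_def)
    \<comment> \<open>The flux is compared with the integral of its source after \<open>f r\<close>
      has been replaced by the smaller \<open>f s\<close> in the linear part and by 1 in the
      reaction.\<close>
    define v where "v r = (k * ?f s / real N) * r powr real N - 1 / (real N + \<sigma>) * r powr (real N + \<sigma>) - flux (e * \<beta>) ?f ?g r" for r
    have "v s \<le> 0"
    proof (rule right_limit_bound[OF s(2)])
      have "(v \<longlongrightarrow> (k * ?f s / real N) * 0 - 1 / (real N + \<sigma>) * 0 - 0) (at_right 0)"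
        unfolding v_def by (intro tendsto_intros tendsto_powr_at_right_0 fmax_origin(2)[OF e] N0 N\<sigma>_pos)
      then show "(v \<longlongrightarrow> 0) (at_right 0)" by simp
      fix r assume r: "0 < r" "r \<le> s"
      define d where "d = (k * ?f s / real N) * (real N * r powr (real N - 1)) - 1 / (real N + \<sigma>) * ((real N + \<sigma>) * r powr (real N + \<sigma> - 1))
        - (k * (r powr (real N - 1) * ?f r) - 1 * (r powr (real N - 1 + \<sigma>) * ?f r powr p))"
      have p1: "((\<lambda>r. r powr real N) has_real_derivative real N * r powr (real N - 1)) (at r)"
        "((\<lambda>r. r powr (real N + \<sigma>)) has_real_derivative (real N + \<sigma>) * r powr (real N + \<sigma> - 1)) (at r)"
        using r by (auto intro!: derivative_eq_intros)
      have rR: "r < R" using r R by simp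
      show "(v has_real_derivative d) (at r)"
        unfolding v_def d_def k_def by (intro DERIV_diff DERIV_cmult p1 flux_deriv[OF R(3) r(1) rR])
      have rd: "r \<in> pdom e" using pdom_mono[OF s(1)] r by simp
      have N1: "real N + \<sigma> - 1 = real N - 1 + \<sigma>" by simp
      have "d = k * r powr (real N - 1) * (?f s - ?f r) + r powr (real N - 1 + \<sigma>) * (?f r powr p - 1)"
        unfolding d_def using N0 N\<sigma>_pos by (simp add: right_diff_distrib N1)
      moreover have "?f s \<le> ?f r" using N(4)[OF s r(1)] r by (cases "r = s") auto
      moreover have "?f r powr p \<le> 1"
        using N(3)[OF rd r(1)] fmax_pos[OF rd e] p_ge by (intro powr_le1) auto
      ultimately show "d \<le> 0" using k by (auto intro!: add_nonpos_nonpos mult_nonneg_nonpos)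
    qed
    then have "(k * ?f s / real N) * s powr real N - 1 / (real N + \<sigma>) * s powr (real N + \<sigma>) \<le> flux (e * \<beta>) ?f ?g s"
      by (simp add: v_def)
    moreover have "s powr real N = s powr (real N - 1) * s" "s powr (real N + \<sigma>) = s powr (real N - 1) * s powr (1 + \<sigma>)"
      using s powr_add[of s "real N - 1" 1] by (simp_all flip: powr_add)
    ultimately have "s powr (real N - 1) * ((k * ?f s / real N) * s - 1 / (real N + \<sigma>) * s powr (1 + \<sigma>))
        \<le> s powr (real N - 1) * (?g s + e * \<beta> * s * ?f s)"
      by (simp add: flux_def algebra_simps)
    then have "(k * ?f s / real N) * s - 1 / (real N + \<sigma>) * s powr (1 + \<sigma>) \<le> ?g s + e * \<beta> * s * ?f s"
      by (rule mult_left_le_imp_le) (use s in simp)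
    \<comment> \<open>The part \<open>e \<beta>\<close> of \<open>k / N\<close> matches the drift in
      the flux and cancels.\<close>
    moreover have "(k * ?f s / real N) * s = e * \<alpha> / real N * s * ?f s + e * \<beta> * s * ?f s"
      using N0 by (simp add: k_def field_simps)
    ultimately show ?thesis by simp
  qed
  have w_low: "1 - C * s powr (\<sigma> + 2) \<le> wmax e s" if s: "s \<in> pdom e" "0 < s" for s
  proof -
    obtain R where R: "s < R" "R \<in> pdom e" "sol (e * \<alpha>) (e * \<beta>) 1 R ?f ?g" using pdom_sol[OF s(1) e] .
    define v where "v r = - (?f r powr m) - C * r powr (\<sigma> + 2)" for r
    have "v s \<le> - 1"
    proof (rule right_limit_bound[OF s(2)])
      have "(v \<longlongrightarrow> - (1 powr m) - C * 0) (at_right 0)"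
        unfolding v_def by (intro tendsto_intros tendsto_powr_at_right_0 fmax_origin(1)[OF e] s2) auto
      then show "(v \<longlongrightarrow> - 1) (at_right 0)" by simp
      fix r assume r: "0 < r" "r \<le> s"
      have p1: "((\<lambda>r. r powr (\<sigma> + 2)) has_real_derivative (\<sigma> + 2) * r powr (\<sigma> + 2 - 1)) (at r)"
        using r by (auto intro!: derivative_eq_intros)
      have rR: "r < R" using r R by simp
      show "(v has_real_derivative - ?g r - C * ((\<sigma> + 2) * r powr (\<sigma> + 2 - 1))) (at r)"
        unfolding v_def by (intro DERIV_diff DERIV_minus DERIV_cmult p1 sol_w_deriv[OF R(3) r(1) rR])
      have rd: "r \<in> pdom e" using pdom_mono[OF s(1)] r by simp
      have "C * ((\<sigma> + 2) * r powr (\<sigma> + 2 - 1)) = r powr (1 + \<sigma>) / (real N + \<sigma>)"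
        unfolding mult.assoc[symmetric] C(2) by (simp add: add.commute)
      moreover have "0 \<le> e * \<alpha> / real N * r * ?f r"
        using e \<alpha>_pos r fmax_pos[OF rd e] by simp
      ultimately show "- ?g r - C * ((\<sigma> + 2) * r powr (\<sigma> + 2 - 1)) \<le> 0" using g_low[OF rd r(1)] by linarith
    qed
    then show ?thesis using fmax_pow_m[OF s(1) e] by (simp add: v_def)
  qed
  have w_half: "1 / 2 \<le> wmax e s" if s: "s \<in> pdom e" "s \<le> \<eta>" for s
  proof (cases "s = 0")
    case True
    then show ?thesis using wmax_0[OF e] by simp
  next
    case False
    then have s0: "0 < s" using s by (simp add: pdom_def)
    have "C * s powr (\<sigma> + 2) \<le> C * \<eta> powr (\<sigma> + 2)" using C s s0 s2 by (intro mult_left_mono powr_mono2) auto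
    then show ?thesis using w_low[OF s(1) s0] \<eta> by simp
  qed
  have \<eta>d: "\<eta> \<in> pdom e"
  proof (rule ccontr)
    assume n: "\<eta> \<notin> pdom e"
    obtain s where s: "s \<in> pdom e" "wmax e s < 1 / 2"
      by (rule pdom_bounded_imp_inf_0[OF e pdom_bounded[OF e ns], of "1/2"]) auto
    have "s \<le> \<eta>" using pdom_mono[OF s(1), of \<eta>] n \<eta> by (cases "s \<le> \<eta>") auto
    then show False using w_half[OF s(1)] s(2) by simp
  qed
  have "(1 / 2) powr (1 / m) \<le> ?f \<eta>"
    unfolding fmax_def using w_half[OF \<eta>d] m_gt by (intro powr_mono2) auto
  then have "e * \<alpha> / real N * \<eta> * (1 / 2) powr (1 / m) \<le> e * \<alpha> / real N * \<eta> * ?f \<eta>"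
    using e \<alpha>_pos \<eta> by (intro mult_left_mono) auto
  moreover have "e * \<alpha> / real N * \<eta> * (1 / 2) powr (1 / m) = e * (\<alpha> / real N * \<eta> * (1 / 2) powr (1 / m))" by simp
  moreover have "e * (\<alpha> / real N * \<eta> * (1 / 2) powr (1 / m)) = \<eta> powr (1 + \<sigma>) / (real N + \<sigma>)"
    by (rule iffD1[OF nonzero_eq_divide_eq[OF less_imp_neq[OF den, symmetric]] e_def])
  ultimately have "0 \<le> ?g \<eta>" using g_low[OF \<eta>d \<eta>(1)] by linarith
  then show False using N(2)[OF \<eta>d \<eta>(1)] by simp
qed

section \<open>The critical parameter and the return to the original coefficients\<close>

lemma prof_exists: "\<exists>D R f g. prof \<alpha> \<beta> 1 D R f g"
proof -
  have bdd: "bdd_below shoot" by (rule bdd_belowI[of _ 0]) (auto simp: shoot_def)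
  define e where "e = Inf shoot"
  have e0: "0 \<le> e" unfolding e_def using shoot_nonempty by (intro cInf_greatest) (auto simp: shoot_def)
  have lower: "e \<le> x" if "x \<in> shoot" for x unfolding e_def by (rule cInf_lower[OF that bdd])
  \<comment> \<open>\<open>shoot\<close> is open in the closed half line and does not contain 0, so
    it has no least element.\<close>
  have ens: "e \<notin> shoot"
  proof
    assume es: "e \<in> shoot"
    then have epos: "0 < e" using e0 zero_notin_shoot by (cases "e = 0") auto
    obtain r where r: "0 < r" "\<And>x. 0 \<le> x \<Longrightarrow> \<bar>x - e\<bar> < r \<Longrightarrow> x \<in> shoot" using shoot_open[OF es] by metis
    define x where "x = e - min (e / 2) (r / 2)"
    have "0 \<le> x" "\<bar>x - e\<bar> < r" "x < e" using epos r(1) by (auto simp: x_def min_def)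
    then show False using r(2)[of x] lower[of x] by simp
  qed
  obtain X L where X: "0 < X" "\<And>s. s \<in> pdom e \<longleftrightarrow> 0 \<le> s \<and> s < X" "sol (e * \<alpha>) (e * \<beta>) 1 X (fmax e) (gmax e)"
    "(fmax e \<longlongrightarrow> 0) (at_left X)" "(EN e \<longlongrightarrow> L) (at_left X)" "0 \<le> L" "\<And>s. 0 < s \<Longrightarrow> s < X \<Longrightarrow> L \<le> EN e s"
    "(gmax e \<longlongrightarrow> - sqrt (2 * L)) (at_left X)"
    using extinction[OF e0 ens] by metis
  \<comment> \<open>A positive \<open>L\<close> would keep all parameters near \<open>e\<close> out
    of \<open>shoot\<close>, although \<open>e\<close> is its infimum.\<close>
  have L: "L = 0"
  proof (rule ccontr)
    assume "L \<noteq> 0"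
    then have "0 < L" using X(6) by simp
    from transversal_extinction_open[OF e0 X(1,2,4,5) this X(7)]
    obtain r where r: "0 < r" "\<And>x. 0 \<le> x \<Longrightarrow> x \<noteq> e \<Longrightarrow> \<bar>x - e\<bar> < r \<Longrightarrow> x \<notin> shoot"
      unfolding eventually_at by (auto simp: dist_real_def)
    obtain x where x: "x \<in> shoot" "x < e + r"
      using cInf_less_iff[OF shoot_nonempty bdd, of "e + r"] r(1) by (auto simp: e_def)
    have "e \<le> x" "x \<noteq> e" using lower[OF x(1)] x(1) ens by auto
    then show False using r(2)[of x] x e0 by auto
  qed
  have "e \<noteq> 0"
  proof
    assume "e = 0"
    then show False using transversal_at_0[of X L] X(1,2,3,8) L by simp
  qed
  then have epos: "0 < e" using e0 by simp
  have P: "prof (e * \<alpha>) (e * \<beta>) 1 1 X (fmax e) (gmax e)"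
    unfolding prof_def vanishing_def using X(1,3,4,8) L fmax_expansion[OF e0] by simp
  \<comment> \<open>\<open>\<Delta>\<close> is the common denominator of \<open>\<alpha>\<close> and
    \<open>\<beta>\<close>. The relations \<open>x1\<close> and \<open>x2\<close> are those that
    make the self-similar ansatz consistent; they say that rescaling with
    \<open>\<mu> = e^\<alpha>\<close> and \<open>\<nu> = e^(-\<beta>)\<close> divides
    \<open>e\<close> out of the first two coefficients and keeps \<open>k = 1\<close>.\<close>
  define \<Delta> where "\<Delta> = \<sigma> * (m - 1) + 2 * (p - 1)"
  have \<Delta>: "\<Delta> < 0" using ss_denominator_neg[OF p_crit] by (simp add: \<Delta>_def)
  have \<alpha>\<beta>: "\<alpha> * \<Delta> = - (\<sigma> + 2)" "\<beta> * \<Delta> = - (m - p)"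
    unfolding ss_alpha_def ss_beta_def \<Delta>_def[symmetric] using \<Delta> by auto
  have x1: "\<alpha> * (m - 1) + - \<beta> * 2 + 1 = 0"
  proof -
    have "(\<alpha> * (m - 1) + - \<beta> * 2 + 1) * \<Delta> = (\<alpha> * \<Delta>) * (m - 1) - 2 * (\<beta> * \<Delta>) + \<Delta>" by (simp add: algebra_simps)
    also have "\<dots> = 0" unfolding \<alpha>\<beta> by (simp add: \<Delta>_def algebra_simps)
    finally show ?thesis using \<Delta> by simp
  qed
  have x2: "\<alpha> * (m - p) + - \<beta> * (\<sigma> + 2) = 0"
  proof -
    have "(\<alpha> * (m - p) + - \<beta> * (\<sigma> + 2)) * \<Delta> = (\<alpha> * \<Delta>) * (m - p) - (\<beta> * \<Delta>) * (\<sigma> + 2)" by (simp add: algebra_simps)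
    also have "\<dots> = 0" unfolding \<alpha>\<beta> by (simp add: algebra_simps)
    finally show ?thesis using \<Delta> by simp
  qed
  have "(e powr - \<beta>)\<^sup>2 = e powr (- \<beta> * 2)"
    unfolding power2_eq_square powr_add[symmetric] by (simp only: mult_2_right)
  then have "(e powr \<alpha>) powr (m - 1) * (e powr - \<beta>)\<^sup>2 * e = e powr (\<alpha> * (m - 1)) * e powr (- \<beta> * 2) * e powr 1"
    using epos by (simp only: powr_powr powr_one)
  also have "\<dots> = e powr (\<alpha> * (m - 1) + - \<beta> * 2 + 1)" by (simp only: powr_add)
  finally have s1: "(e powr \<alpha>) powr (m - 1) * (e powr - \<beta>)\<^sup>2 * e = 1" unfolding x1 using epos by simp
  have "(e powr \<alpha>) powr (m - p) * (e powr - \<beta>) powr (\<sigma> + 2) = e powr (\<alpha> * (m - p) + - \<beta> * (\<sigma> + 2))"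
    by (simp only: powr_powr powr_add[of e "\<alpha> * (m - p)" "- \<beta> * (\<sigma> + 2)"])
  then have s2: "(e powr \<alpha>) powr (m - p) * (e powr - \<beta>) powr (\<sigma> + 2) = 1" unfolding x2 using epos by simp
  have s1': "(e powr \<alpha>) powr (m - 1) * (e powr - \<beta>)\<^sup>2 * (e * c) = c" for c
    using s1 by (simp flip: mult.assoc)
  have "0 < e powr \<alpha>" "0 < e powr - \<beta>" using epos by auto
  from prof_scale[OF P this] show ?thesis unfolding s1' s2 mult_1_right by blast
qed

theorem profile_exists_unique:
  "\<exists>f R. is_profile N m \<sigma> p f R
      \<and> (\<forall>g S. is_profile N m \<sigma> p g S \<longrightarrow> S = R \<and> (\<forall>x\<in>{0<..<R}. g x = f x))
      \<and> strict_antimono_on {0<..<R} f"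
proof -
  obtain D R f g where P: "prof \<alpha> \<beta> 1 D R f g" using prof_exists by blast
  have S: "sol \<alpha> \<beta> 1 R f g" using P by (simp add: prof_def)
  have neg: "g x < 0" if "0 < x" "x < R" for x
    using prof_deriv_neg[OF P _ _ zero_less_one that] \<alpha>_pos \<beta>_pos by simp
  have "strict_antimono_on {0<..<R} f"
    by (rule monotone_onI) (use sol_decreasing[OF S neg] in auto)
  moreover have "h = R \<and> (\<forall>x\<in>{0<..<R}. u x = f x)" if u: "is_profile N m \<sigma> p u h" for u h
  proof -
    obtain D' where "prof \<alpha> \<beta> 1 D' h u (deriv (\<lambda>x. u x powr m))" using is_profile_imp_prof[OF u] .
    from prof_unique[OF P this] show ?thesis by auto
  qed
  ultimately show ?thesis using prof_imp_is_profile[OF P] by blast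
qed

end

theorem theorem1p1:
  fixes N :: nat and m \<sigma> p :: real
  assumes "N \<ge> 1"
    and "m > 1"
    and "-2 < \<sigma>" and "\<sigma> < 0"
    and "1 \<le> p" and "p < crit_exp m \<sigma>"
    and "N = 1 \<Longrightarrow> \<sigma> > -1"
  shows "\<exists>f \<xi>\<^sub>0. is_profile N m \<sigma> p f \<xi>\<^sub>0
      \<and> (\<forall>g \<eta>\<^sub>0. is_profile N m \<sigma> p g \<eta>\<^sub>0 \<longrightarrow>
            \<eta>\<^sub>0 = \<xi>\<^sub>0 \<and> (\<forall>\<xi>\<in>{0<..<\<xi>\<^sub>0}. g \<xi> = f \<xi>))
      \<and> strict_antimono_on {0<..<\<xi>\<^sub>0} f"
proof -
  interpret profile_equation N m \<sigma> p
    by unfold_locales (use assms in auto)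
  show ?thesis by (rule profile_exists_unique)
qed

end
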